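(* Let $\{a_m\}$, $\{\tau_m\}$ and $\{J_m\}$ be positive sequences ($J_m$ integers) with $\tau_m\to0$, $J_m\tau_m\to\infty$, $a_m\to0$, $\sum_m a_m=\infty$ and $\sum_m a_m^2J_m^{-1}\tau_m^{-2}<\infty$. Let $\{\hat\theta_m\}$ be the random sequence generated by the iterated importance sampling algorithm described in the context. Assume: (i) the perturbation density $\kappa$ is supported on a compact set $K_0\subset\mathbb{R}^p$; (ii) $\ell(\theta)=\log f_Y(y^*;\theta)$ is twice differentiable, and for any compact set $K_1\subset\mathbb{R}^p$, $\sup_{\theta\in K_1}|\nabla\ell(\theta)|<\infty$ and $\sup_{\theta\in K_1}|\nabla^2\ell(\theta)|<\infty$; (iii) for any compact set $K_3\subset\mathbb{R}^p$, $\sup_{\theta\in K_3,\,x\in\mathfrak{X}}f_{Y|X}(y^*\mid x;\theta)<\infty$; (iv) writing $\zeta(t)$ for a solution to $d\zeta/dt=\nabla\ell(\zeta(t))$, the maximum likelihood estimate $\hat\theta=\arg\max_\theta\ell(\theta)$ is an asymptotically stable equilibrium point, meaning that (a) for every $\eta>0$ there exists $\delta(\eta)$ such that $|\zeta(t)-\hat\theta|\le\eta$ for all $t>0$ whenever $|\zeta(0)-\hat\theta|\le\delta(\eta)$, and (b) there exists $\delta_0$ such that $\zeta(t)\to\hat\theta$ as $t\to\infty$ whenever $|\zeta(0)-\hat\theta|\le\delta_0$; (v) with probability one, $\sup_m|\hat\theta_m|<\infty$; further, $\hat\theta_m$ falls infinitely often into a compact subset of $\{\zeta(0):\lim_{t\to\infty}\zeta(t)=\hat\theta\}$.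 Then $\lim_{m\to\infty}\hat\theta_m=\hat\theta$ with probability one.
   Context: Latent variable model: $f_{XY}(x,y;\theta)$ is the joint density of a pair of random variables $(X,Y)$ with values in a measurable space $\mathfrak{X}\times\mathfrak{Y}$, depending on a parameter $\theta\in\mathbb{R}^p$, with respect to a $\sigma$-finite product measure. $f_X(x;\theta)$ and $f_Y(y;\theta)$ are the marginal densities of $X$ and $Y$, and $f_{Y|X}(y\mid x;\theta)$ is the conditional density of $Y$ given $X$. The data are a fixed value $y^*\in\mathfrak{Y}$, $\ell(\theta)=\log f_Y(y^*;\theta)$ is the log likelihood, and $\hat\theta=\arg\max_\theta\ell(\theta)$ is the maximum likelihood estimate. Iterated importance sampling algorithm: let $\kappa$ be a probability density on $\mathbb{R}^p$ (with respect to Lebesgue measure) with compact support, zero mean and positive definite covariance matrix $\breve\Sigma$. Given an initial parameter estimate $\hat\theta_1$, positive sequences $\{\tau_m\}$, $\{a_m\}$ and positive integers $\{J_m\}$, for $m=1,2,\ldots$: - for $j=1,\ldots,J_m$: draw $Z_{j,m}\sim\kappa$ and set $\breve\Theta_{j,m}=\hat\theta_m+\tau_mZ_{j,m}$; draw $\breve X_{j,m}\sim f_X(\cdot\,;\breve\Theta_{j,m})$; set $w_j=f_{Y|X}(y^*\mid\breve X_{j,m};\breve\Theta_{j,m})$; - set $D_m=\tau_m^{-2}\breve\Sigma^{-1}\Big\{\big(\sum_{j=1}^{J_m}w_j\big)^{-1}\big(\sum_{j=1}^{J_m}w_j\breve\Theta_{j,m}\big)-\hat\theta_m\Big\}$;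 - set $\hat\theta_{m+1}=\hat\theta_m+a_mD_m$. The Monte Carlo random variables required at each iteration are drawn independently; probability statements concern this Monte Carlo randomness, with the data $y^*$ fixed. Notation: $\nabla$ is the column-vector gradient, $\nabla^2$ the matrix of second derivatives; $|\cdot|$ is the absolute value (norm) of a vector or the largest absolute eigenvalue of a square matrix. *)

theory Defs
  imports "HOL-Probability.Probability"
begin

section \<open>Vector calculus and matrices\<close>

definition grad :: "(real^'p \<Rightarrow> real) \<Rightarrow> real^'p \<Rightarrow> real^'p" where
  "grad l \<theta> = (\<chi> i. frechet_derivative l (at \<theta>) (axis i 1))"

definition hess :: "(real^'p \<Rightarrow> real) \<Rightarrow> real^'p \<Rightarrow> real^'p^'p" where
  "hess l \<theta> = jacobian (grad l) (at \<theta>)"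

definition twice_differentiable :: "(real^'p \<Rightarrow> real) \<Rightarrow> bool" where
  "twice_differentiable l \<longleftrightarrow>
     (\<forall>\<theta>. l differentiable (at \<theta>)) \<and> (\<forall>\<theta>. grad l differentiable (at \<theta>))"

definition eigenvalues :: "real^'n^'n \<Rightarrow> complex set" where
  "eigenvalues A =
     {c. \<exists>v::complex^'n. v \<noteq> 0 \<and> map_matrix complex_of_real A *v v = c *s v}"

text \<open>The set of eigenvalues is finite and nonempty, so this supremum is a maximum.\<close>

definition max_abs_eigenvalue :: "real^'n^'n \<Rightarrow> real" where
  "max_abs_eigenvalue A = (SUP c\<in>eigenvalues A. cmod c)"

definition positive_definite :: "real^'n^'n \<Rightarrow> bool" where
  "positive_definite A \<longleftrightarrow> transpose A = A \<and> (\<forall>v. v \<noteq> 0 \<longrightarrow> 0 < v \<bullet> (A *v v))"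

definition mean_vector :: "(real^'p) measure \<Rightarrow> real^'p" where
  "mean_vector N = (\<integral>z. z \<partial>N)"

definition covariance_matrix :: "(real^'p) measure \<Rightarrow> real^'p^'p" where
  "covariance_matrix N =
     (\<chi> i j. \<integral>z. (z $ i - mean_vector N $ i) * (z $ j - mean_vector N $ j) \<partial>N)"

section \<open>Latent variable model\<close>

definition marginal_X ::
  "'y measure \<Rightarrow> (real^'p \<Rightarrow> 'x \<Rightarrow> 'y \<Rightarrow> real) \<Rightarrow> real^'p \<Rightarrow> 'x \<Rightarrow> real" where
  "marginal_X \<nu> f \<theta> x = (\<integral>y. f \<theta> x y \<partial>\<nu>)"

definition marginal_Y ::
  "'x measure \<Rightarrow> (real^'p \<Rightarrow> 'x \<Rightarrow> 'y \<Rightarrow> real) \<Rightarrow> real^'p \<Rightarrow> 'y \<Rightarrow> real" where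
  "marginal_Y \<mu> f \<theta> y = (\<integral>x. f \<theta> x y \<partial>\<mu>)"

definition log_likelihood ::
  "'x measure \<Rightarrow> (real^'p \<Rightarrow> 'x \<Rightarrow> 'y \<Rightarrow> real) \<Rightarrow> 'y \<Rightarrow> real^'p \<Rightarrow> real" where
  "log_likelihood \<mu> f y \<theta> = ln (marginal_Y \<mu> f \<theta> y)"

text \<open>Joint measurability in the parameter is what makes sampling at a random parameter value
  meaningful.\<close>

definition joint_density ::
  "'x measure \<Rightarrow> 'y measure \<Rightarrow> (real^'p \<Rightarrow> 'x \<Rightarrow> 'y \<Rightarrow> real) \<Rightarrow> bool" where
  "joint_density \<mu> \<nu> f \<longleftrightarrow>
     (\<lambda>(\<theta>, x, y). f \<theta> x y) \<in> borel_measurable (borel \<Otimes>\<^sub>M (\<mu> \<Otimes>\<^sub>M \<nu>)) \<and>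
     (\<forall>\<theta>. \<forall>x\<in>space \<mu>. \<forall>y\<in>space \<nu>. 0 \<le> f \<theta> x y) \<and>
     (\<forall>\<theta>. prob_space (density (\<mu> \<Otimes>\<^sub>M \<nu>) (\<lambda>(x, y). ennreal (f \<theta> x y))))"

text \<open>\<open>g \<theta> x y\<close> is the conditional density of \<open>Y\<close> at \<open>y\<close> given \<open>X = x\<close>. It is a given
  version of the quotient of the joint density by the marginal density of \<open>X\<close>, with no
  convention imposed where that marginal vanishes. The factorization is required at every \<open>y\<close>,
  because a single observed value \<open>y\<close> may have measure zero.\<close>

definition conditional_density ::
  "'x measure \<Rightarrow> 'y measure \<Rightarrow> (real^'p \<Rightarrow> 'x \<Rightarrow> 'y \<Rightarrow> real) \<Rightarrow>
   (real^'p \<Rightarrow> 'x \<Rightarrow> 'y \<Rightarrow> real) \<Rightarrow> bool" where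
  "conditional_density \<mu> \<nu> f g \<longleftrightarrow>
     (\<lambda>(\<theta>, x, y). g \<theta> x y) \<in> borel_measurable (borel \<Otimes>\<^sub>M (\<mu> \<Otimes>\<^sub>M \<nu>)) \<and>
     (\<forall>\<theta>. \<forall>x\<in>space \<mu>. \<forall>y\<in>space \<nu>. 0 \<le> g \<theta> x y) \<and>
     (\<forall>\<theta>. \<forall>y\<in>space \<nu>. AE x in \<mu>. f \<theta> x y = marginal_X \<nu> f \<theta> x * g \<theta> x y)"

section \<open>Iterated importance sampling\<close>

definition perturbation_density :: "(real^'p \<Rightarrow> real) \<Rightarrow> bool" where
  "perturbation_density \<kappa> \<longleftrightarrow>
     \<kappa> \<in> borel_measurable borel \<and> (\<forall>z. 0 \<le> \<kappa> z) \<and> prob_space (density lborel \<kappa>) \<and>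
     mean_vector (density lborel \<kappa>) = 0 \<and>
     positive_definite (covariance_matrix (density lborel \<kappa>))"

text \<open>Joint law of \<open>(Z, X)\<close> when \<open>Z\<close> has density \<open>\<kappa>\<close> and, given \<open>Z\<close>, the
  variable \<open>X\<close> has density \<open>fX (\<theta> + t Z)\<close>.\<close>

definition pair_law ::
  "'x measure \<Rightarrow> (real^'p \<Rightarrow> 'x \<Rightarrow> real) \<Rightarrow> (real^'p \<Rightarrow> real) \<Rightarrow> real \<Rightarrow> real^'p \<Rightarrow>
   ((real^'p) \<times> 'x) measure" where
  "pair_law \<mu> fX \<kappa> t \<theta> =
     density (lborel \<Otimes>\<^sub>M \<mu>) (\<lambda>(z, x). ennreal (\<kappa> z * fX (\<theta> + t *\<^sub>R z) x))"

text \<open>The sigma-algebra of the draws made in the iterations before the \<open>m\<close>-th. Iterations and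
  draws are both counted from \<open>0\<close>.\<close>

definition history ::
  "'w measure \<Rightarrow> 'x measure \<Rightarrow> (nat \<Rightarrow> nat) \<Rightarrow> (nat \<Rightarrow> nat \<Rightarrow> 'w \<Rightarrow> real^'p) \<Rightarrow>
   (nat \<Rightarrow> nat \<Rightarrow> 'w \<Rightarrow> 'x) \<Rightarrow> nat \<Rightarrow> 'w measure" where
  "history P \<mu> J Z X m = sigma (space P)
     (\<Union>k\<in>{..<m}. \<Union>j\<in>{..<J k}.
        {Z k j -` B \<inter> space P | B. B \<in> sets borel} \<union>
        {X k j -` B \<inter> space P | B. B \<in> sets \<mu>})"

definition batch ::
  "(nat \<Rightarrow> nat) \<Rightarrow> (nat \<Rightarrow> nat \<Rightarrow> 'w \<Rightarrow> real^'p) \<Rightarrow> (nat \<Rightarrow> nat \<Rightarrow> 'w \<Rightarrow> 'x) \<Rightarrow>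
   nat \<Rightarrow> 'w \<Rightarrow> nat \<Rightarrow> (real^'p) \<times> 'x" where
  "batch J Z X m \<omega> = (\<lambda>j\<in>{..<J m}. (Z m j \<omega>, X m j \<omega>))"

text \<open>Conditionally on all earlier iterations, the pairs \<open>(Z m j, X m j)\<close> with \<open>j < J m\<close> are
  independent draws from \<open>pair_law\<close> at the current estimate \<open>\<Theta> m\<close>.\<close>

definition monte_carlo_draws ::
  "'w measure \<Rightarrow> 'x measure \<Rightarrow> (real^'p \<Rightarrow> 'x \<Rightarrow> real) \<Rightarrow> (real^'p \<Rightarrow> real) \<Rightarrow>
   (nat \<Rightarrow> real) \<Rightarrow> (nat \<Rightarrow> nat) \<Rightarrow> (nat \<Rightarrow> 'w \<Rightarrow> real^'p) \<Rightarrow>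
   (nat \<Rightarrow> nat \<Rightarrow> 'w \<Rightarrow> real^'p) \<Rightarrow> (nat \<Rightarrow> nat \<Rightarrow> 'w \<Rightarrow> 'x) \<Rightarrow> bool" where
  "monte_carlo_draws P \<mu> fX \<kappa> \<tau> J \<Theta> Z X \<longleftrightarrow>
     (\<forall>m. \<forall>j<J m. Z m j \<in> borel_measurable P \<and> X m j \<in> measurable P \<mu>) \<and>
     (\<forall>m. \<forall>B\<in>sets (Pi\<^sub>M {..<J m} (\<lambda>_. borel \<Otimes>\<^sub>M \<mu>)).
        AE \<omega> in P.
          real_cond_exp P (history P \<mu> J Z X m)
            (indicator (batch J Z X m -` B \<inter> space P)) \<omega>
          = measure (Pi\<^sub>M {..<J m} (\<lambda>_. pair_law \<mu> fX \<kappa> (\<tau> m) (\<Theta> m \<omega>))) B)"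

text \<open>The direction \<open>D\<close> computed from \<open>n\<close> draws \<open>z j\<close>, \<open>x j\<close>; \<open>S\<close> is the covariance matrix
  of the perturbations and \<open>c \<theta> x\<close> is the weight, the conditional density of the data. If all
  weights vanish, the ratio of sums is \<open>0\<close>.\<close>

definition iis_direction ::
  "(real^'p \<Rightarrow> 'x \<Rightarrow> real) \<Rightarrow> real^'p^'p \<Rightarrow> real \<Rightarrow> nat \<Rightarrow> real^'p \<Rightarrow>
   (nat \<Rightarrow> real^'p) \<Rightarrow> (nat \<Rightarrow> 'x) \<Rightarrow> real^'p" where
  "iis_direction c S t n \<theta> z x =
     (let \<theta>' = (\<lambda>j. \<theta> + t *\<^sub>R z j);
          w = (\<lambda>j. c (\<theta>' j) (x j))
      in inverse (t\<^sup>2) *\<^sub>R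
           (matrix_inv S *v
              (inverse (\<Sum>j<n. w j) *\<^sub>R (\<Sum>j<n. w j *\<^sub>R \<theta>' j) - \<theta>)))"

primrec iis_estimate ::
  "(real^'p \<Rightarrow> 'x \<Rightarrow> real) \<Rightarrow> real^'p^'p \<Rightarrow> (nat \<Rightarrow> real) \<Rightarrow> (nat \<Rightarrow> real) \<Rightarrow> (nat \<Rightarrow> nat) \<Rightarrow>
   real^'p \<Rightarrow> (nat \<Rightarrow> nat \<Rightarrow> 'w \<Rightarrow> real^'p) \<Rightarrow> (nat \<Rightarrow> nat \<Rightarrow> 'w \<Rightarrow> 'x) \<Rightarrow>
   nat \<Rightarrow> 'w \<Rightarrow> real^'p" where
  "iis_estimate c S a \<tau> J \<theta>1 Z X 0 \<omega> = \<theta>1"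
| "iis_estimate c S a \<tau> J \<theta>1 Z X (Suc m) \<omega> =
     iis_estimate c S a \<tau> J \<theta>1 Z X m \<omega> +
     a m *\<^sub>R iis_direction c S (\<tau> m) (J m) (iis_estimate c S a \<tau> J \<theta>1 Z X m \<omega>)
              (\<lambda>j. Z m j \<omega>) (\<lambda>j. X m j \<omega>)"

section \<open>Gradient flow\<close>

definition gradient_flow :: "(real^'p \<Rightarrow> real) \<Rightarrow> (real \<Rightarrow> real^'p) \<Rightarrow> bool" where
  "gradient_flow l \<zeta> \<longleftrightarrow>
     (\<forall>t\<ge>0. (\<zeta> has_vector_derivative grad l (\<zeta> t)) (at t within {0..}))"

definition asymptotically_stable :: "(real^'p \<Rightarrow> real) \<Rightarrow> real^'p \<Rightarrow> bool" where
  "asymptotically_stable l \<theta> \<longleftrightarrow>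
     (\<forall>\<eta>>0. \<exists>\<delta>>0. \<forall>\<zeta>. gradient_flow l \<zeta> \<and> norm (\<zeta> 0 - \<theta>) \<le> \<delta> \<longrightarrow>
        (\<forall>t>0. norm (\<zeta> t - \<theta>) \<le> \<eta>)) \<and>
     (\<exists>\<delta>>0. \<forall>\<zeta>. gradient_flow l \<zeta> \<and> norm (\<zeta> 0 - \<theta>) \<le> \<delta> \<longrightarrow> (\<zeta> \<longlongrightarrow> \<theta>) at_top)"

definition attraction_domain :: "(real^'p \<Rightarrow> real) \<Rightarrow> real^'p \<Rightarrow> (real^'p) set" where
  "attraction_domain l \<theta> = {\<zeta> 0 | \<zeta>. gradient_flow l \<zeta> \<and> (\<zeta> \<longlongrightarrow> \<theta>) at_top}"

end

theory Submission
  imports Defs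
begin

text \<open>
  One iteration moves \<open>\<Theta> m\<close> by \<open>a m\<close> times the computed direction. The proof shows that this direction is
  the gradient of the log likelihood \<open>l\<close> plus a vanishing bias and martingale noise, and then that such a
  scheme follows the gradient flow and is caught by the maximum.

  \<^emph>\<open>Direction.\<close> Write \<open>S\<close> for the covariance matrix of the perturbation. Up to the factor \<open>1 / \<tau>\<close>, the
  direction is a self-normalized average of \<open>S\<^sup>-\<^sup>1 z\<close> whose weights integrate, over the latent variable, to the
  likelihood at \<open>\<theta> + \<tau> z\<close>. Taylor expansion of the likelihood and the moments of the perturbation give the
  gradient up to \<open>O(\<tau>)\<close> (\<open>tilted_mean_approximates_gradient\<close>). Normalizing by random weights costs a bias
  \<open>O(1 / (\<tau> J))\<close>, and the variance is \<open>O(1 / (\<tau>\<^sup>2 J))\<close> (\<open>self_normalized_estimate\<close>,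
  \<open>direction_mean_and_variance\<close>). The case that all weights vanish has exponentially small probability in \<open>J\<close>,
  which beats the powers of \<open>1 / \<tau>\<close> since \<open>J \<tau> \<longrightarrow> \<infinity>\<close>.

  \<^emph>\<open>Noise.\<close> The variances of the noise weighted by \<open>a m\<close> are summable, so the noise series converges almost
  surely by Kolmogorov's maximal inequality (\<open>martingale_difference_series_converges\<close>). The estimates are
  localized to a ball; countably many balls exhaust the bounded paths (\<open>noise_decomposition\<close>).

  \<^emph>\<open>Convergence.\<close> On a fixed path the noise is absorbed into the iterates. The bound on the eigenvalues of the
  Hessian makes the gradient locally Lipschitz, because the Hessian is symmetric. A discrete Gronwall estimate
  then shows that the iterates follow a flow line from a limit point in the domain of attraction into every
  neighbourhood of the maximum likelihood estimate. By asymptotic stability the latter is an isolated critical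
  point, hence a strict local maximum, and \<open>l\<close> serves as a Lyapunov function that keeps the iterates near it
  (\<open>strict_maximum_trap\<close>, \<open>noisy_gradient_ascent_converges\<close>). Global solutions of the differential equation are
  never constructed.
\<close>

section \<open>Symmetric Hessians and Lipschitz gradients\<close>

text \<open>The mean value theorem along \<open>u\<close>, applied to \<open>y \<mapsto> f (y + s v) - f y\<close>, reduces the second
  difference to an increment of the gradient \<open>g\<close>. Only differentiability of \<open>g\<close> at the one point
  \<open>x\<close> is needed, not continuity of the second derivative.\<close>

lemma second_difference_bound:
  fixes f :: "'a::euclidean_space \<Rightarrow> real"
  assumes f: "\<And>x. (f has_derivative (\<lambda>h. g x \<bullet> h)) (at x)"
    and g: "(g has_derivative H) (at x)" and e: "e > 0"
  shows "\<exists>d>0. \<forall>s. 0 < s \<and> s < d \<longrightarrow>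
    \<bar>f (x + s *\<^sub>R u + s *\<^sub>R v) - f (x + s *\<^sub>R u) - f (x + s *\<^sub>R v) + f x - s\<^sup>2 * (u \<bullet> H v)\<bar> \<le> e * s\<^sup>2"
proof -
  interpret H: bounded_linear H using g by (rule has_derivative_bounded_linear)
  \<comment> \<open>the summands \<open>1\<close> only serve to make both constants positive\<close>
  define C where "C = 2 * norm u + norm v + 1"
  define D where "D = norm u + norm v + 1"
  have CD: "C > 0" "D > 0" by (auto simp: C_def D_def add_nonneg_pos)
  define e' where "e' = e / (C * D)"
  have "e' > 0" using e CD by (simp add: e'_def)
  then obtain d where d: "d > 0"
    "\<And>y. norm (y - x) < d \<Longrightarrow> norm (g y - g x - H (y - x)) \<le> e' * norm (y - x)"
    using g unfolding has_derivative_at_alt by blast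
  show ?thesis
  proof (intro exI[of _ "d / D"] conjI allI impI)
    show "d / D > 0" using d CD by simp
    fix s assume s: "0 < s \<and> s < d / D"
    hence sD: "s * D < d" using CD by (simp add: field_simps)
    define q where "q r = f (x + (r * s) *\<^sub>R u + s *\<^sub>R v) - f (x + (r * s) *\<^sub>R u)" for r
    define q' where "q' r = s * ((g (x + (r * s) *\<^sub>R u + s *\<^sub>R v) - g (x + (r * s) *\<^sub>R u)) \<bullet> u)" for r
    have q: "(q has_real_derivative q' r) (at r)" for r
    proof -
      have "(q has_derivative (\<lambda>h. g (x + (r * s) *\<^sub>R u + s *\<^sub>R v) \<bullet> ((h * s) *\<^sub>R u)
              - g (x + (r * s) *\<^sub>R u) \<bullet> ((h * s) *\<^sub>R u))) (at r)"
        unfolding q_def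
        by (intro has_derivative_diff has_derivative_compose[OF _ f])
           (auto intro!: derivative_eq_intros)
      thus ?thesis unfolding has_field_derivative_def
        by (rule has_derivative_eq_rhs) (auto simp: q'_def fun_eq_iff algebra_simps inner_diff_left)
    qed
    obtain r where r: "0 < r" "r < 1" "q 1 - q 0 = q' r"
      using MVT2[of 0 1 q q'] q by auto
    let ?a = "(r * s) *\<^sub>R u + s *\<^sub>R v" and ?b = "(r * s) *\<^sub>R u"
    have rs: "r * s \<le> s" using s r by (simp add: mult_left_le_one_le)
    have rsu: "(r * s) * norm u \<le> s * norm u" using rs by (rule mult_right_mono) simp
    have nb: "norm ?b \<le> s * norm u" using rsu r s by simp
    have na: "norm ?a \<le> s * (norm u + norm v)"
    proof -
      have "norm ?a \<le> norm ?b + norm (s *\<^sub>R v)" by (rule norm_triangle_ineq)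
      also have "\<dots> \<le> s * norm u + s * norm v" using nb s by simp
      finally show ?thesis by (simp add: algebra_simps)
    qed
    have lt: "norm ?a < d" "norm ?b < d"
    proof -
      have "s * (norm u + norm v) < d" using sD s by (simp add: D_def algebra_simps)
      thus "norm ?a < d" using na by simp
      have "s * norm u \<le> s * (norm u + norm v)" using s by (simp add: algebra_simps)
      thus "norm ?b < d" using nb \<open>s * (norm u + norm v) < d\<close> by linarith
    qed
    have A: "norm (g (x + ?a) - g x - H ?a) \<le> e' * norm ?a"
      "norm (g (x + ?b) - g x - H ?b) \<le> e' * norm ?b"
      using d(2)[of "x + ?a"] d(2)[of "x + ?b"] lt by simp_all
    have Hab: "H ?a - H ?b = s *\<^sub>R H v" by (simp add: H.add H.scaleR)
    have "g (x + ?a) - g (x + ?b) - s *\<^sub>R H v = (g (x + ?a) - g x - H ?a) - (g (x + ?b) - g x - H ?b)"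
      using Hab[symmetric] by simp
    hence "norm (g (x + ?a) - g (x + ?b) - s *\<^sub>R H v) \<le> e' * norm ?a + e' * norm ?b"
      using A norm_triangle_ineq4 by (smt (verit))
    also have "\<dots> \<le> e' * (s * (norm u + norm v)) + e' * (s * norm u)"
      using na nb \<open>e' > 0\<close> by (intro add_mono mult_left_mono) auto
    also have "\<dots> \<le> e' * s * C" using \<open>e' > 0\<close> s by (simp add: C_def algebra_simps)
    finally have B: "norm (g (x + ?a) - g (x + ?b) - s *\<^sub>R H v) \<le> e' * s * C" .
    have "f (x + s *\<^sub>R u + s *\<^sub>R v) - f (x + s *\<^sub>R u) - f (x + s *\<^sub>R v) + f x - s\<^sup>2 * (u \<bullet> H v)
        = q' r - s\<^sup>2 * (u \<bullet> H v)"
      using r(3) by (simp add: q_def)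
    also have "\<dots> = s * ((g (x + ?a) - g (x + ?b) - s *\<^sub>R H v) \<bullet> u)"
      by (simp add: q'_def algebra_simps inner_diff_left inner_commute power2_eq_square add.assoc)
    finally have "\<bar>f (x + s *\<^sub>R u + s *\<^sub>R v) - f (x + s *\<^sub>R u) - f (x + s *\<^sub>R v) + f x - s\<^sup>2 * (u \<bullet> H v)\<bar>
      = s * \<bar>(g (x + ?a) - g (x + ?b) - s *\<^sub>R H v) \<bullet> u\<bar>" using s by (simp add: abs_mult)
    also have "\<dots> \<le> s * ((e' * s * C) * norm u)"
      using s B by (intro mult_left_mono order_trans[OF Cauchy_Schwarz_ineq2] mult_right_mono) auto
    also have "\<dots> \<le> s * ((e' * s * C) * D)"
      using s \<open>e' > 0\<close> CD by (intro mult_left_mono) (auto simp: D_def)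
    also have "\<dots> = e * s\<^sup>2" using CD by (simp add: e'_def power2_eq_square)
    finally show "\<bar>f (x + s *\<^sub>R u + s *\<^sub>R v) - f (x + s *\<^sub>R u) - f (x + s *\<^sub>R v) + f x - s\<^sup>2 * (u \<bullet> H v)\<bar> \<le> e * s\<^sup>2" .
  qed
qed

lemma second_derivative_symmetric:
  fixes f :: "'a::euclidean_space \<Rightarrow> real"
  assumes f: "\<And>x. (f has_derivative (\<lambda>h. g x \<bullet> h)) (at x)"
    and g: "(g has_derivative H) (at x)"
  shows "u \<bullet> H v = v \<bullet> H u"
proof -
  have "\<bar>u \<bullet> H v - v \<bullet> H u\<bar> \<le> 0 + e" if "e > 0" for e
  proof -
    have e2: "e / 2 > 0" using that by simp
    obtain d1 where d1: "d1 > 0" "\<And>s. 0 < s \<and> s < d1 \<Longrightarrow>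
      \<bar>f (x + s *\<^sub>R u + s *\<^sub>R v) - f (x + s *\<^sub>R u) - f (x + s *\<^sub>R v) + f x - s\<^sup>2 * (u \<bullet> H v)\<bar> \<le> e / 2 * s\<^sup>2"
      using second_difference_bound[OF f g e2, of u v] by blast
    obtain d2 where d2: "d2 > 0" "\<And>s. 0 < s \<and> s < d2 \<Longrightarrow>
      \<bar>f (x + s *\<^sub>R v + s *\<^sub>R u) - f (x + s *\<^sub>R v) - f (x + s *\<^sub>R u) + f x - s\<^sup>2 * (v \<bullet> H u)\<bar> \<le> e / 2 * s\<^sup>2"
      using second_difference_bound[OF f g e2, of v u] by blast
    define s where "s = min d1 d2 / 2"
    have s: "0 < s" "s < d1" "s < d2" using d1 d2 by (auto simp: s_def)
    have "x + s *\<^sub>R v + s *\<^sub>R u = x + s *\<^sub>R u + s *\<^sub>R v" by simp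
    hence "\<bar>s\<^sup>2 * (u \<bullet> H v) - s\<^sup>2 * (v \<bullet> H u)\<bar> \<le> e / 2 * s\<^sup>2 + e / 2 * s\<^sup>2"
      using d1(2)[of s] d2(2)[of s] s unfolding abs_le_iff by (smt (verit))
    hence "\<bar>s\<^sup>2 * (u \<bullet> H v) - s\<^sup>2 * (v \<bullet> H u)\<bar> \<le> e * s\<^sup>2" by simp
    moreover have "\<bar>s\<^sup>2 * (u \<bullet> H v) - s\<^sup>2 * (v \<bullet> H u)\<bar> = s\<^sup>2 * \<bar>u \<bullet> H v - v \<bullet> H u\<bar>"
      by (simp only: right_diff_distrib[symmetric] abs_mult) simp
    ultimately have "s\<^sup>2 * \<bar>u \<bullet> H v - v \<bullet> H u\<bar> \<le> s\<^sup>2 * e" by (simp add: mult.commute)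
    thus ?thesis using s by simp
  qed
  hence "\<bar>u \<bullet> H v - v \<bullet> H u\<bar> \<le> 0" by (rule field_le_epsilon)
  thus ?thesis by simp
qed

lemma real_eigenvalue_in_eigenvalues:
  fixes A :: "real^'n^'n"
  assumes "A *v v = c *\<^sub>R v" "v \<noteq> 0"
  shows "complex_of_real c \<in> eigenvalues A"
proof -
  let ?v = "\<chi> i. complex_of_real (v $ i)"
  have "?v \<noteq> 0" using assms(2) by (auto simp: vec_eq_iff)
  moreover have "map_matrix complex_of_real A *v ?v = complex_of_real c *s ?v"
  proof (simp add: vec_eq_iff matrix_vector_mult_def map_matrix_def, intro allI)
    fix i
    have "(A *v v) $ i = c * v $ i" using assms(1) by simp
    hence "(\<Sum>j\<in>UNIV. A $ i $ j * v $ j) = c * v $ i" by (simp add: matrix_vector_mult_def)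
    thus "(\<Sum>j\<in>UNIV. complex_of_real (A $ i $ j) * complex_of_real (v $ j))
      = complex_of_real c * complex_of_real (v $ i)"
      by (metis (no_types, lifting) of_real_mult of_real_sum sum.cong)
  qed
  ultimately show ?thesis unfolding eigenvalues_def by blast
qed

lemma bdd_above_eigenvalues:
  fixes A :: "real^'n^'n"
  shows "bdd_above (cmod ` eigenvalues A)"
proof (rule bdd_aboveI[of _ "\<Sum>i\<in>UNIV. \<Sum>j\<in>UNIV. \<bar>A $ i $ j\<bar>"])
  fix r assume "r \<in> cmod ` eigenvalues A"
  then obtain c v where c: "r = cmod c" and v: "v \<noteq> 0" 
    and eq: "map_matrix complex_of_real A *v v = c *s v"
    by (auto simp: eigenvalues_def)
  define M where "M = Max (range (\<lambda>i. cmod (v $ i)))"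
  have M: "cmod (v $ i) \<le> M" for i unfolding M_def by (rule Max_ge) auto
  obtain i where i: "M = cmod (v $ i)"
    using Max_in[of "range (\<lambda>i. cmod (v $ i))"] unfolding M_def by (metis (mono_tags, lifting) UNIV_not_empty empty_is_image finite finite_imageI imageE)
  obtain k where "v $ k \<noteq> 0" using v by (auto simp: vec_eq_iff)
  hence "M > 0" using M[of k] by (meson less_le_trans zero_less_norm_iff)
  have "(\<Sum>j\<in>UNIV. complex_of_real (A $ i $ j) * v $ j) = c * v $ i"
    using arg_cong[OF eq, of "\<lambda>w. w $ i"] by (simp add: matrix_vector_mult_def map_matrix_def)
  hence "r * M = cmod (\<Sum>j\<in>UNIV. complex_of_real (A $ i $ j) * v $ j)"
    by (simp add: c i norm_mult)
  also have "\<dots> \<le> (\<Sum>j\<in>UNIV. \<bar>A $ i $ j\<bar> * M)"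
    by (rule order_trans[OF norm_sum]) (auto intro!: sum_mono mult_left_mono M simp: norm_mult)
  also have "\<dots> = (\<Sum>j\<in>UNIV. \<bar>A $ i $ j\<bar>) * M" by (simp add: sum_distrib_right)
  finally have "r \<le> (\<Sum>j\<in>UNIV. \<bar>A $ i $ j\<bar>)" using \<open>M > 0\<close> by simp
  also have "\<dots> \<le> (\<Sum>i\<in>UNIV. \<Sum>j\<in>UNIV. \<bar>A $ i $ j\<bar>)"
    by (rule member_le_sum[of i UNIV "\<lambda>i. \<Sum>j\<in>UNIV. \<bar>A $ i $ j\<bar>"]) (auto intro: sum_nonneg)
  finally show "r \<le> (\<Sum>i\<in>UNIV. \<Sum>j\<in>UNIV. \<bar>A $ i $ j\<bar>)" .
qed

text \<open>For a symmetric matrix the largest absolute eigenvalue bounds the operator norm. If \<open>v\<close>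
  maximizes \<open>|A u|\<close> on the unit sphere and \<open>r\<close> is the maximum, then \<open>(A - r) (A + r) v = 0\<close>, so
  one of \<open>r\<close>, \<open>- r\<close> is an eigenvalue.\<close>

lemma norm_le_max_abs_eigenvalue:
  fixes A :: "real^'n^'n"
  assumes sym: "\<And>u v. u \<bullet> (A *v v) = v \<bullet> (A *v u)"
  shows "norm (A *v x) \<le> max_abs_eigenvalue A * norm x"
proof -
  let ?S = "sphere (0::real^'n) 1"
  have "?S \<noteq> {}" by (metis norm_axis_1 mem_sphere_0 empty_iff)
  moreover have "continuous_on ?S (\<lambda>v. norm (A *v v))"
    by (intro continuous_intros linear_continuous_on matrix_vector_mul_bounded_linear)
  ultimately obtain v where v: "v \<in> ?S" "\<And>u. u \<in> ?S \<Longrightarrow> norm (A *v u) \<le> norm (A *v v)"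
    using continuous_attains_sup[of ?S "\<lambda>v. norm (A *v v)"] by auto
  define r where "r = norm (A *v v)"
  have nv: "norm v = 1" "v \<noteq> 0" using v by auto
  have all: "norm (A *v u) \<le> r * norm u" for u
  proof (cases "u = 0")
    case False
    have "norm (A *v (u /\<^sub>R norm u)) \<le> r" unfolding r_def using False by (intro v(2)) simp
    thus ?thesis using False by (simp add: matrix_vector_mult_scaleR field_simps)
  qed (simp)
  \<comment> \<open>\<open>A\<^sup>2 v = r\<^sup>2 v\<close>, as the square of the difference is at most \<open>r\<^sup>4 - 2 r\<^sup>4 + r\<^sup>4 = 0\<close>\<close>
  let ?w = "A *v (A *v v)"
  have vw: "v \<bullet> ?w = r\<^sup>2"
    using sym[of v "A *v v"] by (simp add: r_def power2_norm_eq_inner)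
  have "norm ?w \<le> r * r" using all[of "A *v v"] by (simp add: r_def)
  hence "(norm ?w)\<^sup>2 \<le> (r\<^sup>2)\<^sup>2" by (simp add: power2_eq_square mult_mono')
  moreover have "(norm (?w - r\<^sup>2 *\<^sub>R v))\<^sup>2 = (norm ?w)\<^sup>2 - 2 * r\<^sup>2 * (v \<bullet> ?w) + (r\<^sup>2)\<^sup>2 * (norm v)\<^sup>2"
    by (simp only: power2_norm_eq_inner)
       (simp add: inner_diff_left inner_diff_right inner_commute algebra_simps power2_eq_square)
  ultimately have "(norm (?w - r\<^sup>2 *\<^sub>R v))\<^sup>2 \<le> 0" using vw nv by (simp add: power2_eq_square)
  hence w: "?w = r\<^sup>2 *\<^sub>R v" by simp
  have r0: "r \<ge> 0" by (simp add: r_def)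
  have "r \<le> max_abs_eigenvalue A"
  proof (cases "A *v v + r *\<^sub>R v = 0")
    case True
    hence "A *v v = (-r) *\<^sub>R v" by (simp add: add_eq_0_iff)
    from real_eigenvalue_in_eigenvalues[OF this nv(2)] have "cmod (complex_of_real (-r)) \<le> max_abs_eigenvalue A"
      unfolding max_abs_eigenvalue_def by (intro cSUP_upper bdd_above_eigenvalues)
    thus ?thesis using r0 by simp
  next
    case False
    have "A *v (A *v v + r *\<^sub>R v) = r *\<^sub>R (A *v v + r *\<^sub>R v)"
      using w by (simp add: matrix_vector_right_distrib matrix_vector_mult_scaleR algebra_simps power2_eq_square)
    from real_eigenvalue_in_eigenvalues[OF this False] have "cmod (complex_of_real r) \<le> max_abs_eigenvalue A"
      unfolding max_abs_eigenvalue_def by (intro cSUP_upper bdd_above_eigenvalues)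
    thus ?thesis using r0 by simp
  qed
  thus ?thesis using all[of x] mult_right_mono[of r "max_abs_eigenvalue A" "norm x"] by simp
qed

lemma has_derivative_grad:
  assumes "l differentiable (at \<theta>)"
  shows "(l has_derivative (\<lambda>h. grad l \<theta> \<bullet> h)) (at \<theta>)"
proof -
  have d: "(l has_derivative frechet_derivative l (at \<theta>)) (at \<theta>)"
    using assms by (simp add: frechet_derivative_works)
  then have lin: "linear (frechet_derivative l (at \<theta>))" by (rule has_derivative_linear)
  have "frechet_derivative l (at \<theta>) h = grad l \<theta> \<bullet> h" for h
  proof -
    have "frechet_derivative l (at \<theta>) h = frechet_derivative l (at \<theta>) (\<Sum>i\<in>UNIV. h $ i *\<^sub>R axis i 1)"
      by (simp add: basis_expansion[of h, unfolded scalar_mult_eq_scaleR])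
    also have "\<dots> = (\<Sum>i\<in>UNIV. h $ i * frechet_derivative l (at \<theta>) (axis i 1))"
      using lin by (simp add: linear_sum linear_cmul)
    finally show ?thesis by (simp add: grad_def inner_vec_def mult.commute)
  qed
  thus ?thesis using d by (metis (no_types, lifting) ext)
qed

text \<open>The spectral bound on the Hessian controls its operator norm because the Hessian of a
  twice differentiable function is symmetric; hence the gradient is Lipschitz on balls.\<close>

lemma grad_lipschitz_on_cball:
  assumes l: "twice_differentiable l"
    and h: "\<forall>K. compact K \<longrightarrow> bdd_above ((\<lambda>\<theta>. max_abs_eigenvalue (hess l \<theta>)) ` K)"
  obtains L where "L \<ge> 0" "\<And>x y. x \<in> cball 0 R \<Longrightarrow> y \<in> cball 0 R \<Longrightarrow> norm (grad l x - grad l y) \<le> L * norm (x - y)"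
proof -
  have d: "(l has_derivative (\<lambda>h. grad l \<theta> \<bullet> h)) (at \<theta>)" for \<theta>
    using l has_derivative_grad by (auto simp: twice_differentiable_def)
  have g: "(grad l has_derivative (\<lambda>h. hess l \<theta> *v h)) (at \<theta>)" for \<theta>
  proof -
    have "grad l differentiable (at \<theta>)" using l by (simp add: twice_differentiable_def)
    thus ?thesis unfolding hess_def using jacobian_works by blast
  qed
  have n: "norm (hess l \<theta> *v v) \<le> max_abs_eigenvalue (hess l \<theta>) * norm v" for \<theta> v
    using second_derivative_symmetric[OF d g] by (intro norm_le_max_abs_eigenvalue) 
  have "bdd_above ((\<lambda>\<theta>. max_abs_eigenvalue (hess l \<theta>)) ` cball 0 R)" using h by simp
  then obtain L0 where L0: "\<And>\<theta>. \<theta> \<in> cball 0 R \<Longrightarrow> max_abs_eigenvalue (hess l \<theta>) \<le> L0"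
    unfolding bdd_above_def by blast
  define L where "L = max L0 0"
  have "norm (grad l x - grad l y) \<le> L * norm (x - y)" if "x \<in> cball 0 R" "y \<in> cball 0 R" for x y
  proof (rule differentiable_bound[of "cball 0 R" "grad l" "\<lambda>\<theta> h. hess l \<theta> *v h"])
    show "(grad l has_derivative (*v) (hess l z)) (at z within cball 0 R)" for z
      using g by (rule has_derivative_at_withinI)
    show "onorm ((*v) (hess l z)) \<le> L" if "z \<in> cball 0 R" for z
    proof (rule onorm_le)
      fix v :: "real^'a"
      have "max_abs_eigenvalue (hess l z) * norm v \<le> L * norm v" 
        using L0[OF that] by (intro mult_right_mono) (auto simp: L_def)
      thus "norm (hess l z *v v) \<le> L * norm v" using n[of z v] by linarith
    qed
  qed (use that in auto)
  thus ?thesis by (intro that[of L]) (auto simp: L_def)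
qed

section \<open>Tracking a flow by perturbed Euler steps\<close>

lemma norm_increment_le:
  fixes f :: "real \<Rightarrow> 'a::real_normed_vector"
  assumes "\<And>u. u \<in> {p..q} \<Longrightarrow> (f has_vector_derivative f' u) (at u within {p..q})"
    and "\<And>u. u \<in> {p..q} \<Longrightarrow> norm (f' u) \<le> B" and "p \<le> q"
  shows "norm (f q - f p) \<le> B * (q - p)"
proof -
  have "norm (f q - f p) \<le> B * norm (q - p)"
  proof (rule differentiable_bound[of "{p..q}" f "\<lambda>u h. h *\<^sub>R f' u"])
    show "onorm (\<lambda>h. h *\<^sub>R f' u) \<le> B" if "u \<in> {p..q}" for u
      using assms(2)[OF that] by (intro onorm_le) (simp add: mult.commute[of B] mult_left_mono)
  qed (use assms in \<open>auto simp: has_vector_derivative_def\<close>)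
  thus ?thesis using assms(3) by simp
qed

lemma flow_euler_step:
  fixes \<zeta> :: "real \<Rightarrow> 'a::real_normed_vector"
  assumes flow: "\<And>t. 0 \<le> t \<Longrightarrow> (\<zeta> has_vector_derivative g (\<zeta> t)) (at t within {0..})"
    and lip: "\<And>x y. x \<in> S \<Longrightarrow> y \<in> S \<Longrightarrow> norm (g x - g y) \<le> L * norm (x - y)" and "L \<ge> 0"
    and G: "\<And>x. x \<in> S \<Longrightarrow> norm (g x) \<le> G"
    and S: "\<And>t. 0 \<le> t \<Longrightarrow> \<zeta> t \<in> S" and s: "0 \<le> s" "0 \<le> h"
  shows "norm (\<zeta> (s + h) - \<zeta> s - h *\<^sub>R g (\<zeta> s)) \<le> L * G * h * h"
proof -
  have fl: "(\<zeta> has_vector_derivative g (\<zeta> u)) (at u within {s..v})" if "u \<in> {s..v}" for u v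
    using flow[of u] s that by (auto intro: has_vector_derivative_within_subset)
  have near: "norm (\<zeta> u - \<zeta> s) \<le> G * h" if "u \<in> {s..s+h}" for u
  proof -
    have "norm (\<zeta> u - \<zeta> s) \<le> G * (u - s)"
      by (rule norm_increment_le[of s u \<zeta> "\<lambda>u. g (\<zeta> u)"]) (use fl that s in \<open>auto intro!: G S\<close>)
    also have "\<dots> \<le> G * h" using that G[OF S[OF s(1)]] norm_ge_zero[of "g (\<zeta> s)"]
      by (intro mult_left_mono) (auto simp del: norm_ge_zero)
    finally show ?thesis .
  qed
  let ?f = "\<lambda>u. \<zeta> u - u *\<^sub>R g (\<zeta> s)"
  have "norm (?f (s + h) - ?f s) \<le> L * G * h * (s + h - s)"
  proof (rule norm_increment_le[of s "s+h" ?f "\<lambda>u. g (\<zeta> u) - g (\<zeta> s)"])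
    fix u assume u: "u \<in> {s..s+h}"
    show "(?f has_vector_derivative g (\<zeta> u) - g (\<zeta> s)) (at u within {s..s+h})"
      using fl[OF u] by (auto intro!: derivative_eq_intros)
    have "norm (g (\<zeta> u) - g (\<zeta> s)) \<le> L * norm (\<zeta> u - \<zeta> s)"
      using u s by (intro lip S) auto
    also have "\<dots> \<le> L * (G * h)" using near[OF u] \<open>L \<ge> 0\<close> by (rule mult_left_mono)
    finally show "norm (g (\<zeta> u) - g (\<zeta> s)) \<le> L * G * h" by (simp add: mult.assoc)
  qed (use s in auto)
  moreover have "?f (s + h) - ?f s = \<zeta> (s + h) - \<zeta> s - h *\<^sub>R g (\<zeta> s)"
    by (simp add: algebra_simps)
  ultimately show ?thesis by simp
qed

text \<open>A discrete Gronwall inequality: on the accumulated time \<open>s j\<close>, the iterates stay close to a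
  solution of the differential equation that starts near the \<open>m\<close>-th iterate. It compares with one
  given solution, so neither existence nor uniqueness of solutions is needed.\<close>

lemma perturbed_euler_tracks_flow:
  fixes \<phi> :: "nat \<Rightarrow> 'a::real_normed_vector"
  assumes flow: "\<And>t. 0 \<le> t \<Longrightarrow> (\<zeta> has_vector_derivative g (\<zeta> t)) (at t within {0..})"
    and lip: "\<And>x y. x \<in> S \<Longrightarrow> y \<in> S \<Longrightarrow> norm (g x - g y) \<le> L * norm (x - y)" and "L \<ge> 0"
    and G: "\<And>x. x \<in> S \<Longrightarrow> norm (g x) \<le> G"
    and S: "\<And>t. 0 \<le> t \<Longrightarrow> \<zeta> t \<in> S" "\<And>m. \<phi> m \<in> S"
    and a: "\<And>m. 0 < a m"
    and rec: "\<And>m. \<phi> (Suc m) = \<phi> m + a m *\<^sub>R (g (\<phi> m) + e m)"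
    and \<epsilon>: "\<And>i. m \<le> i \<Longrightarrow> norm (e i) + L * G * a i \<le> \<epsilon>"
  defines "s \<equiv> \<lambda>j. sum a {m..<m+j}"
  shows "norm (\<phi> (m + j) - \<zeta> (s j)) \<le> (norm (\<phi> m - \<zeta> 0) + \<epsilon> * s j) * exp (L * s j)"
proof (induction j)
  case 0
  show ?case by (simp add: s_def)
next
  case (Suc j)
  let ?x = "\<phi> (m + j)" and ?h = "a (m + j)"
  let ?d = "norm (\<phi> m - \<zeta> 0)"
  have s0: "s j \<ge> 0" unfolding s_def using a by (intro sum_nonneg) (auto simp: less_imp_le)
  have sS: "s (Suc j) = s j + ?h" by (simp add: s_def)
  have h0: "?h > 0" by (rule a)
  have G0: "G \<ge> 0" using G[OF S(2)] norm_ge_zero order_trans by blast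
  have e0: "\<epsilon> \<ge> 0"
  proof -
    have "0 \<le> norm (e m) + L * G * a m" using \<open>L \<ge> 0\<close> G0 a[of m] by simp
    thus ?thesis using \<epsilon>[of m] by linarith
  qed
  \<comment> \<open>propagated error, perturbation, and local error of the Euler step\<close>
  have split: "\<phi> (m + Suc j) - \<zeta> (s (Suc j)) =
      (?x - \<zeta> (s j)) + ?h *\<^sub>R (g ?x - g (\<zeta> (s j))) + ?h *\<^sub>R e (m + j)
      - (\<zeta> (s j + ?h) - \<zeta> (s j) - ?h *\<^sub>R g (\<zeta> (s j)))"
    by (simp add: rec sS algebra_simps)
  have "norm (\<phi> (m + Suc j) - \<zeta> (s (Suc j))) \<le> norm (?x - \<zeta> (s j)) + norm (?h *\<^sub>R (g ?x - g (\<zeta> (s j)))) + norm (?h *\<^sub>R e (m + j))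
      + norm (\<zeta> (s j + ?h) - \<zeta> (s j) - ?h *\<^sub>R g (\<zeta> (s j)))"
    unfolding split
    by (intro order_trans[OF norm_triangle_ineq4] add_mono order_trans[OF norm_triangle_ineq] order_refl)
  also have "\<dots> \<le> norm (?x - \<zeta> (s j)) + ?h * (L * norm (?x - \<zeta> (s j))) + ?h * norm (e (m + j)) + L * G * ?h * ?h"
  proof (intro add_mono order_refl)
    show "norm (?h *\<^sub>R (g ?x - g (\<zeta> (s j)))) \<le> ?h * (L * norm (?x - \<zeta> (s j)))"
      using h0 lip[OF S(2)[of "m + j"] S(1)[OF s0]] by (simp add: mult_left_mono)
    show "norm (\<zeta> (s j + ?h) - \<zeta> (s j) - ?h *\<^sub>R g (\<zeta> (s j))) \<le> L * G * ?h * ?h"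
      by (rule flow_euler_step[OF flow lip \<open>L \<ge> 0\<close> G S(1) s0]) (use h0 in auto)
  qed (use h0 in simp)
  also have "\<dots> = (1 + L * ?h) * norm (?x - \<zeta> (s j)) + ?h * (norm (e (m + j)) + L * G * ?h)"
    by (simp add: algebra_simps)
  also have "\<dots> \<le> exp (L * ?h) * ((?d + \<epsilon> * s j) * exp (L * s j)) + ?h * \<epsilon>"
  proof (intro add_mono mult_mono)
    show "1 + L * ?h \<le> exp (L * ?h)" by (rule exp_ge_add_one_self)
    show "norm (e (m + j)) + L * G * ?h \<le> \<epsilon>" by (rule \<epsilon>) simp
    show "0 \<le> norm (e (m + j)) + L * G * ?h" using \<open>L \<ge> 0\<close> G0 h0 by simp
  qed (use Suc.IH h0 in simp_all)
  also have "\<dots> = (?d + \<epsilon> * s j) * exp (L * s (Suc j)) + ?h * \<epsilon> * 1"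
    by (simp add: sS algebra_simps exp_add)
  also have "\<dots> \<le> (?d + \<epsilon> * s j) * exp (L * s (Suc j)) + ?h * \<epsilon> * exp (L * s (Suc j))"
    using \<open>L \<ge> 0\<close> h0 e0 s0 by (intro add_left_mono mult_left_mono) (auto simp: sS)
  also have "\<dots> = (?d + \<epsilon> * s (Suc j)) * exp (L * s (Suc j))" by (simp add: sS algebra_simps)
  finally show ?case .
qed

lemma partial_sums_exceed:
  fixes a :: "nat \<Rightarrow> real"
  assumes a: "\<And>m. 0 < a m" and ns: "\<not> summable a" and T: "T \<ge> 0"
    and A: "\<And>i. m \<le> i \<Longrightarrow> a i \<le> A" "A \<ge> 0"
  shows "\<exists>j. T \<le> sum a {m..<m+j} \<and> sum a {m..<m+j} \<le> T + A"
proof -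
  have "\<exists>j. T \<le> sum a {m..<m+j}"
  proof (rule ccontr)
    assume "\<not> ?thesis"
    hence *: "sum a {m..<m+j} \<le> T" for j by (meson linear)
    have "summable (\<lambda>i. a (i + m))"
    proof (rule summableI_nonneg_bounded)
      show "(\<Sum>i<n. a (i + m)) \<le> T" for n
        using *[of n] sum.shift_bounds_nat_ivl[of a 0 m n] by (simp add: lessThan_atLeast0 add.commute)
    qed (use a in \<open>auto simp: less_imp_le\<close>)
    thus False using ns by (simp add: summable_iff_shift)
  qed
  then obtain j where j: "T \<le> sum a {m..<m+j}" "\<And>i. i < j \<Longrightarrow> \<not> T \<le> sum a {m..<m+i}"
    using exists_least_iff[of "\<lambda>j. T \<le> sum a {m..<m+j}"] by blast
  show ?thesis
  proof (cases j)
    case 0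
    thus ?thesis using j T A by (intro exI[of _ 0]) auto
  next
    case (Suc k)
    have "sum a {m..<m+k} \<le> T" using j(2)[of k] Suc by auto
    thus ?thesis using j(1) A(1)[of "m+k"] Suc by (intro exI[of _ j]) auto
  qed
qed

lemma real_mean_value_segment:
  fixes l :: "'a::real_inner \<Rightarrow> real"
  assumes l: "\<And>x. (l has_derivative (\<lambda>h. g x \<bullet> h)) (at x)"
  obtains t where "0 < t" "t < 1" "l (x + h) - l x = g (x + t *\<^sub>R h) \<bullet> h"
proof -
  have "((\<lambda>t. l (x + t *\<^sub>R h)) has_real_derivative g (x + t *\<^sub>R h) \<bullet> h) (at t)" for t
  proof -
    have "((\<lambda>t. l (x + t *\<^sub>R h)) has_derivative (\<lambda>u. g (x + t *\<^sub>R h) \<bullet> (u *\<^sub>R h))) (at t)"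
      by (rule has_derivative_compose[OF _ l]) (auto intro!: derivative_eq_intros)
    thus ?thesis unfolding has_field_derivative_def
      by (rule has_derivative_eq_rhs) (auto simp: fun_eq_iff)
  qed
  then obtain t where "0 < t" "t < 1" "l (x + 1 *\<^sub>R h) - l (x + 0 *\<^sub>R h) = (1 - 0) * (g (x + t *\<^sub>R h) \<bullet> h)"
    using MVT2[of 0 1 "\<lambda>t. l (x + t *\<^sub>R h)" "\<lambda>t. g (x + t *\<^sub>R h) \<bullet> h"] by auto
  thus ?thesis using that by simp
qed

section \<open>Convergence of perturbed gradient ascent\<close>

text \<open>Suppose that \<open>c\<close> maximizes \<open>l\<close> and is the only critical point within distance \<open>r\<close>. Then \<open>l\<close> is
  bounded away from its maximum on the annulus \<open>\<eta> \<le> |x - c| \<le> r\<close>, and the part \<open>U\<close> of the ball of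
  radius \<open>\<eta>\<close> where \<open>l\<close> exceeds a slightly higher level cannot be left: late steps are too short to
  jump over the annulus, and away from \<open>c\<close> they do not decrease \<open>l\<close>.\<close>

lemma strict_maximum_trap:
  fixes l :: "'a::euclidean_space \<Rightarrow> real"
  assumes l: "\<And>x. (l has_derivative (\<lambda>h. g x \<bullet> h)) (at x)"
    and S: "compact S" "convex S"
    and lip: "\<And>x y. x \<in> S \<Longrightarrow> y \<in> S \<Longrightarrow> norm (g x - g y) \<le> L * norm (x - y)" and L: "L \<ge> 0"
    and G: "\<And>x. x \<in> S \<Longrightarrow> norm (g x) \<le> G"
    and \<phi>S: "\<And>m. \<phi> m \<in> S"
    and max: "\<And>x. l x \<le> l c"
    and crit: "\<And>x. norm (x - c) \<le> r \<Longrightarrow> g x = 0 \<Longrightarrow> x = c"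
    and a: "\<And>m. 0 < a m" "a \<longlonglongrightarrow> 0" and e: "e \<longlonglongrightarrow> 0"
    and rec: "\<And>m. \<phi> (Suc m) = \<phi> m + a m *\<^sub>R (g (\<phi> m) + e m)"
    and \<eta>: "0 < \<eta>" "\<eta> < r"
  obtains U where "open U" "c \<in> U" "U \<subseteq> ball c \<eta>" "eventually (\<lambda>m. \<phi> m \<in> U \<longrightarrow> \<phi> (Suc m) \<in> U) sequentially"
proof -
  have contl: "continuous_on A l" for A
    using l by (meson continuous_at_imp_continuous_on has_derivative_continuous)
  have g_of_max: "g x = 0" if "l x = l c" for x
  proof -
    have "(\<lambda>h. g x \<bullet> h) = (\<lambda>h. 0)"
      by (rule differential_zero_maxmin[of x UNIV l]) (use l max that in auto)
    from fun_cong[OF this, of "g x"] show ?thesis by simp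
  qed
  have G0: "G \<ge> 0" using G[OF \<phi>S] norm_ge_zero order_trans by blast
  define ann where "ann = {x. \<eta> \<le> norm (x - c) \<and> norm (x - c) \<le> r}"
  have cann: "compact ann"
  proof -
    have "ann = cball c r - ball c \<eta>" by (auto simp: ann_def dist_norm norm_minus_commute)
    thus ?thesis by (simp add: compact_diff)
  qed
  obtain c0 where c0: "c0 < l c" "\<And>x. x \<in> ann \<Longrightarrow> l x \<le> c0"
  proof (cases "ann = {}")
    case True
    thus ?thesis using that[of "l c - 1"] by simp
  next
    case False
    then obtain x where x: "x \<in> ann" "\<And>y. y \<in> ann \<Longrightarrow> l y \<le> l x"
      using continuous_attains_sup[OF cann False contl] by blast
    have "l x \<noteq> l c" using x(1) g_of_max[of x] crit[of x] \<eta> by (auto simp: ann_def)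
    thus ?thesis using that[of "l x"] x max[of x] by auto
  qed
  \<comment> \<open>\<open>c1\<close> is the level that defines \<open>U\<close>; between \<open>c1\<close> and \<open>c2\<close> a late step cannot decrease \<open>l\<close>\<close>
  define c1 where "c1 = (c0 + l c) / 2"
  define c2 where "c2 = (c1 + l c) / 2"
  have cs: "c0 < c1" "c1 < c2" "c2 < l c" using c0 by (auto simp: c1_def c2_def)
  define U where "U = ball c \<eta> \<inter> {x. c1 < l x}"
  have Uo: "open U" unfolding U_def
    by (intro open_Int open_ball open_Collect_less continuous_on_const contl)
  have cU: "c \<in> U" using \<eta> cs by (simp add: U_def)
  \<comment> \<open>a compact set without \<open>c\<close>, so the gradient is bounded away from \<open>0\<close> on it\<close>
  define C where "C = {x\<in>cball c \<eta>. l x \<le> c2}"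
  have Cc: "compact C" unfolding C_def
  proof -
    have "closed {x. l x \<le> c2}" by (intro closed_Collect_le continuous_on_const contl)
    hence "compact (cball c \<eta> \<inter> {x. l x \<le> c2})" by (intro compact_Int_closed) auto
    moreover have "cball c \<eta> \<inter> {x. l x \<le> c2} = {x\<in>cball c \<eta>. l x \<le> c2}" by auto
    ultimately show "compact {x\<in>cball c \<eta>. l x \<le> c2}" by simp
  qed
  obtain \<gamma> where \<gamma>: "\<gamma> > 0" "\<And>x. x \<in> C \<inter> S \<Longrightarrow> \<gamma> \<le> norm (g x)"
  proof (cases "C \<inter> S = {}")
    case True
    thus ?thesis using that[of 1] by auto
  next
    case False
    have "continuous_on S g"
    proof (rule continuous_onI)
      fix x \<epsilon> assume x: "x \<in> S" "(\<epsilon>::real) > 0"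
      show "\<exists>d>0. \<forall>x'\<in>S. dist x' x < d \<longrightarrow> dist (g x') (g x) \<le> \<epsilon>"
      proof (intro exI[of _ "\<epsilon> / (L + 1)"] conjI ballI impI)
        fix y assume y: "y \<in> S" "dist y x < \<epsilon> / (L + 1)"
        have "dist (g y) (g x) \<le> L * dist y x" using lip[OF y(1) x(1)] by (simp add: dist_norm)
        also have "\<dots> \<le> (L + 1) * (\<epsilon> / (L + 1))" using y L by (intro mult_mono) auto
        also have "\<dots> = \<epsilon>" using L by simp
        finally show "dist (g y) (g x) \<le> \<epsilon>" .
      qed (use x L in auto)
    qed
    hence "continuous_on (C \<inter> S) (\<lambda>x. norm (g x))"
      by (intro continuous_on_norm) (auto intro: continuous_on_subset)
    then obtain x where x: "x \<in> C \<inter> S" "\<And>y. y \<in> C \<inter> S \<Longrightarrow> norm (g x) \<le> norm (g y)"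
      using continuous_attains_inf[of "C \<inter> S" "\<lambda>x. norm (g x)"] False Cc S by (auto intro: compact_Int)
    have "x \<noteq> c" using x cs by (auto simp: C_def)
    hence "g x \<noteq> 0" using x crit[of x] \<eta> by (auto simp: C_def dist_norm norm_minus_commute)
    thus ?thesis using that[of "norm (g x)"] x by auto
  qed
  \<comment> \<open>eventual smallness of the step and of its effect on \<open>l\<close>\<close>
  have e1: "\<forall>\<^sub>F m in sequentially. norm (e m) < 1"
    using e tendstoD[of e 0 sequentially 1] by simp
  have ts: "(\<lambda>m. a m * (G + 1)) \<longlonglongrightarrow> 0" by (rule tendsto_mult_left_zero[OF a(2)])
  have e2: "\<forall>\<^sub>F m in sequentially. a m * (G + 1) < r - \<eta>"
    using ts \<eta> by (intro order_tendstoD(2)) auto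
  have e3: "\<forall>\<^sub>F m in sequentially. G * (a m * (G + 1)) < c2 - c1"
    using tendsto_mult_right_zero[OF ts, of G] cs by (intro order_tendstoD(2)) auto
  have "(\<lambda>m. G * norm (e m) + L * (a m * (G + 1)) * (G + 1)) \<longlonglongrightarrow> 0"
    using tendsto_add[OF tendsto_mult_right_zero[OF tendsto_norm_zero[OF e], of G]
        tendsto_mult_left_zero[OF tendsto_mult_right_zero[OF ts, of L], of "G + 1"]] by simp
  hence e4: "\<forall>\<^sub>F m in sequentially. G * norm (e m) + L * (a m * (G + 1)) * (G + 1) < \<gamma>\<^sup>2"
    using \<gamma> by (intro order_tendstoD(2)) auto
  have "\<forall>\<^sub>F m in sequentially. \<phi> m \<in> U \<longrightarrow> \<phi> (Suc m) \<in> U"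
    using e1 e2 e3 e4
  proof eventually_elim
    case (elim m)
    let ?x = "\<phi> m" and ?y = "\<phi> (Suc m)"
    let ?v = "g ?x + e m"
    show ?case
    proof
      assume xU: "?x \<in> U"
      have nv: "norm ?v \<le> G + 1" using norm_triangle_ineq[of "g ?x" "e m"] G[OF \<phi>S, of m] elim(1) by linarith
      have yx: "?y = ?x + a m *\<^sub>R ?v" by (rule rec)
      have step: "norm (a m *\<^sub>R ?v) \<le> a m * (G + 1)" using nv a(1)[of m] by simp
      have near: "norm (?y - c) \<le> r"
      proof -
        have "norm (?y - c) = norm ((?x - c) + a m *\<^sub>R ?v)" unfolding yx by (simp add: algebra_simps)
        also have "\<dots> \<le> norm (?x - c) + norm (a m *\<^sub>R ?v)" by (rule norm_triangle_ineq)
        finally show ?thesis using step elim(2) xU by (auto simp: U_def dist_norm norm_minus_commute)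
      qed
      obtain t where t: "0 < t" "t < 1" "l (?x + a m *\<^sub>R ?v) - l ?x = g (?x + t *\<^sub>R a m *\<^sub>R ?v) \<bullet> (a m *\<^sub>R ?v)"
        using real_mean_value_segment[OF l] by blast
      let ?z = "?x + t *\<^sub>R a m *\<^sub>R ?v"
      have zS: "?z \<in> S"
      proof -
        have "?z = (1 - t) *\<^sub>R ?x + t *\<^sub>R ?y" by (simp add: yx algebra_simps)
        thus ?thesis using S(2) \<phi>S[of m] \<phi>S[of "Suc m"] t by (auto intro: convexD_alt)
      qed
      have ly: "l ?y - l ?x = a m * (g ?z \<bullet> ?v)" using t(3) by (simp add: yx)
      have "c1 < l ?y"
      proof (cases "c2 \<le> l ?x")
        case True
        have "\<bar>g ?z \<bullet> ?v\<bar> \<le> G * (G + 1)"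
          by (rule order_trans[OF Cauchy_Schwarz_ineq2]) (intro mult_mono G[OF zS] nv G0 norm_ge_zero)
        hence "a m * \<bar>g ?z \<bullet> ?v\<bar> \<le> a m * (G * (G + 1))" using a(1)[of m] by simp
        moreover have "\<bar>a m * (g ?z \<bullet> ?v)\<bar> = a m * \<bar>g ?z \<bullet> ?v\<bar>" using a(1)[of m] by (simp add: abs_mult)
        ultimately show ?thesis using ly elim(3) True by (simp add: algebra_simps)
      next
        case False
        have "?x \<in> C \<inter> S" using xU False \<phi>S by (auto simp: C_def U_def)
        hence "\<gamma>\<^sup>2 \<le> (norm (g ?x))\<^sup>2" using \<gamma> by (intro power_mono) auto
        moreover have "g ?z \<bullet> ?v = (norm (g ?x))\<^sup>2 + g ?x \<bullet> e m + (g ?z - g ?x) \<bullet> ?v"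
          by (simp add: power2_norm_eq_inner inner_add_right inner_diff_left)
        moreover have "\<bar>g ?x \<bullet> e m\<bar> \<le> G * norm (e m)"
          by (rule order_trans[OF Cauchy_Schwarz_ineq2]) (intro mult_right_mono G[OF \<phi>S] norm_ge_zero)
        moreover have "\<bar>(g ?z - g ?x) \<bullet> ?v\<bar> \<le> L * (a m * (G + 1)) * (G + 1)"
        proof -
          have "norm (g ?z - g ?x) \<le> L * norm (?z - ?x)" by (intro lip zS \<phi>S)
          also have "norm (?z - ?x) = t * norm (a m *\<^sub>R ?v)" using t by (simp add: abs_mult)
          also have "t * norm (a m *\<^sub>R ?v) \<le> 1 * (a m * (G + 1))" using t step by (intro mult_mono) auto
          finally have "norm (g ?z - g ?x) \<le> L * (a m * (G + 1))" using L by (simp add: mult_left_mono)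
          moreover have "0 \<le> L * (a m * (G + 1))" using L G0 a(1)[of m] by simp
          ultimately show ?thesis
            by (intro order_trans[OF Cauchy_Schwarz_ineq2] mult_mono nv) auto
        qed
        ultimately have "g ?z \<bullet> ?v \<ge> 0" using elim(4) by linarith
        hence "0 \<le> a m * (g ?z \<bullet> ?v)" by (intro mult_nonneg_nonneg less_imp_le[OF a(1)])
        hence "l ?y \<ge> l ?x" using ly by linarith
        thus ?thesis using xU by (simp add: U_def)
      qed
      moreover have "?y \<notin> ann" using c0(2)[of ?y] calculation cs by auto
      ultimately show "?y \<in> U" using near by (auto simp: U_def ann_def dist_norm norm_minus_commute)
    qed
  qed
  thus ?thesis using that[of U] Uo cU by (auto simp: U_def)
qed

text \<open>Started near \<open>\<zeta> 0\<close> late enough, the iterates follow the flow line \<open>\<zeta>\<close> into any neighbourhood of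
  \<open>c\<close>. They do so infinitely often, and the trap keeps them there.\<close>

lemma perturbed_gradient_ascent_converges:
  fixes l :: "'a::euclidean_space \<Rightarrow> real"
  assumes l: "\<And>x. (l has_derivative (\<lambda>h. g x \<bullet> h)) (at x)"
    and lip: "\<And>R. \<exists>L\<ge>0. \<forall>x\<in>cball 0 R. \<forall>y\<in>cball 0 R. norm (g x - g y) \<le> L * norm (x - y)"
    and max: "\<And>x. l x \<le> l c"
    and r: "r > 0" "\<And>x. norm (x - c) \<le> r \<Longrightarrow> g x = 0 \<Longrightarrow> x = c"
    and a: "\<And>m. 0 < a m" "a \<longlonglongrightarrow> 0" "\<not> summable a" and e: "e \<longlonglongrightarrow> 0"
    and rec: "\<And>m. \<phi> (Suc m) = \<phi> m + a m *\<^sub>R (g (\<phi> m) + e m)"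
    and bdd: "bounded (range \<phi>)"
    and flow: "\<And>t. 0 \<le> t \<Longrightarrow> (\<zeta> has_vector_derivative g (\<zeta> t)) (at t within {0..})"
    and \<zeta>: "(\<zeta> \<longlongrightarrow> c) at_top"
    and \<rho>: "strict_mono \<rho>" "(\<phi> \<circ> \<rho>) \<longlonglongrightarrow> \<zeta> 0"
  shows "\<phi> \<longlonglongrightarrow> c"
proof -
  have "\<forall>\<^sub>F t in at_top. dist (\<zeta> t) c < 1" using \<zeta> by (rule tendstoD) simp
  then obtain T0 where T0: "\<And>t. t \<ge> T0 \<Longrightarrow> dist (\<zeta> t) c < 1" by (auto simp: eventually_at_top_linorder)
  have contz: "continuous_on {0..T0} \<zeta>"
  proof (rule continuous_on_vector_derivative)
    show "(\<zeta> has_vector_derivative g (\<zeta> t)) (at t within {0..T0})" if "t \<in> {0..T0}" for t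
      using flow[of t] that by (auto intro: has_vector_derivative_within_subset)
  qed
  have "bounded (\<zeta> ` {0..T0})" using contz compact_continuous_image compact_imp_bounded by blast
  hence "bounded (range \<phi> \<union> \<zeta> ` {0..T0} \<union> ball c 1)" using bdd by (simp add: bounded_Un)
  then obtain R where "\<forall>x \<in> range \<phi> \<union> \<zeta> ` {0..T0} \<union> ball c 1. norm x \<le> R"
    unfolding bounded_iff by blast
  hence R: "range \<phi> \<union> \<zeta> ` {0..T0} \<union> ball c 1 \<subseteq> cball 0 R" by (auto simp del: mem_ball)
  define S where "S = cball (0::'a) R"
  have \<phi>S: "\<phi> m \<in> S" for m using R unfolding S_def by blast
  have \<zeta>S: "\<zeta> t \<in> S" if "t \<ge> 0" for t
  proof (cases "t \<le> T0")
    case True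
    thus ?thesis using R that unfolding S_def by force
  next
    case False
    hence "\<zeta> t \<in> ball c 1" using T0[of t] by (simp add: dist_commute)
    thus ?thesis using R unfolding S_def by blast
  qed
  obtain L where L: "L \<ge> 0" "\<And>x y. x \<in> S \<Longrightarrow> y \<in> S \<Longrightarrow> norm (g x - g y) \<le> L * norm (x - y)"
    using lip[of R] unfolding S_def by blast
  define G where "G = norm (g (\<phi> 0)) + L * (2 * R)"
  have G: "norm (g x) \<le> G" if "x \<in> S" for x
  proof -
    have "norm (g x) \<le> norm (g x - g (\<phi> 0)) + norm (g (\<phi> 0))" by (metis norm_triangle_sub add.commute)
    moreover have "norm (g x - g (\<phi> 0)) \<le> L * norm (x - \<phi> 0)" by (rule L(2)[OF that \<phi>S])
    moreover have "norm (x - \<phi> 0) \<le> 2 * R"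
      using that \<phi>S[of 0] norm_triangle_ineq4[of x "\<phi> 0"] by (simp add: S_def)
    hence "L * norm (x - \<phi> 0) \<le> L * (2 * R)" using L(1) by (rule mult_left_mono)
    ultimately show ?thesis by (simp add: G_def)
  qed
  have Scc: "compact S" "convex S" by (auto simp: S_def)
  have freq: "\<exists>m\<ge>N. \<phi> m \<in> U" if U: "open U" "c \<in> U" for U N
  proof -
    obtain d where d: "d > 0" "ball c d \<subseteq> U" using U by (meson openE)
    have "\<forall>\<^sub>F t in at_top. dist (\<zeta> t) c < d / 2" using \<zeta> d by (intro tendstoD) auto
    then obtain T1 where T1: "\<And>t. t \<ge> T1 \<Longrightarrow> dist (\<zeta> t) c < d / 2" by (auto simp: eventually_at_top_linorder)
    define T where "T = max T1 0"
    define E where "E = exp (L * (T + 1))"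
    have E: "E > 0" by (simp add: E_def)
    \<comment> \<open>makes the perturbation contribute at most \<open>d / 4\<close> to the Gronwall bound up to time \<open>T + 1\<close>\<close>
    define \<epsilon> where "\<epsilon> = d / (4 * E * (T + 1))"
    have T0': "T \<ge> 0" by (simp add: T_def)
    have \<epsilon>0: "\<epsilon> > 0" using d E T0' by (simp add: \<epsilon>_def)
    have "(\<lambda>i. norm (e i) + L * G * a i) \<longlonglongrightarrow> 0 + L * G * 0"
      by (intro tendsto_intros tendsto_norm_zero e a)
    hence "\<forall>\<^sub>F i in sequentially. norm (e i) + L * G * a i < \<epsilon>"
      using \<epsilon>0 by (intro order_tendstoD(2)) auto
    moreover have "\<forall>\<^sub>F i in sequentially. a i < 1" using a(2) by (rule order_tendstoD(2)) simp
    ultimately have "\<forall>\<^sub>F i in sequentially. norm (e i) + L * G * a i < \<epsilon> \<and> a i < 1" by (rule eventually_conj)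
    then obtain N1 where N1: "\<And>i. i \<ge> N1 \<Longrightarrow> norm (e i) + L * G * a i < \<epsilon> \<and> a i < 1"
      by (auto simp: eventually_sequentially)
    have "\<forall>\<^sub>F k in sequentially. dist ((\<phi> \<circ> \<rho>) k) (\<zeta> 0) < d / (4 * E)"
      by (rule tendstoD[OF \<rho>(2)]) (use d E in simp)
    then obtain k0 where k0: "\<And>k. k \<ge> k0 \<Longrightarrow> dist (\<phi> (\<rho> k)) (\<zeta> 0) < d / (4 * E)"
      by (auto simp: eventually_sequentially)
    define k where "k = Max {k0, N, N1}"
    define m where "m = \<rho> k"
    have m: "m \<ge> N" "m \<ge> N1" "norm (\<phi> m - \<zeta> 0) < d / (4 * E)"
      using seq_suble[OF \<rho>(1), of k] k0[of k] by (auto simp: k_def m_def dist_norm)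
    obtain j where j: "T \<le> sum a {m..<m+j}" "sum a {m..<m+j} \<le> T + 1"
      using partial_sums_exceed[OF a(1) a(3) T0', of m 1] N1 m by (auto simp: less_imp_le)
    let ?s = "sum a {m..<m+j}"
    have "norm (\<phi> (m + j) - \<zeta> ?s) \<le> (norm (\<phi> m - \<zeta> 0) + \<epsilon> * ?s) * exp (L * ?s)"
    proof (rule perturbed_euler_tracks_flow[where g = g and \<phi> = \<phi> and e = e, OF flow L(2) L(1) G \<zeta>S \<phi>S a(1) rec])
      show "norm (e i) + L * G * a i \<le> \<epsilon>" if "i \<ge> m" for i using N1[of i] m that by auto
    qed
    also have "\<dots> \<le> (norm (\<phi> m - \<zeta> 0) + \<epsilon> * (T + 1)) * E"
      unfolding E_def using \<epsilon>0 j L T0' by (intro mult_mono add_left_mono) (auto intro!: mult_left_mono)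
    also have "\<dots> = norm (\<phi> m - \<zeta> 0) * E + d / 4"
    proof -
      have "\<epsilon> * (T + 1) * E = d / 4" using E T0' by (simp add: \<epsilon>_def)
      thus ?thesis by (simp add: distrib_right)
    qed
    also have "\<dots> < d / 4 + d / 4" using m(3) E by (simp add: field_simps)
    finally have "dist (\<phi> (m + j)) (\<zeta> ?s) < d / 2" by (simp add: dist_norm)
    moreover have "dist (\<zeta> ?s) c < d / 2" using j by (intro T1) (simp add: T_def)
    ultimately have "dist (\<phi> (m + j)) c < d" by (metis dist_triangle_half_l dist_commute)
    hence "\<phi> (m + j) \<in> U" using d by (auto simp: dist_commute)
    thus ?thesis using m by (intro exI[of _ "m + j"]) auto
  qed
  show ?thesis
  proof (rule tendstoI)
    fix \<epsilon> :: real assume "\<epsilon> > 0"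
    define \<eta> where "\<eta> = min \<epsilon> r / 2"
    have \<eta>: "0 < \<eta>" "\<eta> < r" "\<eta> < \<epsilon>" using \<open>\<epsilon> > 0\<close> r by (auto simp: \<eta>_def)
    obtain U where U: "open U" "c \<in> U" "U \<subseteq> ball c \<eta>"
      "\<forall>\<^sub>F m in sequentially. \<phi> m \<in> U \<longrightarrow> \<phi> (Suc m) \<in> U"
      using strict_maximum_trap[OF l Scc L(2) L(1) G \<phi>S max r(2) a(1,2) e rec \<eta>(1,2)] by metis
    then obtain N where N: "\<And>m. m \<ge> N \<Longrightarrow> \<phi> m \<in> U \<Longrightarrow> \<phi> (Suc m) \<in> U"
      by (auto simp: eventually_sequentially)
    obtain m0 where m0: "m0 \<ge> N" "\<phi> m0 \<in> U" using freq[OF U(1,2)] by blast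
    have "\<phi> m \<in> U" if "m \<ge> m0" for m
      using that by (induction m rule: dec_induct) (use m0 N in auto)
    thus "\<forall>\<^sub>F m in sequentially. dist (\<phi> m) c < \<epsilon>"
      unfolding eventually_sequentially using U(3) \<eta> by (force simp: dist_commute subset_iff)
  qed
qed

text \<open>Noise \<open>\<xi>\<close> whose weighted series converges need not be small. Adding the tail of that series
  to the iterates removes it at the cost of a vanishing perturbation of the gradient.\<close>

lemma noisy_gradient_ascent_converges:
  fixes l :: "'a::euclidean_space \<Rightarrow> real"
  assumes l: "\<And>x. (l has_derivative (\<lambda>h. g x \<bullet> h)) (at x)"
    and lip: "\<And>R. \<exists>L\<ge>0. \<forall>x\<in>cball 0 R. \<forall>y\<in>cball 0 R. norm (g x - g y) \<le> L * norm (x - y)"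
    and max: "\<And>x. l x \<le> l c"
    and r: "r > 0" "\<And>x. norm (x - c) \<le> r \<Longrightarrow> g x = 0 \<Longrightarrow> x = c"
    and a: "\<And>m. 0 < a m" "a \<longlonglongrightarrow> 0" "\<not> summable a"
    and b: "b \<longlonglongrightarrow> 0" and \<xi>: "summable (\<lambda>m. a m *\<^sub>R \<xi> m)"
    and rec: "\<And>m. x (Suc m) = x m + a m *\<^sub>R (g (x m) + b m + \<xi> m)"
    and bdd: "bounded (range x)"
    and K: "compact K" "\<exists>\<^sub>\<infinity>m. x m \<in> K"
    and flow: "\<And>y. y \<in> K \<Longrightarrow> \<exists>\<zeta>. \<zeta> 0 = y \<and>
      (\<forall>t\<ge>0. (\<zeta> has_vector_derivative g (\<zeta> t)) (at t within {0..})) \<and> (\<zeta> \<longlongrightarrow> c) at_top"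
  shows "x \<longlonglongrightarrow> c"
proof -
  define M where "M n = (\<Sum>m<n. a m *\<^sub>R \<xi> m)" for n
  define tail where "tail n = (\<Sum>m. a m *\<^sub>R \<xi> m) - M n" for n
  define \<phi> where "\<phi> n = x n + tail n" for n
  define e where "e n = g (x n) - g (\<phi> n) + b n" for n
  have "M \<longlonglongrightarrow> (\<Sum>m. a m *\<^sub>R \<xi> m)" unfolding M_def by (rule summable_LIMSEQ[OF \<xi>])
  hence tail0: "tail \<longlonglongrightarrow> 0"
    unfolding tail_def using tendsto_diff[OF tendsto_const[of "\<Sum>m. a m *\<^sub>R \<xi> m"]] by fastforce
  have "bounded (range tail)" using tail0 by (meson convergentI convergent_imp_bounded)
  moreover have "range \<phi> \<subseteq> (\<lambda>(u, v). u + v) ` (range x \<times> range tail)" by (auto simp: \<phi>_def)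
  ultimately have b\<phi>: "bounded (range \<phi>)"
    using bounded_subset[OF bounded_plus[OF bdd]] by blast
  have rec': "\<phi> (Suc n) = \<phi> n + a n *\<^sub>R (g (\<phi> n) + e n)" for n
    by (simp add: \<phi>_def tail_def M_def e_def rec algebra_simps)
  have "bounded (range x \<union> range \<phi>)" using bdd b\<phi> by (simp add: bounded_Un)
  then obtain R where "\<forall>y \<in> range x \<union> range \<phi>. norm y \<le> R" unfolding bounded_iff by blast
  hence R: "range x \<union> range \<phi> \<subseteq> cball 0 R" by auto
  obtain L where L: "L \<ge> 0" "\<forall>x\<in>cball 0 R. \<forall>y\<in>cball 0 R. norm (g x - g y) \<le> L * norm (x - y)"
    using lip by blast
  have "(\<lambda>n. g (x n) - g (\<phi> n)) \<longlonglongrightarrow> 0"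
  proof (rule Lim_null_comparison)
    show "\<forall>\<^sub>F n in sequentially. norm (g (x n) - g (\<phi> n)) \<le> L * norm (tail n)"
    proof (rule always_eventually, rule allI)
      fix n
      have "norm (g (x n) - g (\<phi> n)) \<le> L * norm (x n - \<phi> n)" using R L by blast
      thus "norm (g (x n) - g (\<phi> n)) \<le> L * norm (tail n)" by (simp add: \<phi>_def)
    qed
    show "(\<lambda>n. L * norm (tail n)) \<longlonglongrightarrow> 0" by (rule tendsto_mult_right_zero[OF tendsto_norm_zero[OF tail0]])
  qed
  hence e0: "e \<longlonglongrightarrow> 0" unfolding e_def using tendsto_add[OF _ b] by fastforce
  obtain \<rho>1 where \<rho>1: "strict_mono (\<rho>1 :: nat \<Rightarrow> nat)" "\<And>n. x (\<rho>1 n) \<in> K"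
    using infinite_enumerate[of "{m. x m \<in> K}"] K(2) by (auto simp: INFM_iff_infinite)
  obtain y \<rho>2 where \<rho>2: "y \<in> K" "strict_mono (\<rho>2 :: nat \<Rightarrow> nat)" "((x \<circ> \<rho>1) \<circ> \<rho>2) \<longlonglongrightarrow> y"
    using K(1) \<rho>1(2) unfolding compact_def by (metis comp_apply)
  define \<rho> where "\<rho> = \<rho>1 \<circ> \<rho>2"
  have \<rho>: "strict_mono \<rho>" unfolding \<rho>_def by (intro strict_mono_o \<rho>1 \<rho>2)
  obtain \<zeta> where \<zeta>: "\<zeta> 0 = y" "\<And>t. t \<ge> 0 \<Longrightarrow> (\<zeta> has_vector_derivative g (\<zeta> t)) (at t within {0..})"
    "(\<zeta> \<longlongrightarrow> c) at_top" using flow[OF \<rho>2(1)] by blast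
  have "(\<lambda>k. x (\<rho> k) + tail (\<rho> k)) \<longlonglongrightarrow> y + 0"
    using \<rho>2(3) LIMSEQ_subseq_LIMSEQ[OF tail0 \<rho>] by (intro tendsto_add) (auto simp: \<rho>_def comp_def)
  hence "(\<phi> \<circ> \<rho>) \<longlonglongrightarrow> \<zeta> 0" by (simp add: \<phi>_def comp_def \<zeta>(1))
  hence "\<phi> \<longlonglongrightarrow> c"
    using perturbed_gradient_ascent_converges[OF l lip max r a e0 rec' b\<phi> \<zeta>(2,3) \<rho>] by blast
  hence "(\<lambda>n. \<phi> n - tail n) \<longlonglongrightarrow> c - 0" by (intro tendsto_diff tail0)
  thus ?thesis by (simp add: \<phi>_def)
qed

text \<open>A critical point is a constant flow line, so it cannot lie in the region of attraction of
  another point.\<close>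

lemma isolated_critical_point:
  assumes "asymptotically_stable l c"
  obtains r where "r > 0" "\<And>x. norm (x - c) \<le> r \<Longrightarrow> grad l x = 0 \<Longrightarrow> x = c"
proof -
  obtain r where r: "r > 0"
    "\<And>\<zeta>. gradient_flow l \<zeta> \<Longrightarrow> norm (\<zeta> 0 - c) \<le> r \<Longrightarrow> (\<zeta> \<longlongrightarrow> c) at_top"
    using assms by (auto simp: asymptotically_stable_def)
  have "x = c" if "norm (x - c) \<le> r" "grad l x = 0" for x
  proof -
    have "gradient_flow l (\<lambda>t. x)" using that by (simp add: gradient_flow_def)
    hence "((\<lambda>t::real. x) \<longlongrightarrow> c) at_top" by (rule r(2)) (use that in simp)
    thus ?thesis by (simp add: tendsto_const_iff)
  qed
  thus ?thesis using that r by blast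
qed

section \<open>Almost sure convergence of martingale difference series\<close>

text \<open>Kolmogorov's maximal inequality for martingale differences. The martingale property is
  expressed by orthogonality to bounded functions of the past. The sum \<open>T\<close> that is stopped when
  it first reaches \<open>\<epsilon>\<close> keeps all test functions bounded.\<close>

lemma (in prob_space) kolmogorov_maximal_inequality:
  fixes \<xi> :: "nat \<Rightarrow> 'a \<Rightarrow> real" and F :: "nat \<Rightarrow> 'a measure"
  assumes F: "\<And>n. subalgebra M (F n)"
    and adapted: "\<And>i n. i < n \<Longrightarrow> \<xi> i \<in> borel_measurable (F n)"
    and sq: "\<And>i. integrable M (\<lambda>\<omega>. (\<xi> i \<omega>)\<^sup>2)" "\<And>i. (\<integral>\<omega>. (\<xi> i \<omega>)\<^sup>2 \<partial>M) \<le> v i"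
    and orth: "\<And>i G c. G \<in> borel_measurable (F i) \<Longrightarrow> (\<And>\<omega>. \<bar>G \<omega>\<bar> \<le> c) \<Longrightarrow> (\<integral>\<omega>. \<xi> i \<omega> * G \<omega> \<partial>M) = 0"
    and \<epsilon>: "\<epsilon> > 0"
  shows "prob {\<omega>\<in>space M. \<exists>k\<le>n. \<epsilon> \<le> \<bar>\<Sum>i<k. \<xi> (m + i) \<omega>\<bar>} \<le> (\<Sum>i<n. v (m + i)) / \<epsilon>\<^sup>2"
proof -
  define S where "S k \<omega> = (\<Sum>i<k. \<xi> (m + i) \<omega>)" for k \<omega>
  define B where "B i = {\<omega>\<in>space M. \<forall>j\<le>i. \<bar>S j \<omega>\<bar> < \<epsilon>}" for i
  define T where "T k \<omega> = (\<Sum>i<k. \<xi> (m + i) \<omega> * indicator (B i) \<omega>)" for k \<omega>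
  have \<xi>M[measurable]: "\<xi> i \<in> borel_measurable M" for i
    using adapted[of i "Suc i"] F measurable_from_subalg by blast
  have spF: "space (F k) = space M" for k using F by (simp add: subalgebra_def)
  have S_F: "S j \<in> borel_measurable (F (m + i))" if "j \<le> i" for i j
    unfolding S_def using that by (intro borel_measurable_sum adapted) auto
  have B_F: "B i \<in> sets (F (m + i))" for i
  proof -
    have "{\<omega>\<in>space (F (m + i)). \<forall>j\<in>{..i}. \<bar>S j \<omega>\<bar> < \<epsilon>} \<in> sets (F (m + i))"
    proof (rule sets.sets_Collect_finite_All)
      fix j assume "j \<in> {..i}"
      hence [measurable]: "S j \<in> borel_measurable (F (m + i))" by (intro S_F) simp
      show "{\<omega>\<in>space (F (m + i)). \<bar>S j \<omega>\<bar> < \<epsilon>} \<in> sets (F (m + i))" by measurable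
    qed simp
    thus ?thesis unfolding B_def spF by (simp only: Ball_def atMost_iff)
  qed
  have B_M[measurable]: "B i \<in> sets M" for i using B_F[of i] F[of "m + i"] by (auto simp: subalgebra_def)
  have T_M[measurable]: "T k \<in> borel_measurable M" for k unfolding T_def by measurable
  have S_M[measurable]: "S k \<in> borel_measurable M" for k unfolding S_def by measurable
  have TS: "T i \<omega> * indicator (B i) \<omega> = S i \<omega> * indicator (B i) \<omega>" for i \<omega>
  proof (cases "\<omega> \<in> B i")
    case True
    hence "\<omega> \<in> B j" if "j < i" for j using that by (auto simp: B_def)
    hence "T i \<omega> = S i \<omega>" unfolding T_def S_def by (intro sum.cong) auto
    thus ?thesis by simp
  qed simp
  have Tsq: "integrable M (\<lambda>\<omega>. (T k \<omega>)\<^sup>2) \<and> (\<integral>\<omega>. (T k \<omega>)\<^sup>2 \<partial>M) \<le> (\<Sum>i<k. v (m + i))" for k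
  proof (induction k)
    case 0
    show ?case by (simp add: T_def)
  next
    case (Suc k)
    let ?G = "\<lambda>\<omega>. S k \<omega> * indicator (B k) \<omega>"
    have G: "?G \<in> borel_measurable (F (m + k))"
      using S_F[of k k] B_F[of k] by measurable
    have Gb: "\<bar>?G \<omega>\<bar> \<le> \<epsilon>" for \<omega>
      using \<epsilon> by (auto simp: B_def indicator_def intro: less_imp_le)
    \<comment> \<open>on \<open>B k\<close> the stopped sum \<open>T k\<close> equals \<open>S k\<close>, which is bounded by \<open>\<epsilon>\<close> there\<close>
    have exp: "(T (Suc k) \<omega>)\<^sup>2 = (T k \<omega>)\<^sup>2 + 2 * (\<xi> (m + k) \<omega> * ?G \<omega>) + (\<xi> (m + k) \<omega>)\<^sup>2 * indicator (B k) \<omega>" for \<omega>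
      using TS[of k \<omega>] by (cases "\<omega> \<in> B k") (auto simp: T_def power2_eq_square algebra_simps)
    have i1: "integrable M (\<xi> (m + k))"
      using sq(1) square_integrable_imp_integrable[of "\<xi> (m + k)"] by auto
    have i2: "integrable M (\<lambda>\<omega>. \<xi> (m + k) \<omega> * ?G \<omega>)"
    proof (rule Bochner_Integration.integrable_bound)
      show "integrable M (\<lambda>\<omega>. \<epsilon> * \<xi> (m + k) \<omega>)" using i1 by simp
      show "AE \<omega> in M. norm (\<xi> (m + k) \<omega> * ?G \<omega>) \<le> norm (\<epsilon> * \<xi> (m + k) \<omega>)"
        using Gb \<epsilon> by (intro AE_I2) (simp add: abs_mult mult.commute[of "\<bar>\<xi> _ _\<bar>"] mult_right_mono del: abs_indicator)
    qed measurable
    have i3: "integrable M (\<lambda>\<omega>. (\<xi> (m + k) \<omega>)\<^sup>2 * indicator (B k) \<omega>)"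
      by (intro integrable_real_mult_indicator sq B_M)
    have "(\<integral>\<omega>. (\<xi> (m + k) \<omega>)\<^sup>2 * indicator (B k) \<omega> \<partial>M) \<le> (\<integral>\<omega>. (\<xi> (m + k) \<omega>)\<^sup>2 \<partial>M)"
      by (intro integral_mono i3 sq) (auto simp: indicator_def)
    hence "(\<integral>\<omega>. (\<xi> (m + k) \<omega>)\<^sup>2 * indicator (B k) \<omega> \<partial>M) \<le> v (m + k)"
      using sq(2) order_trans by blast
    moreover have "(\<integral>\<omega>. \<xi> (m + k) \<omega> * ?G \<omega> \<partial>M) = 0" by (rule orth[OF G Gb])
    ultimately show ?case unfolding exp using Suc.IH i2 i3
      by (simp add: Bochner_Integration.integral_add)
  qed
  have sub: "{\<omega>\<in>space M. \<exists>k\<le>n. \<epsilon> \<le> \<bar>\<Sum>i<k. \<xi> (m + i) \<omega>\<bar>} \<subseteq> {\<omega>\<in>space M. \<epsilon>\<^sup>2 \<le> (T n \<omega>)\<^sup>2}"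
  proof safe
    fix \<omega> k0 assume \<omega>: "\<omega> \<in> space M" and k0: "k0 \<le> n" "\<epsilon> \<le> \<bar>\<Sum>i<k0. \<xi> (m + i) \<omega>\<bar>"
    define k where "k = (LEAST k. \<epsilon> \<le> \<bar>S k \<omega>\<bar>)"
    have k: "\<epsilon> \<le> \<bar>S k \<omega>\<bar>" unfolding k_def by (rule LeastI[of _ k0]) (use k0 in \<open>simp add: S_def\<close>)
    have kn: "k \<le> n" using Least_le[of "\<lambda>k. \<epsilon> \<le> \<bar>S k \<omega>\<bar>" k0] k0 by (simp add: k_def S_def)
    have less: "\<bar>S j \<omega>\<bar> < \<epsilon>" if "j < k" for j
      using not_less_Least[of j "\<lambda>k. \<epsilon> \<le> \<bar>S k \<omega>\<bar>"] that by (simp add: k_def)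
    have Bi: "\<omega> \<in> B i \<longleftrightarrow> i < k" for i
      using less k \<omega> by (auto simp: B_def not_le[symmetric])
    have "T n \<omega> = (\<Sum>i<n. if i < k then \<xi> (m + i) \<omega> else 0)"
      unfolding T_def by (intro sum.cong) (auto simp: Bi indicator_def)
    also have "\<dots> = S k \<omega>"
      unfolding S_def using kn by (intro sum.mono_neutral_cong_right) auto
    finally have "\<epsilon> \<le> \<bar>T n \<omega>\<bar>" using k by simp
    thus "\<epsilon>\<^sup>2 \<le> (T n \<omega>)\<^sup>2" using \<epsilon> by (metis abs_le_square_iff abs_of_pos)
  qed
  have "prob {\<omega>\<in>space M. \<exists>k\<le>n. \<epsilon> \<le> \<bar>\<Sum>i<k. \<xi> (m + i) \<omega>\<bar>} \<le> prob {\<omega>\<in>space M. \<epsilon>\<^sup>2 \<le> (T n \<omega>)\<^sup>2}"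
    by (intro finite_measure_mono sub) measurable
  also have "\<dots> \<le> (\<integral>\<omega>. (T n \<omega>)\<^sup>2 \<partial>M) / \<epsilon>\<^sup>2"
    by (rule integral_Markov_inequality_measure[where A="{}", simplified]) (use Tsq \<epsilon> in auto)
  also have "\<dots> \<le> (\<Sum>i<n. v (m + i)) / \<epsilon>\<^sup>2" using Tsq by (intro divide_right_mono) auto
  finally show ?thesis .
qed

text \<open>The maximal inequality, applied to the tails of the series, makes its partial sums almost
  surely Cauchy.\<close>

lemma (in prob_space) martingale_difference_series_converges:
  fixes \<xi> :: "nat \<Rightarrow> 'a \<Rightarrow> real" and F :: "nat \<Rightarrow> 'a measure"
  assumes F: "\<And>n. subalgebra M (F n)"
    and adapted: "\<And>i n. i < n \<Longrightarrow> \<xi> i \<in> borel_measurable (F n)"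
    and sq: "\<And>i. integrable M (\<lambda>\<omega>. (\<xi> i \<omega>)\<^sup>2)" "\<And>i. (\<integral>\<omega>. (\<xi> i \<omega>)\<^sup>2 \<partial>M) \<le> v i"
    and orth: "\<And>i G c. G \<in> borel_measurable (F i) \<Longrightarrow> (\<And>\<omega>. \<bar>G \<omega>\<bar> \<le> c) \<Longrightarrow> (\<integral>\<omega>. \<xi> i \<omega> * G \<omega> \<partial>M) = 0"
    and v: "summable v"
  shows "AE \<omega> in M. summable (\<lambda>i. \<xi> i \<omega>)"
proof -
  have \<xi>M[measurable]: "\<xi> i \<in> borel_measurable M" for i
    using adapted[of i "Suc i"] F measurable_from_subalg by blast
  have v0: "v i \<ge> 0" for i using sq(2)[of i] by (rule order_trans[rotated]) simp
  define E where "E \<epsilon> m n = {\<omega>\<in>space M. \<exists>k\<le>n. \<epsilon> \<le> \<bar>\<Sum>i<k. \<xi> (m + i) \<omega>\<bar>}" for \<epsilon> and m n :: nat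
  have E_M[measurable]: "E \<epsilon> m n \<in> sets M" for \<epsilon> m n unfolding E_def by measurable
  define bad where "bad \<epsilon> = (\<Inter>m. \<Union>n. E \<epsilon> m n)" for \<epsilon>
  have bad_M[measurable]: "bad \<epsilon> \<in> sets M" for \<epsilon> unfolding bad_def by measurable
  have bad0: "prob (bad \<epsilon>) = 0" if \<epsilon>: "\<epsilon> > 0" for \<epsilon>
  proof -
    have le: "prob (bad \<epsilon>) \<le> (\<Sum>i. v (i + m)) / \<epsilon>\<^sup>2" for m
    proof -
      have "prob (\<Union>n. E \<epsilon> m n) \<le> (\<Sum>i. v (i + m)) / \<epsilon>\<^sup>2"
      proof (rule LIMSEQ_le_const2)
        show "(\<lambda>n. prob (E \<epsilon> m n)) \<longlonglongrightarrow> prob (\<Union>n. E \<epsilon> m n)"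
          by (rule finite_Lim_measure_incseq) (auto simp: E_def incseq_def intro: order_trans)
        have "prob (E \<epsilon> m n) \<le> (\<Sum>i. v (i + m)) / \<epsilon>\<^sup>2" for n
        proof -
          have "prob (E \<epsilon> m n) \<le> (\<Sum>i<n. v (m + i)) / \<epsilon>\<^sup>2"
            unfolding E_def by (rule kolmogorov_maximal_inequality[OF F adapted sq orth \<epsilon>])
          also have "\<dots> \<le> (\<Sum>i. v (i + m)) / \<epsilon>\<^sup>2"
            using v v0 by (intro divide_right_mono) (auto simp: add.commute intro!: sum_le_suminf summable_ignore_initial_segment)
          finally show ?thesis .
        qed
        thus "\<exists>N. \<forall>n\<ge>N. prob (E \<epsilon> m n) \<le> (\<Sum>i. v (i + m)) / \<epsilon>\<^sup>2" by blast
      qed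
      moreover have "prob (bad \<epsilon>) \<le> prob (\<Union>n. E \<epsilon> m n)"
        by (intro finite_measure_mono) (auto simp: bad_def)
      ultimately show ?thesis by linarith
    qed
    have "(\<lambda>m. (\<Sum>i. v (i + m)) / \<epsilon>\<^sup>2) \<longlonglongrightarrow> 0 / \<epsilon>\<^sup>2"
      using suminf_exist_split2[OF v] by (intro tendsto_intros) (use \<epsilon> in auto)
    hence "prob (bad \<epsilon>) \<le> 0" using le by (intro LIMSEQ_le_const) auto
    thus ?thesis using measure_nonneg[of M "bad \<epsilon>"] by linarith
  qed
  have "AE \<omega> in M. \<forall>q::nat. \<omega> \<notin> bad (1 / real (Suc q))"
    unfolding AE_all_countable
  proof
    fix q
    have "AE \<omega> in M. \<omega> \<notin> bad (1 / real (Suc q))"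
      using bad0[of "1 / real (Suc q)"] by (intro AE_not_in) (auto simp: null_setsI emeasure_eq_measure)
    thus "AE \<omega> in M. \<omega> \<notin> bad (1 / real (Suc q))" .
  qed
  with AE_space show ?thesis
  proof eventually_elim
    case (elim \<omega>)
    show ?case
      unfolding summable_Cauchy
    proof (intro allI impI)
      fix e :: real assume "e > 0"
      then obtain q where q: "1 / real (Suc q) < e / 2" using nat_approx_posE[of "e / 2"] by auto
      obtain m where m: "\<And>n. \<omega> \<notin> E (1 / real (Suc q)) m n" using elim(2) by (auto simp: bad_def)
      have small: "\<bar>\<Sum>i<k. \<xi> (m + i) \<omega>\<bar> < e / 2" for k
      proof -
        have "\<not> 1 / real (Suc q) \<le> \<bar>\<Sum>i<k. \<xi> (m + i) \<omega>\<bar>"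
          using m[of k] elim(1) unfolding E_def by blast
        thus ?thesis using q by linarith
      qed
      have "norm (\<Sum>i\<in>{p..<n}. \<xi> i \<omega>) < e" if "p \<ge> m" for p n
      proof (cases "p \<le> n")
        case True
        have "(\<Sum>i\<in>{m..<m+k}. \<xi> i \<omega>) = (\<Sum>i<k. \<xi> (m + i) \<omega>)" for k
          using sum.shift_bounds_nat_ivl[of "\<lambda>i. \<xi> i \<omega>" 0 m k] by (simp add: lessThan_atLeast0 add.commute)
        from this[of "n - m"] this[of "p - m"]
        have "(\<Sum>i\<in>{p..<n}. \<xi> i \<omega>) = (\<Sum>i<n-m. \<xi> (m + i) \<omega>) - (\<Sum>i<p-m. \<xi> (m + i) \<omega>)"
          using sum.atLeastLessThan_concat[of m p n "\<lambda>i. \<xi> i \<omega>"] that True by simp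
        thus ?thesis using small[of "n - m"] small[of "p - m"] unfolding real_norm_def by linarith
      qed (use \<open>e > 0\<close> in simp)
      thus "\<exists>N. \<forall>p\<ge>N. \<forall>n. norm (\<Sum>i\<in>{p..<n}. \<xi> i \<omega>) < e" by blast
    qed
  qed
qed

section \<open>Conditional laws and product kernels\<close>

text \<open>If the kernel \<open>\<kappa>\<close> gives the conditional probabilities, given the sub-sigma-algebra \<open>F\<close>, of
  each fixed event \<open>Y \<in> B\<close>, then expectations of functions that depend jointly on the past and on \<open>Y\<close>
  are iterated integrals. The joint law of the past and \<open>Y\<close> and the law built from \<open>\<kappa>\<close> agree on
  measurable rectangles, hence everywhere.\<close>

lemma (in prob_space) nn_integral_disintegrate:
  fixes Y :: "'a \<Rightarrow> 'b" and \<kappa> :: "'a \<Rightarrow> 'b measure"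
  assumes F: "subalgebra M F" and Y[measurable]: "Y \<in> measurable M N"
    and \<kappa>[measurable]: "\<kappa> \<in> measurable F (prob_algebra N)"
    and cond: "\<And>B. B \<in> sets N \<Longrightarrow>
      AE \<omega> in M. real_cond_exp M F (indicator (Y -` B \<inter> space M)) \<omega> = measure (\<kappa> \<omega>) B"
    and h[measurable]: "h \<in> borel_measurable (F \<Otimes>\<^sub>M N)"
  shows "(\<integral>\<^sup>+\<omega>. h (\<omega>, Y \<omega>) \<partial>M) = (\<integral>\<^sup>+\<omega>. \<integral>\<^sup>+b. h (\<omega>, b) \<partial>\<kappa> \<omega> \<partial>M)"
proof -
  interpret F: finite_measure_subalgebra M F by unfold_locales (rule F)
  define M' where "M' = restr_to_subalg M F"
  have sM'[measurable_cong]: "sets M' = sets F" unfolding M'_def by (rule sets_restr_to_subalg[OF F])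
  have spF: "space F = space M" using F by (simp add: subalgebra_def)
  have idF[measurable]: "(\<lambda>\<omega>. \<omega>) \<in> measurable M F"
    using F by (intro measurable_from_subalg[OF F]) auto
  have \<kappa>p: "prob_space (\<kappa> \<omega>)" "sets (\<kappa> \<omega>) = sets N" if "\<omega> \<in> space M" for \<omega>
    using measurable_space[OF \<kappa>, of \<omega>] that by (auto simp: space_prob_algebra spF)
  have \<kappa>s[measurable]: "\<kappa> \<in> measurable F (subprob_algebra N)" by (rule measurable_prob_algebraD[OF \<kappa>])
  have \<kappa>s': "\<kappa> \<in> measurable M' (subprob_algebra N)"
    using \<kappa>s by (simp add: measurable_cong_sets[OF sM' refl])
  have nnM': "(\<integral>\<^sup>+\<omega>. f \<omega> \<partial>M') = (\<integral>\<^sup>+\<omega>. f \<omega> \<partial>M)" if "f \<in> borel_measurable F" for f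
    unfolding M'_def by (rule nn_integral_subalgebra2[OF F that])
  define L1 where "L1 = distr M (F \<Otimes>\<^sub>M N) (\<lambda>\<omega>. (\<omega>, Y \<omega>))"
  define g where "g \<omega> = distr (\<kappa> \<omega>) (F \<Otimes>\<^sub>M N) (\<lambda>b. (\<omega>, b))" for \<omega>
  have g[measurable]: "g \<in> measurable F (subprob_algebra (F \<Otimes>\<^sub>M N))"
    unfolding g_def by (rule measurable_distr2[where M = N]) measurable
  have g': "g \<in> measurable M' (subprob_algebra (F \<Otimes>\<^sub>M N))"
    using g by (simp add: measurable_cong_sets[OF sM' refl])
  have pair[measurable]: "(\<lambda>b. (\<omega>, b)) \<in> measurable (\<kappa> \<omega>) (F \<Otimes>\<^sub>M N)" if "\<omega> \<in> space M" for \<omega>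
    using that \<kappa>p(2)[OF that] by (simp add: spF measurable_cong_sets[OF \<kappa>p(2)[OF that] refl])
  define L2 where "L2 = M' \<bind> g"
  have ne: "space M' \<noteq> {}" using not_empty spF sets_eq_imp_space_eq[OF sM'] by simp
  let ?E = "{a \<times> b | a b. a \<in> sets F \<and> b \<in> sets N}"
  have "L1 = L2"
  proof (rule measure_eqI_generator_eq[where E = "?E"
        and \<Omega> = "space F \<times> space N" and A = "\<lambda>_. space F \<times> space N"])
    show "Int_stable ?E" by (rule Int_stable_pair_measure_generator)
    show "?E \<subseteq> Pow (space F \<times> space N)"
      by (rule pair_measure_closed)
    show "sets L1 = sigma_sets (space F \<times> space N) ?E"
      by (simp add: L1_def sets_pair_measure)
    show "sets L2 = sigma_sets (space F \<times> space N) ?E"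
      unfolding L2_def using sets_bind[OF sets_kernel[OF g'] ne] by (simp add: sets_pair_measure)
    show "range (\<lambda>_. space F \<times> space N) \<subseteq> ?E" by auto
    show "(\<Union>i. space F \<times> space N) = space F \<times> space N" by simp
    show "emeasure L1 (space F \<times> space N) \<noteq> \<infinity>"
    proof -
      have "prob_space L1" unfolding L1_def by (rule prob_space_distr) measurable
      then interpret L1: prob_space L1 .
      show ?thesis using L1.emeasure_finite by simp
    qed
    fix X assume "X \<in> ?E"
    then obtain A B where X: "X = A \<times> B" and AB[measurable]: "A \<in> sets F" "B \<in> sets N" by auto
    have AM[measurable]: "A \<in> sets M" using F AB by (auto simp: subalgebra_def)
    have ind: "integrable M (indicator (Y -` B \<inter> space M) :: 'a \<Rightarrow> real)"
      by (simp add: integrable_indicator_iff emeasure_eq_measure)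
    have "emeasure L1 X = emeasure M (A \<inter> (Y -` B \<inter> space M))"
      unfolding L1_def X using sets.sets_into_space[OF AM]
      by (subst emeasure_distr) (auto intro!: arg_cong[where f = "emeasure M"])
    also have "\<dots> = ennreal (\<integral>\<omega>\<in>A. indicator (Y -` B \<inter> space M) \<omega> \<partial>M)"
      by (simp add: set_lebesgue_integral_def emeasure_eq_measure indicator_inter_arith[symmetric] Int_assoc)
    also have "(\<integral>\<omega>\<in>A. indicator (Y -` B \<inter> space M) \<omega> \<partial>M)
        = (\<integral>\<omega>\<in>A. real_cond_exp M F (indicator (Y -` B \<inter> space M)) \<omega> \<partial>M)"
      by (rule F.real_cond_exp_intA[OF ind AB(1)])
    also have "\<dots> = (\<integral>\<omega>\<in>A. measure (\<kappa> \<omega>) B \<partial>M)"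
      unfolding set_lebesgue_integral_def
      by (rule integral_cong_AE) (use cond[OF AB(2)] in \<open>auto elim!: eventually_mono intro!: borel_measurable_scaleR
          measurable_from_subalg[OF F borel_measurable_cond_exp] measurable_from_subalg[OF F]
          measurable_compose[OF \<kappa>s measurable_measure_subprob_algebra]\<close>)
    also have "ennreal \<dots> = (\<integral>\<^sup>+\<omega>. indicator A \<omega> * emeasure (\<kappa> \<omega>) B \<partial>M)"
    proof -
      have m: "(\<lambda>\<omega>. indicator A \<omega> * measure (\<kappa> \<omega>) B) \<in> borel_measurable M"
        by (intro borel_measurable_times borel_measurable_indicator AM measurable_from_subalg[OF F]
           measurable_compose[OF \<kappa>s measurable_measure_subprob_algebra] AB)
      have "(\<integral>\<^sup>+\<omega>. ennreal (indicator A \<omega> * measure (\<kappa> \<omega>) B) \<partial>M) = ennreal (\<integral>\<omega>. indicator A \<omega> * measure (\<kappa> \<omega>) B \<partial>M)"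
      proof (rule nn_integral_eq_integral)
        show "integrable M (\<lambda>\<omega>. indicator A \<omega> * measure (\<kappa> \<omega>) B)"
        proof (rule integrable_const_bound[of _ 1])
          show "AE \<omega> in M. norm (indicator A \<omega> * measure (\<kappa> \<omega>) B) \<le> 1"
            using \<kappa>p by (intro AE_I2) (auto simp: indicator_def prob_space.prob_le_1)
        qed (rule m)
      qed auto
      moreover have "(\<integral>\<^sup>+\<omega>. ennreal (indicator A \<omega> * measure (\<kappa> \<omega>) B) \<partial>M) = (\<integral>\<^sup>+\<omega>. indicator A \<omega> * emeasure (\<kappa> \<omega>) B \<partial>M)"
      proof (rule nn_integral_cong)
        fix \<omega> assume "\<omega> \<in> space M"
        then interpret k: prob_space "\<kappa> \<omega>" by (rule \<kappa>p)
        show "ennreal (indicator A \<omega> * measure (\<kappa> \<omega>) B) = indicator A \<omega> * emeasure (\<kappa> \<omega>) B"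
          by (auto simp: indicator_def k.emeasure_eq_measure)
      qed
      ultimately show ?thesis by (simp add: set_lebesgue_integral_def)
    qed
    also have "\<dots> = (\<integral>\<^sup>+\<omega>. emeasure (g \<omega>) X \<partial>M)"
    proof (rule nn_integral_cong)
      fix \<omega> assume \<omega>: "\<omega> \<in> space M"
      have "emeasure (g \<omega>) X = emeasure (\<kappa> \<omega>) ((\<lambda>b. (\<omega>, b)) -` X \<inter> space (\<kappa> \<omega>))"
        unfolding g_def by (rule emeasure_distr[OF pair[OF \<omega>]]) (simp add: X AB)
      also have "(\<lambda>b. (\<omega>, b)) -` X \<inter> space (\<kappa> \<omega>) = (if \<omega> \<in> A then B else {})"
        using sets.sets_into_space[OF AB(2)] sets_eq_imp_space_eq[OF \<kappa>p(2)[OF \<omega>]] by (auto simp: X)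
      finally show "indicator A \<omega> * emeasure (\<kappa> \<omega>) B = emeasure (g \<omega>) X" by simp
    qed
    also have "\<dots> = (\<integral>\<^sup>+\<omega>. emeasure (g \<omega>) X \<partial>M')"
      by (rule nnM'[symmetric]) (simp add: X)
    also have "\<dots> = emeasure L2 X"
      unfolding L2_def by (rule emeasure_bind[OF ne g', symmetric]) (simp add: X)
    finally show "emeasure L1 X = emeasure L2 X" .
  qed
  hence "(\<integral>\<^sup>+x. h x \<partial>L1) = (\<integral>\<^sup>+x. h x \<partial>L2)" by simp
  also have "(\<integral>\<^sup>+x. h x \<partial>L1) = (\<integral>\<^sup>+\<omega>. h (\<omega>, Y \<omega>) \<partial>M)"
    unfolding L1_def by (rule nn_integral_distr) measurable
  also have "(\<integral>\<^sup>+x. h x \<partial>L2) = (\<integral>\<^sup>+\<omega>. \<integral>\<^sup>+x. h x \<partial>g \<omega> \<partial>M')"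
    unfolding L2_def by (rule nn_integral_bind[OF h g'])
  also have "\<dots> = (\<integral>\<^sup>+\<omega>. \<integral>\<^sup>+x. h x \<partial>g \<omega> \<partial>M)" by (rule nnM') measurable
  also have "\<dots> = (\<integral>\<^sup>+\<omega>. \<integral>\<^sup>+b. h (\<omega>, b) \<partial>\<kappa> \<omega> \<partial>M)"
    by (intro nn_integral_cong) (simp add: g_def nn_integral_distr pair)
  finally show ?thesis .
qed

lemma nn_integral_eq_of_integral_0:
  fixes f :: "'a \<Rightarrow> real"
  assumes "integrable M f" "(\<integral>x. f x \<partial>M) = 0"
  shows "(\<integral>\<^sup>+x. ennreal (f x) \<partial>M) = (\<integral>\<^sup>+x. ennreal (- f x) \<partial>M)"
proof -
  have "(\<integral>\<^sup>+x. ennreal (f x) \<partial>M) < \<infinity>" "(\<integral>\<^sup>+x. ennreal (- f x) \<partial>M) < \<infinity>"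
    using assms(1) real_integrable_def[of M f] by (auto simp: less_top)
  moreover have "enn2real (\<integral>\<^sup>+x. ennreal (f x) \<partial>M) = enn2real (\<integral>\<^sup>+x. ennreal (- f x) \<partial>M)"
    using real_lebesgue_integral_def[OF assms(1)] assms(2) by simp
  ultimately show ?thesis by (metis ennreal_enn2real infinity_ennreal_def)
qed

text \<open>The martingale difference property: a function with conditional mean zero has mean zero.\<close>

lemma (in prob_space) integral_disintegrate_0:
  fixes Y :: "'a \<Rightarrow> 'b" and \<kappa> :: "'a \<Rightarrow> 'b measure" and h :: "'a \<times> 'b \<Rightarrow> real"
  assumes F: "subalgebra M F" and Y: "Y \<in> measurable M N"
    and \<kappa>: "\<kappa> \<in> measurable F (prob_algebra N)"
    and cond: "\<And>B. B \<in> sets N \<Longrightarrow>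
      AE \<omega> in M. real_cond_exp M F (indicator (Y -` B \<inter> space M)) \<omega> = measure (\<kappa> \<omega>) B"
    and h[measurable]: "h \<in> borel_measurable (F \<Otimes>\<^sub>M N)" and "integrable M (\<lambda>\<omega>. h (\<omega>, Y \<omega>))"
    and z: "\<And>\<omega>. \<omega> \<in> space M \<Longrightarrow> integrable (\<kappa> \<omega>) (\<lambda>b. h (\<omega>, b)) \<and> (\<integral>b. h (\<omega>, b) \<partial>\<kappa> \<omega>) = 0"
  shows "(\<integral>\<omega>. h (\<omega>, Y \<omega>) \<partial>M) = 0"
proof -
  note D = nn_integral_disintegrate[OF F Y \<kappa> cond]
  have "(\<integral>\<^sup>+\<omega>. ennreal (h (\<omega>, Y \<omega>)) \<partial>M) = (\<integral>\<^sup>+\<omega>. \<integral>\<^sup>+b. ennreal (h (\<omega>, b)) \<partial>\<kappa> \<omega> \<partial>M)"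
    by (rule D[OF _ measurable_compose[OF h measurable_ennreal]])
  also have "\<dots> = (\<integral>\<^sup>+\<omega>. \<integral>\<^sup>+b. ennreal (- h (\<omega>, b)) \<partial>\<kappa> \<omega> \<partial>M)"
    by (intro nn_integral_cong nn_integral_eq_of_integral_0) (use z in auto)
  also have "\<dots> = (\<integral>\<^sup>+\<omega>. ennreal (- h (\<omega>, Y \<omega>)) \<partial>M)"
    by (rule D[OF _ measurable_compose[OF borel_measurable_uminus[OF h] measurable_ennreal], symmetric])
  finally show ?thesis using real_lebesgue_integral_def[OF assms(6)] by simp
qed

lemma measurable_PiM_power_kernel:
  assumes Q[measurable]: "Q \<in> measurable M (prob_algebra N)" and I: "finite I"
  shows "(\<lambda>x. PiM I (\<lambda>_. Q x)) \<in> measurable M (prob_algebra (PiM I (\<lambda>_. N)))"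
proof (rule measurable_prob_algebra_generated)
  have Qs: "prob_space (Q x)" "sets (Q x) = sets N" if "x \<in> space M" for x
    using measurable_space[OF Q that] by (auto simp: space_prob_algebra)
  show "sets (PiM I (\<lambda>_. N)) = sigma_sets (\<Pi>\<^sub>E i\<in>I. space N) (prod_algebra I (\<lambda>_. N))"
    by (rule sets_PiM)
  show "Int_stable (prod_algebra I (\<lambda>_. N))" by (rule Int_stable_prod_algebra)
  show "prod_algebra I (\<lambda>_. N) \<subseteq> Pow (\<Pi>\<^sub>E i\<in>I. space N)" by (rule prod_algebra_sets_into_space)
  show "prob_space (PiM I (\<lambda>_. Q x))" if "x \<in> space M" for x
    using Qs[OF that] by (intro prob_space_PiM)
  show "sets (PiM I (\<lambda>_. Q x)) = sets (PiM I (\<lambda>_. N))" if "x \<in> space M" for x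
    using Qs[OF that] by (intro sets_PiM_cong) auto
  fix A assume "A \<in> prod_algebra I (\<lambda>_. N)"
  then obtain X where A: "A = Pi\<^sub>E I X" and X: "\<And>i. i \<in> I \<Longrightarrow> X i \<in> sets N"
    using I by (auto simp: prod_algebra_eq_finite)
  have "emeasure (PiM I (\<lambda>_. Q x)) A = (\<Prod>i\<in>I. emeasure (Q x) (X i))" if "x \<in> space M" for x
  proof -
    interpret q: prob_space "Q x" using Qs that by auto
    interpret product_sigma_finite "\<lambda>_. Q x" by unfold_locales
    show ?thesis unfolding A using X Qs(2)[OF that] I by (intro emeasure_PiM) auto
  qed
  moreover have "(\<lambda>x. \<Prod>i\<in>I. emeasure (Q x) (X i)) \<in> borel_measurable M"
    by (intro borel_measurable_prod_ennreal measurable_compose[OF measurable_prob_algebraD[OF Q] measurable_emeasure_subprob_algebra] X)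
  ultimately show "(\<lambda>x. emeasure (PiM I (\<lambda>_. Q x)) A) \<in> borel_measurable M"
    by (subst measurable_cong) auto
qed

section \<open>Self-normalized importance sampling\<close>

lemma integral_iid_sum:
  fixes h :: "'a \<Rightarrow> real" and n :: nat
  assumes Q: "prob_space Q" and h[measurable]: "h \<in> borel_measurable Q" and b: "AE y in Q. \<bar>h y\<bar> \<le> c"
  defines "M \<equiv> PiM {..<n} (\<lambda>_. Q)"
  shows "integrable M (\<lambda>x. \<Sum>j<n. h (x j))"
    and "(\<integral>x. (\<Sum>j<n. h (x j)) \<partial>M) = real n * (\<integral>y. h y \<partial>Q)"
proof -
  interpret Q: prob_space Q by (rule Q)
  interpret product_prob_space "\<lambda>_. Q" "{..<n}" by unfold_locales
  have int: "integrable Q h" using b by (intro Q.integrable_const_bound[of _ c]) auto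
  have comp: "integrable M (\<lambda>x. h (x j)) \<and> (\<integral>x. h (x j) \<partial>M) = (\<integral>y. h y \<partial>Q)" if "j < n" for j
  proof -
    have d: "distr M Q (\<lambda>x. x j) = Q" unfolding M_def using that by (intro PiM_component) auto
    have m[measurable]: "(\<lambda>x. x j) \<in> measurable M Q" unfolding M_def using that by simp
    have "integrable (distr M Q (\<lambda>x. x j)) h" using int d by simp
    hence "integrable M (\<lambda>x. h (x j))" by (rule integrable_distr[OF m])
    thus ?thesis using integral_distr[OF m h] d by simp
  qed
  show "integrable M (\<lambda>x. \<Sum>j<n. h (x j))" using comp by (intro Bochner_Integration.integrable_sum) auto
  show "(\<integral>x. (\<Sum>j<n. h (x j)) \<partial>M) = real n * (\<integral>y. h y \<partial>Q)"
    using comp by (subst Bochner_Integration.integral_sum) auto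
qed

lemma integral_iid_centered_sum_square:
  fixes h :: "'a \<Rightarrow> real" and n :: nat
  assumes Q: "prob_space Q" and h[measurable]: "h \<in> borel_measurable Q" and b: "AE y in Q. \<bar>h y\<bar> \<le> c"
    and z: "(\<integral>y. h y \<partial>Q) = 0"
  defines "M \<equiv> PiM {..<n} (\<lambda>_. Q)"
  shows "integrable M (\<lambda>x. (\<Sum>j<n. h (x j))\<^sup>2)"
    and "(\<integral>x. (\<Sum>j<n. h (x j))\<^sup>2 \<partial>M) \<le> real n * c\<^sup>2"
proof -
  interpret Q: prob_space Q by (rule Q)
  interpret product_prob_space "\<lambda>_. Q" "{..<n}" by unfold_locales
  have int: "integrable Q h" using b by (intro Q.integrable_const_bound[of _ c]) auto
  have b2: "AE y in Q. (h y)\<^sup>2 \<le> c\<^sup>2" using b by eventually_elim (rule abs_le_square_iff[THEN iffD1], simp)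
  have int2: "integrable Q (\<lambda>y. (h y)\<^sup>2)" using b2 by (intro Q.integrable_const_bound[of _ "c\<^sup>2"]) auto
  have "(\<integral>y. (h y)\<^sup>2 \<partial>Q) \<le> (\<integral>y. c\<^sup>2 \<partial>Q)" by (intro integral_mono_AE int2 b2) simp
  hence le: "(\<integral>y. (h y)\<^sup>2 \<partial>Q) \<le> c\<^sup>2" by (simp add: Q.prob_space)
  have pr: "integrable M (\<lambda>x. h (x i) * h (x j)) \<and>
      (\<integral>x. h (x i) * h (x j) \<partial>M) = (if i = j then (\<integral>y. (h y)\<^sup>2 \<partial>Q) else 0)" if ij: "i < n" "j < n" for i j
  proof -
    define f where "f k y = (if k = i then h y else 1) * (if k = j then h y else 1)" for k y
    \<comment> \<open>written as a product over all coordinates, so that Fubini applies; \<open>i = j\<close> is included\<close>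
    have f: "(\<lambda>x. \<Prod>k\<in>{..<n}. f k (x k)) = (\<lambda>x. h (x i) * h (x j))"
      unfolding f_def prod.distrib using ij by (simp add: prod.delta)
    have fi: "integrable Q (f k)" for k
      using int int2 by (cases "k = i"; cases "k = j") (auto simp: f_def[abs_def] power2_eq_square)
    have "(\<integral>x. h (x i) * h (x j) \<partial>M) = (\<Prod>k\<in>{..<n}. integral\<^sup>L Q (f k))"
      unfolding f[symmetric] M_def by (rule product_integral_prod) (auto intro: fi)
    also have "\<dots> = (if i = j then (\<integral>y. (h y)\<^sup>2 \<partial>Q) else 0)"
    proof (cases "i = j")
      case True
      have "integral\<^sup>L Q (f k) = (if k = i then (\<integral>y. (h y)\<^sup>2 \<partial>Q) else 1)" for k
        using True by (auto simp: f_def[abs_def] power2_eq_square Q.prob_space)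
      thus ?thesis using True ij by (simp add: prod.delta)
    next
      case False
      have "integral\<^sup>L Q (f i) = 0" using False z by (simp add: f_def[abs_def])
      hence "(\<Prod>k\<in>{..<n}. integral\<^sup>L Q (f k)) = 0" using ij by (intro prod_zero) auto
      thus ?thesis using False by simp
    qed
    finally show ?thesis unfolding f[symmetric] M_def by (auto intro: product_integrable_prod fi)
  qed
  have sq: "(\<lambda>x. (\<Sum>j<n. h (x j))\<^sup>2) = (\<lambda>x. \<Sum>i<n. \<Sum>j<n. h (x i) * h (x j))"
    by (simp add: power2_eq_square sum_product)
  show "integrable M (\<lambda>x. (\<Sum>j<n. h (x j))\<^sup>2)"
    unfolding sq using pr by (intro Bochner_Integration.integrable_sum) auto
  have "(\<integral>x. (\<Sum>j<n. h (x j))\<^sup>2 \<partial>M) = (\<Sum>i<n. \<Sum>j<n. (\<integral>x. h (x i) * h (x j) \<partial>M))"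
    unfolding sq using pr
    by (subst Bochner_Integration.integral_sum)
       (auto intro!: Bochner_Integration.integrable_sum Bochner_Integration.integral_sum sum.cong)
  also have "\<dots> = (\<Sum>i<n. (\<integral>y. (h y)\<^sup>2 \<partial>Q))"
    using pr by (intro sum.cong refl) (simp add: sum.delta)
  also have "\<dots> \<le> real n * c\<^sup>2" using le by (simp add: mult_left_mono)
  finally show "(\<integral>x. (\<Sum>j<n. h (x j))\<^sup>2 \<partial>M) \<le> real n * c\<^sup>2" .
qed

lemma weighted_average_bound:
  fixes w u :: "nat \<Rightarrow> real"
  assumes w: "\<And>j. j < n \<Longrightarrow> 0 \<le> w j" and u: "\<And>j. j < n \<Longrightarrow> \<bar>u j\<bar> \<le> B" and B: "B \<ge> 0"
  shows "\<bar>inverse (\<Sum>j<n. w j) * (\<Sum>j<n. w j * u j)\<bar> \<le> B"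
proof -
  have W: "(\<Sum>j<n. w j) \<ge> 0" using w by (intro sum_nonneg) auto
  have "\<bar>\<Sum>j<n. w j * u j\<bar> \<le> (\<Sum>j<n. w j * B)"
    by (rule order_trans[OF sum_abs], rule sum_mono) (use w u in \<open>auto simp: abs_mult intro!: mult_left_mono\<close>)
  also have "\<dots> = (\<Sum>j<n. w j) * B" by (simp add: sum_distrib_right)
  finally have *: "\<bar>\<Sum>j<n. w j * u j\<bar> \<le> (\<Sum>j<n. w j) * B" .
  show ?thesis
  proof (cases "(\<Sum>j<n. w j) = 0")
    case False
    thus ?thesis using * W by (simp add: abs_mult field_simps)
  qed (use B in simp)
qed

text \<open>The self-normalized importance sampling estimate \<open>R\<close> of \<open>\<rho> = \<integral> w u / \<integral> w\<close> from \<open>n\<close>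
  independent draws has mean square error and bias of order \<open>1 / n\<close>. With \<open>A\<close> the linearization of \<open>R - \<rho>\<close> and \<open>E\<close> the relative error of the averaged weights,
  \<open>R - \<rho> = A + (R - \<rho>) E\<close>. Here \<open>A\<close> is centered, \<open>A\<close> and \<open>E\<close> have second moments of order
  \<open>1 / n\<close>, and \<open>R - \<rho>\<close> is bounded. If all weights vanish, \<open>R = 0\<close>; this event is exponentially unlikely.\<close>

lemma self_normalized_estimate:
  fixes w u :: "'a \<Rightarrow> real" and n :: nat
  assumes Q: "prob_space Q" and wm[measurable]: "w \<in> borel_measurable Q" and um[measurable]: "u \<in> borel_measurable Q"
    and w: "AE y in Q. 0 \<le> w y \<and> w y \<le> C" and u: "AE y in Q. \<bar>u y\<bar> \<le> B" and B: "B \<ge> 0"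
    and \<beta>: "0 < \<beta>" "\<beta> \<le> (\<integral>y. w y \<partial>Q)" and n: "0 < n"
  defines "M \<equiv> PiM {..<n} (\<lambda>_. Q)"
  defines "\<rho> \<equiv> (\<integral>y. w y * u y \<partial>Q) / (\<integral>y. w y \<partial>Q)"
  defines "R \<equiv> \<lambda>x. inverse (\<Sum>j<n. w (x j)) * (\<Sum>j<n. w (x j) * u (x j))"
  shows "AE x in M. \<bar>R x\<bar> \<le> B"
    and "R \<in> borel_measurable M"
    and "(\<integral>x. (R x - \<rho>)\<^sup>2 \<partial>M) \<le> 16 * B\<^sup>2 * C\<^sup>2 / \<beta>\<^sup>2 / real n"
    and "\<bar>(\<integral>x. R x \<partial>M) - \<rho>\<bar> \<le> (8 * B\<^sup>2 + 1 / 2) * C\<^sup>2 / \<beta>\<^sup>2 / real n"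
    and "measure M {x\<in>space M. (\<Sum>j<n. w (x j)) = 0} \<le> (1 - \<beta> / C) ^ n"
proof -
  interpret Q: prob_space Q by (rule Q)
  interpret product_prob_space "\<lambda>_. Q" "{..<n}" by unfold_locales
  have P: "prob_space M" unfolding M_def by (intro prob_space_PiM Q)
  interpret PM: prob_space M by (rule P)
  have m[measurable]: "(\<lambda>x. x j) \<in> measurable M Q" if "j < n" for j unfolding M_def using that by simp
  show Rm[measurable]: "R \<in> borel_measurable M"
    unfolding R_def by (intro borel_measurable_times borel_measurable_inverse borel_measurable_sum
        measurable_compose[OF m wm] measurable_compose[OF m um]) auto
  have AEP: "AE x in M. \<forall>j\<in>{..<n}. 0 \<le> w (x j) \<and> w (x j) \<le> C \<and> \<bar>u (x j)\<bar> \<le> B"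
  proof (rule AE_finite_allI)
    fix j assume "j \<in> {..<n}"
    thus "AE x in M. 0 \<le> w (x j) \<and> w (x j) \<le> C \<and> \<bar>u (x j)\<bar> \<le> B"
      unfolding M_def using w u by (intro AE_component) auto
  qed simp
  show Rb: "AE x in M. \<bar>R x\<bar> \<le> B"
    using AEP by eventually_elim (unfold R_def, rule weighted_average_bound, use B in auto)
  let ?b = "\<integral>y. w y \<partial>Q"
  have wi: "integrable Q w" using w by (intro Q.integrable_const_bound[of _ C]) auto
  have "?b \<le> (\<integral>y. C \<partial>Q)" using w by (intro integral_mono_AE wi) auto
  hence bC: "?b \<le> C" by (simp add: Q.prob_space)
  have C: "C > 0" using bC \<beta> by linarith
  have b0: "?b > 0" using \<beta> by linarith
  have wub: "AE y in Q. \<bar>w y * u y\<bar> \<le> w y * B"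
    using w u by eventually_elim (auto simp: abs_mult intro!: mult_left_mono)
  have wui: "integrable Q (\<lambda>y. w y * u y)"
    by (rule Bochner_Integration.integrable_bound[of _ "\<lambda>y. w y * B"]) (use wi wub w in \<open>auto elim!: eventually_mono\<close>)
  have "\<bar>\<integral>y. w y * u y \<partial>Q\<bar> \<le> (\<integral>y. \<bar>w y * u y\<bar> \<partial>Q)" by (rule integral_abs_bound)
  also have "\<dots> \<le> (\<integral>y. w y * B \<partial>Q)" using wi wui wub by (intro integral_mono_AE) auto
  also have "\<dots> = ?b * B" by simp
  finally have \<rho>B: "\<bar>\<rho>\<bar> \<le> B" using b0 by (simp add: \<rho>_def field_simps)
  define h where "h y = w y * (u y - \<rho>)" for y
  have hm[measurable]: "h \<in> borel_measurable Q" unfolding h_def by measurable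
  have hb: "AE y in Q. \<bar>h y\<bar> \<le> C * (2 * B)"
    using w u
  proof eventually_elim
    case (elim y)
    hence "\<bar>u y - \<rho>\<bar> \<le> 2 * B" using \<rho>B by linarith
    thus ?case using elim C unfolding h_def abs_mult by (intro mult_mono) auto
  qed
  have h0: "(\<integral>y. h y \<partial>Q) = 0"
    unfolding h_def right_diff_distrib using wi wui b0 by (simp add: \<rho>_def)
  define k where "k y = ?b - w y" for y
  have km[measurable]: "k \<in> borel_measurable Q" unfolding k_def by measurable
  have kb: "AE y in Q. \<bar>k y\<bar> \<le> C"
    using w by eventually_elim (use bC b0 in \<open>auto simp: k_def\<close>)
  have k0: "(\<integral>y. k y \<partial>Q) = 0" unfolding k_def using wi by (simp add: Q.prob_space)
  define A where "A x = (\<Sum>j<n. h (x j)) / (n * ?b)" for x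
  define E where "E x = (\<Sum>j<n. k (x j)) / (n * ?b)" for x
  have sqle: "real n * c\<^sup>2 / (real n * ?b)\<^sup>2 \<le> c\<^sup>2 / \<beta>\<^sup>2 / real n" for c
  proof -
    have "real n * c\<^sup>2 / (real n * ?b)\<^sup>2 = (c\<^sup>2 / real n) / ?b\<^sup>2" using n by (simp add: power2_eq_square)
    also have "\<dots> \<le> (c\<^sup>2 / real n) / \<beta>\<^sup>2" using \<beta> by (intro divide_left_mono power_mono) auto
    finally show ?thesis by (simp add: mult.commute)
  qed
  have A2: "integrable M (\<lambda>x. (A x)\<^sup>2)" "(\<integral>x. (A x)\<^sup>2 \<partial>M) \<le> (C * (2 * B))\<^sup>2 / \<beta>\<^sup>2 / real n"
  proof -
    note I = integral_iid_centered_sum_square[OF Q hm hb h0, of n, folded M_def]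
    show "integrable M (\<lambda>x. (A x)\<^sup>2)" unfolding A_def power_divide using I(1) by simp
    have "(\<integral>x. (A x)\<^sup>2 \<partial>M) \<le> real n * (C * (2 * B))\<^sup>2 / (real n * ?b)\<^sup>2"
      unfolding A_def power_divide using I(2) by (simp add: divide_right_mono)
    thus "(\<integral>x. (A x)\<^sup>2 \<partial>M) \<le> (C * (2 * B))\<^sup>2 / \<beta>\<^sup>2 / real n" using sqle order_trans by blast
  qed
  have E2: "integrable M (\<lambda>x. (E x)\<^sup>2)" "(\<integral>x. (E x)\<^sup>2 \<partial>M) \<le> C\<^sup>2 / \<beta>\<^sup>2 / real n"
  proof -
    note I = integral_iid_centered_sum_square[OF Q km kb k0, of n, folded M_def]
    show "integrable M (\<lambda>x. (E x)\<^sup>2)" unfolding E_def power_divide using I(1) by simp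
    have "(\<integral>x. (E x)\<^sup>2 \<partial>M) \<le> real n * C\<^sup>2 / (real n * ?b)\<^sup>2"
      unfolding E_def power_divide using I(2) by (simp add: divide_right_mono)
    thus "(\<integral>x. (E x)\<^sup>2 \<partial>M) \<le> C\<^sup>2 / \<beta>\<^sup>2 / real n" using sqle order_trans by blast
  qed
  have A1: "integrable M A" "(\<integral>x. A x \<partial>M) = 0"
    unfolding A_def using integral_iid_sum[OF Q hm hb, of n, folded M_def] h0 by simp_all
  have Em[measurable]: "E \<in> borel_measurable M"
    unfolding E_def by (intro borel_measurable_divide borel_measurable_sum measurable_compose[OF m km]) auto
  have Am[measurable]: "A \<in> borel_measurable M" using A1 by auto
  \<comment> \<open>also when all weights vanish: then \<open>R x = A x = 0\<close> and \<open>E x = 1\<close>\<close>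
  have id: "AE x in M. R x - \<rho> = A x + (R x - \<rho>) * E x"
    using AEP
  proof eventually_elim
    case (elim x)
    let ?W = "\<Sum>j<n. w (x j)"
    have hs: "(\<Sum>j<n. h (x j)) = (\<Sum>j<n. w (x j) * u (x j)) - \<rho> * ?W"
      by (simp add: h_def right_diff_distrib sum_subtractf sum_distrib_left mult.commute)
    have ks: "(\<Sum>j<n. k (x j)) = real n * ?b - ?W" by (simp add: k_def sum_subtractf)
    have "(R x - \<rho>) * ?W = (\<Sum>j<n. h (x j))"
    proof (cases "?W = 0")
      case True
      hence "w (x j) = 0" if "j < n" for j using elim that by (subst (asm) sum_nonneg_eq_0_iff) auto
      thus ?thesis unfolding hs by simp
    next
      case False
      thus ?thesis unfolding hs by (simp add: R_def left_diff_distrib)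
    qed
    hence "A x = (R x - \<rho>) * (?W / (real n * ?b))" by (simp add: A_def)
    moreover have "E x = 1 - ?W / (real n * ?b)" using n b0 unfolding E_def ks by (simp add: diff_divide_distrib)
    moreover have "R x - \<rho> = (R x - \<rho>) * r + (R x - \<rho>) * (1 - r)" for r by (simp add: algebra_simps)
    ultimately show ?case by (simp only:)
  qed
  have Rb2: "AE x in M. \<bar>R x - \<rho>\<bar> \<le> 2 * B" using Rb by eventually_elim (use \<rho>B in linarith)
  have R2i: "integrable M (\<lambda>x. (R x - \<rho>)\<^sup>2)"
  proof (rule PM.integrable_const_bound[of _ "(2 * B)\<^sup>2"])
    show "AE x in M. norm ((R x - \<rho>)\<^sup>2) \<le> (2 * B)\<^sup>2"
      using Rb2
    proof eventually_elim
      case (elim x)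
      have "\<bar>R x - \<rho>\<bar>\<^sup>2 \<le> (2 * B)\<^sup>2" using elim by (intro power_mono) auto
      thus ?case by simp
    qed
  qed measurable
  have "(\<integral>x. (R x - \<rho>)\<^sup>2 \<partial>M) \<le> (\<integral>x. 2 * (A x)\<^sup>2 + 2 * (2 * B)\<^sup>2 * (E x)\<^sup>2 \<partial>M)"
  proof (rule integral_mono_AE)
    show "AE x in M. (R x - \<rho>)\<^sup>2 \<le> 2 * (A x)\<^sup>2 + 2 * (2 * B)\<^sup>2 * (E x)\<^sup>2"
      using id Rb2
    proof eventually_elim
      case (elim x)
      have "(R x - \<rho>)\<^sup>2 = (A x + (R x - \<rho>) * E x)\<^sup>2" using elim(1) by simp
      also have "\<dots> \<le> 2 * (A x)\<^sup>2 + 2 * ((R x - \<rho>) * E x)\<^sup>2"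
        using sum_squares_bound[of "A x" "(R x - \<rho>) * E x"] by (simp add: power2_sum)
      also have "((R x - \<rho>) * E x)\<^sup>2 \<le> (2 * B)\<^sup>2 * (E x)\<^sup>2"
      proof -
        have "\<bar>R x - \<rho>\<bar>\<^sup>2 \<le> (2 * B)\<^sup>2" using elim(2) by (intro power_mono) auto
        thus ?thesis by (simp only: power_mult_distrib[of "R x - \<rho>"] power2_abs) (rule mult_right_mono, simp_all)
      qed
      finally show ?case by simp
    qed
  qed (use R2i A2 E2 in auto)
  also have "\<dots> = 2 * (\<integral>x. (A x)\<^sup>2 \<partial>M) + 2 * (2 * B)\<^sup>2 * (\<integral>x. (E x)\<^sup>2 \<partial>M)"
    using A2 E2 by simp
  also have "\<dots> \<le> 2 * ((C * (2 * B))\<^sup>2 / \<beta>\<^sup>2 / real n) + 2 * (2 * B)\<^sup>2 * (C\<^sup>2 / \<beta>\<^sup>2 / real n)"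
    using A2 E2 by (intro add_mono mult_left_mono) auto
  also have "\<dots> = 16 * B\<^sup>2 * C\<^sup>2 / \<beta>\<^sup>2 / real n"
    by (simp add: power_mult_distrib add_divide_distrib[symmetric] algebra_simps)
  finally show R2: "(\<integral>x. (R x - \<rho>)\<^sup>2 \<partial>M) \<le> 16 * B\<^sup>2 * C\<^sup>2 / \<beta>\<^sup>2 / real n" .
  have Ri: "integrable M R" using Rb by (intro PM.integrable_const_bound[of _ B]) auto
  have REi: "integrable M (\<lambda>x. (R x - \<rho>) * E x)"
  proof -
    have "integrable M E" using E2(1) PM.square_integrable_imp_integrable[OF Em] by blast
    hence "integrable M (\<lambda>x. (2 * B) * E x)" by simp
    thus ?thesis
      by (rule Bochner_Integration.integrable_bound)
         (use Rb2 B in \<open>auto elim!: eventually_mono simp: abs_mult intro!: mult_right_mono\<close>)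
  qed
  have "(\<integral>x. R x \<partial>M) - \<rho> = (\<integral>x. R x - \<rho> \<partial>M)" using Ri by (simp add: PM.prob_space)
  also have "\<dots> = (\<integral>x. A x + (R x - \<rho>) * E x \<partial>M)"
    by (intro integral_cong_AE id) measurable
  also have "\<dots> = (\<integral>x. (R x - \<rho>) * E x \<partial>M)" using A1 REi by simp
  finally have eq: "(\<integral>x. R x \<partial>M) - \<rho> = (\<integral>x. (R x - \<rho>) * E x \<partial>M)" .
  have "\<bar>\<integral>x. (R x - \<rho>) * E x \<partial>M\<bar> \<le> (\<integral>x. \<bar>(R x - \<rho>) * E x\<bar> \<partial>M)" by (rule integral_abs_bound)
  also have "\<dots> \<le> (\<integral>x. ((R x - \<rho>)\<^sup>2 + (E x)\<^sup>2) / 2 \<partial>M)"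
  proof (rule integral_mono)
    fix x
    have "2 * \<bar>R x - \<rho>\<bar> * \<bar>E x\<bar> \<le> \<bar>R x - \<rho>\<bar>\<^sup>2 + \<bar>E x\<bar>\<^sup>2" by (rule sum_squares_bound)
    thus "\<bar>(R x - \<rho>) * E x\<bar> \<le> ((R x - \<rho>)\<^sup>2 + (E x)\<^sup>2) / 2" by (simp add: abs_mult)
  qed (use REi R2i E2 in auto)
  also have "\<dots> = ((\<integral>x. (R x - \<rho>)\<^sup>2 \<partial>M) + (\<integral>x. (E x)\<^sup>2 \<partial>M)) / 2" using R2i E2 by simp
  also have "\<dots> \<le> (16 * B\<^sup>2 * C\<^sup>2 / \<beta>\<^sup>2 / real n + C\<^sup>2 / \<beta>\<^sup>2 / real n) / 2"
    by (intro divide_right_mono add_mono R2 E2(2)) simp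
  also have "\<dots> = (8 * B\<^sup>2 + 1 / 2) * C\<^sup>2 / \<beta>\<^sup>2 / real n" by (simp add: add_divide_distrib algebra_simps)
  finally show "\<bar>(\<integral>x. R x \<partial>M) - \<rho>\<bar> \<le> (8 * B\<^sup>2 + 1 / 2) * C\<^sup>2 / \<beta>\<^sup>2 / real n" unfolding eq .
  let ?Z = "{y\<in>space Q. w y = 0}"
  have "?b \<le> (\<integral>y. C * indicator (space Q - ?Z) y \<partial>Q)"
  proof (rule integral_mono_AE[OF wi])
    show "integrable Q (\<lambda>y. C * indicator (space Q - ?Z) y)"
      by (intro integrable_mult_right) (simp add: integrable_indicator_iff Q.emeasure_eq_measure)
    show "AE y in Q. w y \<le> C * indicator (space Q - ?Z) y"
      using w AE_space by eventually_elim (auto simp: indicator_def)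
  qed
  also have "\<dots> = C * (1 - measure Q ?Z)" by (simp add: Q.prob_compl Int_absorb2)
  finally have "\<beta> / C \<le> 1 - measure Q ?Z" using C \<beta> by (simp add: field_simps)
  hence Z: "measure Q ?Z \<le> 1 - \<beta> / C" by linarith
  have "measure M {x\<in>space M. (\<Sum>j<n. w (x j)) = 0} \<le> measure M (\<Pi>\<^sub>E j\<in>{..<n}. ?Z)"
  proof (rule PM.finite_measure_mono_AE)
    show "AE x in M. x \<in> {x\<in>space M. (\<Sum>j<n. w (x j)) = 0} \<longrightarrow> x \<in> (\<Pi>\<^sub>E j\<in>{..<n}. ?Z)"
      using AEP
    proof eventually_elim
      case (elim x)
      show ?case
      proof
        assume x: "x \<in> {x\<in>space M. (\<Sum>j<n. w (x j)) = 0}"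
        hence "w (x j) = 0" if "j < n" for j
          using elim that sum_nonneg_eq_0_iff[of "{..<n}" "\<lambda>j. w (x j)"] by auto
        thus "x \<in> (\<Pi>\<^sub>E j\<in>{..<n}. ?Z)" using x by (auto simp: M_def space_PiM PiE_iff)
      qed
    qed
    show "(\<Pi>\<^sub>E j\<in>{..<n}. ?Z) \<in> sets M" unfolding M_def by (intro sets_PiM_I_finite) auto
  qed
  also have "measure M (\<Pi>\<^sub>E j\<in>{..<n}. ?Z) = (\<Prod>j\<in>{..<n}. measure Q ?Z)"
  proof -
    interpret finite_product_prob_space "\<lambda>_. Q" "{..<n}" by unfold_locales simp
    show ?thesis unfolding M_def by (rule finite_measure_PiM_emb) auto
  qed
  also have "\<dots> \<le> (1 - \<beta> / C) ^ n" using Z by (simp add: power_mono)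
  finally show "measure M {x\<in>space M. (\<Sum>j<n. w (x j)) = 0} \<le> (1 - \<beta> / C) ^ n" .
qed

section \<open>Perturbations weighted by the likelihood\<close>

lemma local_lipschitz_bound:
  fixes g :: "'a::euclidean_space \<Rightarrow> 'b::real_normed_vector"
  assumes "\<forall>x\<in>cball 0 R. \<forall>y\<in>cball 0 R. norm (g x - g y) \<le> L * norm (x - y)" "L \<ge> 0" "R \<ge> 0" "x \<in> cball 0 R"
  shows "norm (g x) \<le> norm (g 0) + L * R"
proof -
  have "norm (g x - g 0) \<le> L * norm (x - 0)" using assms by (intro assms(1)[rule_format]) auto
  also have "\<dots> \<le> L * R" using assms by (intro mult_left_mono) auto
  finally show ?thesis using norm_triangle_sub[of "g x" "g 0"] by linarith
qed

text \<open>First and second order Taylor bounds, uniform on a ball, for a likelihood \<open>exp \<circ> l\<close> whose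
  log likelihood \<open>l\<close> has a locally Lipschitz gradient \<open>g\<close>.\<close>

lemma exp_taylor_bounds:
  fixes l :: "'a::euclidean_space \<Rightarrow> real"
  assumes l: "\<And>x. (l has_derivative (\<lambda>h. g x \<bullet> h)) (at x)"
    and lip: "\<And>R. \<exists>L\<ge>0. \<forall>x\<in>cball 0 R. \<forall>y\<in>cball 0 R. norm (g x - g y) \<le> L * norm (x - y)"
    and R: "R \<ge> 0"
  obtains G M \<beta> where "G \<ge> 0" "M \<ge> 0" "\<beta> > 0"
    "\<And>x. x \<in> cball 0 R \<Longrightarrow> \<beta> \<le> exp (l x)"
    "\<And>x. x \<in> cball 0 R \<Longrightarrow> norm (exp (l x) *\<^sub>R g x) \<le> G"
    "\<And>x h. x \<in> cball 0 R \<Longrightarrow> x + h \<in> cball 0 R \<Longrightarrow> \<bar>exp (l (x + h)) - exp (l x)\<bar> \<le> G * norm h"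
    "\<And>x h. x \<in> cball 0 R \<Longrightarrow> x + h \<in> cball 0 R \<Longrightarrow>
       \<bar>exp (l (x + h)) - exp (l x) - (exp (l x) *\<^sub>R g x) \<bullet> h\<bar> \<le> M * (norm h)\<^sup>2"
proof -
  let ?B = "cball (0::'a) R"
  obtain L where L: "L \<ge> 0" "\<forall>x\<in>?B. \<forall>y\<in>?B. norm (g x - g y) \<le> L * norm (x - y)" using lip by blast
  have contl: "continuous_on ?B l"
    using l by (meson continuous_at_imp_continuous_on has_derivative_continuous)
  have "compact ?B" "?B \<noteq> {}" using R by auto
  then obtain x0 x1 where x0: "x0 \<in> ?B" "\<And>x. x \<in> ?B \<Longrightarrow> l x0 \<le> l x"
    and x1: "x1 \<in> ?B" "\<And>x. x \<in> ?B \<Longrightarrow> l x \<le> l x1"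
    using continuous_attains_inf[OF _ _ contl] continuous_attains_sup[OF _ _ contl] by metis
  define E where "E = exp (l x1)"
  have E: "exp (l x) \<le> E" if "x \<in> ?B" for x using x1(2)[OF that] by (simp add: E_def)
  have E0: "E > 0" by (simp add: E_def)
  define g0 where "g0 = norm (g 0) + L * R"
  have g0: "norm (g x) \<le> g0" if "x \<in> ?B" for x
    unfolding g0_def by (rule local_lipschitz_bound[OF L(2,1) R that])
  have g00: "g0 \<ge> 0" using g0[of 0] R by (intro order_trans[OF norm_ge_zero]) auto
  define q where "q x = exp (l x) *\<^sub>R g x" for x
  have dp: "((\<lambda>x. exp (l x)) has_derivative (\<lambda>h. q x \<bullet> h)) (at x)" for x
    unfolding q_def using has_derivative_exp[OF l, of x] by (simp add: mult.commute)
  have qb: "norm (q x) \<le> E * g0" if "x \<in> ?B" for x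
    using mult_mono[OF E[OF that] g0[OF that]] E0 by (simp add: q_def)
  have seg: "x + t *\<^sub>R h \<in> ?B" if "x \<in> ?B" "x + h \<in> ?B" "0 < t" "t < 1" for x h t
  proof -
    have "x + t *\<^sub>R h = (1 - t) *\<^sub>R x + t *\<^sub>R (x + h)" by (simp add: algebra_simps)
    thus ?thesis using convexD_alt[OF convex_cball that(1,2), of t] that by simp
  qed
  have p1: "\<bar>exp (l (x + h)) - exp (l x)\<bar> \<le> E * g0 * norm h" if xh: "x \<in> ?B" "x + h \<in> ?B" for x h
  proof -
    obtain t where t: "0 < t" "t < 1" "exp (l (x + h)) - exp (l x) = q (x + t *\<^sub>R h) \<bullet> h"
      using real_mean_value_segment[OF dp] by blast
    have "\<bar>q (x + t *\<^sub>R h) \<bullet> h\<bar> \<le> norm (q (x + t *\<^sub>R h)) * norm h" by (rule Cauchy_Schwarz_ineq2)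
    also have "\<dots> \<le> E * g0 * norm h" using qb[OF seg[OF xh t(1,2)]] by (intro mult_right_mono) auto
    finally show ?thesis using t(3) by simp
  qed
  define M where "M = E * L + E * g0 * g0"
  have M0: "M \<ge> 0" using E0 L g00 by (simp add: M_def)
  have ql: "norm (q (x + h) - q x) \<le> M * norm h" if xh: "x \<in> ?B" "x + h \<in> ?B" for x h
  proof -
    have "q (x + h) - q x = exp (l (x + h)) *\<^sub>R (g (x + h) - g x) + (exp (l (x + h)) - exp (l x)) *\<^sub>R g x"
      by (simp add: q_def algebra_simps)
    hence "norm (q (x + h) - q x) \<le> exp (l (x + h)) * norm (g (x + h) - g x) + \<bar>exp (l (x + h)) - exp (l x)\<bar> * norm (g x)"
      by (metis norm_triangle_ineq norm_scaleR abs_exp_cancel)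
    also have "\<dots> \<le> E * (L * norm h) + (E * g0 * norm h) * g0"
    proof (intro add_mono mult_mono)
      show "norm (g (x + h) - g x) \<le> L * norm h" using L(2) xh by (metis add_diff_cancel_left')
    qed (use E[OF xh(2)] E0 g0[OF xh(1)] p1[OF xh] g00 in auto)
    finally show ?thesis by (simp add: M_def algebra_simps)
  qed
  have p2: "\<bar>exp (l (x + h)) - exp (l x) - q x \<bullet> h\<bar> \<le> M * (norm h)\<^sup>2" if xh: "x \<in> ?B" "x + h \<in> ?B" for x h
  proof -
    obtain t where t: "0 < t" "t < 1" "exp (l (x + h)) - exp (l x) = q (x + t *\<^sub>R h) \<bullet> h"
      using real_mean_value_segment[OF dp] by blast
    have "norm (q (x + t *\<^sub>R h) - q x) \<le> M * norm (t *\<^sub>R h)" by (rule ql[OF xh(1) seg[OF xh t(1,2)]])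
    also have "\<dots> \<le> M * norm h" using t M0 by (intro mult_left_mono) (auto simp: mult_left_le_one_le)
    finally have *: "norm (q (x + t *\<^sub>R h) - q x) \<le> M * norm h" .
    have "\<bar>(q (x + t *\<^sub>R h) - q x) \<bullet> h\<bar> \<le> norm (q (x + t *\<^sub>R h) - q x) * norm h" by (rule Cauchy_Schwarz_ineq2)
    also have "\<dots> \<le> M * norm h * norm h" by (intro mult_right_mono *) simp
    finally show ?thesis using t(3) by (simp add: inner_diff_left power2_eq_square mult.assoc)
  qed
  show ?thesis
  proof (rule that[of "E * g0" M "exp (l x0)"])
    show "exp (l x0) \<le> exp (l x)" if "x \<in> ?B" for x using x0(2)[OF that] by simp
  qed (use E0 g00 M0 p1 p2 qb in \<open>auto simp: q_def\<close>)
qed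

lemma positive_definite_left_inverse:
  fixes A :: "real^'n^'n"
  assumes "positive_definite A"
  shows "matrix_inv A ** A = mat 1"
proof -
  have "v = 0" if "A *v v = 0" for v
    using assms that by (force simp: positive_definite_def)
  hence "inj ((*v) A)" by (simp add: linear_injective_0 matrix_vector_mul_linear)
  hence "invertible A" by (metis invertible_left_inverse matrix_left_invertible_injective)
  thus ?thesis unfolding invertible_def matrix_inv_def by (rule someI2_ex) simp
qed

lemma matrix_vector_component_bound:
  fixes A :: "real^'n^'n"
  obtains U where "U \<ge> 0" "\<And>z i. \<bar>(A *v z) $ i\<bar> \<le> U * norm z"
proof -
  have bl: "bounded_linear ((*v) A)" by (rule matrix_vector_mul_bounded_linear)
  have "\<bar>(A *v z) $ i\<bar> \<le> onorm ((*v) A) * norm z" for z i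
    using order_trans[OF component_le_norm_cart onorm[OF bl]] .
  thus ?thesis using that onorm_pos_le[OF bl] by blast
qed

text \<open>With \<open>S\<close> the covariance matrix of \<open>D\<close>, the vector \<open>S\<^sup>-\<^sup>1 z\<close> has mean zero, and its product
  with the linear function \<open>z \<mapsto> v \<bullet> z\<close> has mean \<open>v\<close>.\<close>

lemma perturbation_second_moment:
  fixes D :: "(real^'p) measure"
  assumes D: "prob_space D" and sD[measurable_cong]: "sets D = sets borel" and B: "AE z in D. norm z \<le> B"
    and mean: "mean_vector D = 0" and pd: "positive_definite (covariance_matrix D)"
  defines "u \<equiv> \<lambda>i z. (matrix_inv (covariance_matrix D) *v z) $ i"
  shows "(\<integral>z. u i z \<partial>D) = 0" and "(\<integral>z. u i z * (v \<bullet> z) \<partial>D) = v $ i"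
proof -
  interpret D: prob_space D by (rule D)
  let ?S = "covariance_matrix D" and ?T = "matrix_inv (covariance_matrix D)"
  have intz: "integrable D (\<lambda>z. z)" using B by (intro D.integrable_const_bound[of _ B]) auto
  have intc: "integrable D (\<lambda>z. z $ i)" for i
    using integrable_bounded_linear[OF bounded_linear_vec_nth intz] .
  have mc: "(\<integral>z. z $ i \<partial>D) = 0" for i
    using integral_bounded_linear[OF bounded_linear_vec_nth intz, of i] mean by (simp add: mean_vector_def)
  have int2: "integrable D (\<lambda>z. z $ i * z $ j)" for i j
  proof (rule D.integrable_const_bound[of _ "B * B"])
    show "AE z in D. norm (z $ i * z $ j) \<le> B * B"
      using B
    proof eventually_elim
      case (elim z)
      have "\<bar>z $ i\<bar> \<le> B" "\<bar>z $ j\<bar> \<le> B" using elim component_le_norm_cart[of z] order_trans by blast+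
      thus ?case by (simp add: abs_mult mult_mono)
    qed
  qed measurable
  have cov: "(\<integral>z. z $ i * z $ j \<partial>D) = ?S $ i $ j" for i j
    using mean by (simp add: covariance_matrix_def)
  have u: "u i z = (\<Sum>j\<in>UNIV. ?T $ i $ j * z $ j)" for z by (simp add: u_def matrix_vector_mult_def)
  show "(\<integral>z. u i z \<partial>D) = 0" unfolding u using intc mc by (subst Bochner_Integration.integral_sum) auto
  have "(\<integral>z. u i z * (v \<bullet> z) \<partial>D) = (\<integral>z. (\<Sum>j\<in>UNIV. \<Sum>k\<in>UNIV. ?T $ i $ j * v $ k * (z $ j * z $ k)) \<partial>D)"
    by (intro Bochner_Integration.integral_cong refl) (unfold u inner_vec_def inner_real_def sum_product, intro sum.cong refl, simp add: mult_ac)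
  also have "\<dots> = (\<Sum>j\<in>UNIV. \<Sum>k\<in>UNIV. ?T $ i $ j * v $ k * ?S $ j $ k)"
    by (subst Bochner_Integration.integral_sum)
       (auto intro!: sum.cong Bochner_Integration.integrable_sum int2 simp: int2 cov Bochner_Integration.integral_sum)
  also have "\<dots> = (?T *v (?S *v v)) $ i"
    by (simp add: matrix_vector_mult_def sum_distrib_left mult_ac)
  also have "\<dots> = v $ i"
    using positive_definite_left_inverse[OF pd] by (simp add: matrix_vector_mul_assoc)
  finally show "(\<integral>z. u i z * (v \<bullet> z) \<partial>D) = v $ i" .
qed

text \<open>The mean of \<open>S\<^sup>-\<^sup>1 z\<close> under the perturbation law weighted by the likelihood at \<open>\<theta> + t z\<close>,
  divided by \<open>t\<close>, is the gradient of the log likelihood up to an error of order \<open>t\<close>.\<close>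

lemma tilted_mean_approximates_gradient:
  fixes D :: "(real^'p) measure" and l :: "real^'p \<Rightarrow> real"
  assumes D: "prob_space D" and sD[measurable_cong]: "sets D = sets borel" and B: "AE z in D. norm z \<le> B"
    and mean: "mean_vector D = 0" and pd: "positive_definite (covariance_matrix D)"
    and l: "\<And>x. (l has_derivative (\<lambda>h. g x \<bullet> h)) (at x)"
    and lip: "\<And>R. \<exists>L\<ge>0. \<forall>x\<in>cball 0 R. \<forall>y\<in>cball 0 R. norm (g x - g y) \<le> L * norm (x - y)"
    and R: "R \<ge> 0" and T: "T \<ge> 0"
  defines "u \<equiv> \<lambda>i z. (matrix_inv (covariance_matrix D) *v z) $ i"
  obtains \<beta> c where "\<beta> > 0" "c \<ge> 0"
    "\<And>\<theta> t. \<theta> \<in> cball 0 R \<Longrightarrow> 0 < t \<Longrightarrow> t \<le> T \<Longrightarrow> \<beta> \<le> (\<integral>z. exp (l (\<theta> + t *\<^sub>R z)) \<partial>D)"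
    "\<And>\<theta> t i. \<theta> \<in> cball 0 R \<Longrightarrow> 0 < t \<Longrightarrow> t \<le> T \<Longrightarrow>
      \<bar>(\<integral>z. exp (l (\<theta> + t *\<^sub>R z)) * u i z \<partial>D) / (\<integral>z. exp (l (\<theta> + t *\<^sub>R z)) \<partial>D) / t - g \<theta> $ i\<bar> \<le> c * t"
proof -
  interpret D: prob_space D by (rule D)
  have "AE z in D. 0 \<le> B" using B by eventually_elim (rule order_trans[OF norm_ge_zero])
  hence B0: "B \<ge> 0" by simp
  define R' where "R' = R + T * B"
  have R': "R' \<ge> 0" using R T B0 by (simp add: R'_def)
  obtain G M \<beta> where GM: "G \<ge> 0" "M \<ge> 0" "\<beta> > 0"
    and \<beta>: "\<And>x. x \<in> cball 0 R' \<Longrightarrow> \<beta> \<le> exp (l x)"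
    and Gb: "\<And>x. x \<in> cball 0 R' \<Longrightarrow> norm (exp (l x) *\<^sub>R g x) \<le> G"
    and t1: "\<And>x h. x \<in> cball 0 R' \<Longrightarrow> x + h \<in> cball 0 R' \<Longrightarrow> \<bar>exp (l (x + h)) - exp (l x)\<bar> \<le> G * norm h"
    and t2: "\<And>x h. x \<in> cball 0 R' \<Longrightarrow> x + h \<in> cball 0 R' \<Longrightarrow>
       \<bar>exp (l (x + h)) - exp (l x) - (exp (l x) *\<^sub>R g x) \<bullet> h\<bar> \<le> M * (norm h)\<^sup>2"
    by (rule exp_taylor_bounds[OF l lip R']) blast
  obtain U where U: "U \<ge> 0" "\<And>z i. \<bar>(matrix_inv (covariance_matrix D) *v z) $ i\<bar> \<le> U * norm z"
    using matrix_vector_component_bound by blast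
  have contl: "continuous_on UNIV l"
    using l by (meson continuous_at_imp_continuous_on has_derivative_continuous)
  have lm[measurable]: "l \<in> borel_measurable borel" using contl by (rule borel_measurable_continuous_onI)
  have um[measurable]: "u i \<in> borel_measurable borel" for i
    unfolding u_def
    by (intro borel_measurable_continuous_onI continuous_intros linear_continuous_on matrix_vector_mul_bounded_linear)
  define c where "c = M * B\<^sup>2 * (U * B) / \<beta> + G * (G * B) / \<beta>\<^sup>2"
  have "\<beta> \<le> (\<integral>z. exp (l (\<theta> + t *\<^sub>R z)) \<partial>D) \<and>
     \<bar>(\<integral>z. exp (l (\<theta> + t *\<^sub>R z)) * u i z \<partial>D) / (\<integral>z. exp (l (\<theta> + t *\<^sub>R z)) \<partial>D) / t - g \<theta> $ i\<bar> \<le> c * t"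
    if \<theta>: "\<theta> \<in> cball 0 R" and t: "0 < t" "t \<le> T" for \<theta> t i
  proof -
    let ?p = "exp (l \<theta>)"
    let ?e = "\<lambda>z. exp (l (\<theta> + t *\<^sub>R z))"
    let ?q = "?p *\<^sub>R g \<theta>"
    have \<theta>': "\<theta> \<in> cball 0 R'" using \<theta> T B0 by (simp add: R'_def add_increasing2)
    have in': "AE z in D. \<theta> + t *\<^sub>R z \<in> cball 0 R' \<and> norm (t *\<^sub>R z) \<le> t * B \<and> \<bar>u i z\<bar> \<le> U * B"
      using B
    proof eventually_elim
      case (elim z)
      have 1: "norm (t *\<^sub>R z) \<le> t * B" using elim t by simp
      have "t * B \<le> T * B" using t B0 by (intro mult_right_mono) auto
      hence "norm (\<theta> + t *\<^sub>R z) \<le> R + T * B" using norm_triangle_ineq[of \<theta> "t *\<^sub>R z"] 1 \<theta> by simp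
      moreover have "\<bar>u i z\<bar> \<le> U * B" unfolding u_def
        using order_trans[OF U(2)] mult_left_mono[OF elim U(1)] by blast
      ultimately show ?case using 1 by (simp add: R'_def)
    qed
    have pb: "AE z in D. \<bar>?e z - ?p\<bar> \<le> t * (G * B)"
      using in'
    proof eventually_elim
      case (elim z)
      have "\<bar>?e z - ?p\<bar> \<le> G * norm (t *\<^sub>R z)" by (intro t1 \<theta>') (use elim in auto)
      also have "\<dots> \<le> G * (t * B)" using elim GM by (intro mult_left_mono) auto
      finally show ?case by (simp add: mult_ac)
    qed
    have pi: "integrable D (\<lambda>z. ?e z)"
      using pb by (intro D.integrable_const_bound[of _ "?p + t * (G * B)"]) (auto elim!: eventually_mono)
    have ui: "integrable D (u i)"
      using in' by (intro D.integrable_const_bound[of _ "U * B"]) (auto elim!: eventually_mono)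
    have pui: "integrable D (\<lambda>z. ?e z * u i z)"
    proof (rule D.integrable_const_bound[of _ "(?p + t * (G * B)) * (U * B)"])
      show "AE z in D. norm (?e z * u i z) \<le> (?p + t * (G * B)) * (U * B)"
        using pb in'
      proof eventually_elim
        case (elim z)
        have "?e z \<le> ?p + t * (G * B)" using elim(1) by linarith
        moreover have "0 \<le> ?p + t * (G * B)" using GM B0 t by simp
        ultimately show ?case using elim(2) unfolding real_norm_def abs_mult by (intro mult_mono) auto
      qed
    qed measurable
    have uqi: "integrable D (\<lambda>z. u i z * (?q \<bullet> z))"
    proof (rule D.integrable_const_bound[of _ "(U * B) * (norm ?q * B)"])
      show "AE z in D. norm (u i z * (?q \<bullet> z)) \<le> (U * B) * (norm ?q * B)"
        using in' B
      proof eventually_elim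
        case (elim z)
        have "\<bar>?q \<bullet> z\<bar> \<le> norm ?q * B"
          by (rule order_trans[OF Cauchy_Schwarz_ineq2]) (intro mult_left_mono elim(2) norm_ge_zero)
        thus ?case using elim(1) U(1) B0 unfolding real_norm_def abs_mult by (intro mult_mono) auto
      qed
    qed measurable
    let ?b = "\<integral>z. ?e z \<partial>D" and ?n = "\<integral>z. ?e z * u i z \<partial>D"
    have "(\<integral>z. \<beta> \<partial>D) \<le> ?b"
      using in' \<beta> pi by (intro integral_mono_AE) (auto elim!: eventually_mono)
    hence b\<beta>: "\<beta> \<le> ?b" by (simp add: D.prob_space)
    have "?b - ?p = (\<integral>z. ?e z - ?p \<partial>D)" using pi by (simp add: D.prob_space)
    also have "\<bar>\<dots>\<bar> \<le> (\<integral>z. \<bar>?e z - ?p\<bar> \<partial>D)" by (rule integral_abs_bound)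
    also have "\<dots> \<le> (\<integral>z. t * (G * B) \<partial>D)" using pi pb by (intro integral_mono_AE) auto
    finally have bp: "\<bar>?b - ?p\<bar> \<le> t * (G * B)" by (simp add: D.prob_space)
    have mom: "(\<integral>z. u i z \<partial>D) = 0" "\<And>v. (\<integral>z. u i z * (v \<bullet> z) \<partial>D) = v $ i"
      unfolding u_def by (rule perturbation_second_moment[OF D sD B mean pd])+
    have n_eq: "?n - t * ?q $ i = (\<integral>z. ?e z * u i z - ?p * u i z - t * (u i z * (?q \<bullet> z)) \<partial>D)"
      using pui ui uqi mom(1) mom(2)[of ?q] by simp
    have "\<bar>?n - t * ?q $ i\<bar> \<le> (\<integral>z. \<bar>?e z * u i z - ?p * u i z - t * (u i z * (?q \<bullet> z))\<bar> \<partial>D)"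
      unfolding n_eq by (rule integral_abs_bound)
    also have "\<dots> \<le> (\<integral>z. t\<^sup>2 * (M * B\<^sup>2 * (U * B)) \<partial>D)"
    proof (rule integral_mono_AE)
      show "AE z in D. \<bar>?e z * u i z - ?p * u i z - t * (u i z * (?q \<bullet> z))\<bar> \<le> t\<^sup>2 * (M * B\<^sup>2 * (U * B))"
        using in'
      proof eventually_elim
        case (elim z)
        have "\<bar>?e z - ?p - ?q \<bullet> (t *\<^sub>R z)\<bar> \<le> M * (norm (t *\<^sub>R z))\<^sup>2"
          by (intro t2 \<theta>') (use elim in auto)
        also have "\<dots> \<le> M * (t * B)\<^sup>2" using elim GM by (intro mult_left_mono power_mono) auto
        finally have 1: "\<bar>?e z - ?p - ?q \<bullet> (t *\<^sub>R z)\<bar> \<le> M * (t * B)\<^sup>2" .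
        have "\<bar>?e z * u i z - ?p * u i z - t * (u i z * (?q \<bullet> z))\<bar>
          = \<bar>?e z - ?p - ?q \<bullet> (t *\<^sub>R z)\<bar> * \<bar>u i z\<bar>"
          unfolding abs_mult[symmetric] by (simp add: algebra_simps)
        also have "\<dots> \<le> M * (t * B)\<^sup>2 * (U * B)" using 1 elim GM by (intro mult_mono) auto
        finally show ?case by (simp add: power_mult_distrib mult_ac)
      qed
    qed (use pui ui uqi in auto)
    finally have nb: "\<bar>?n - t * ?q $ i\<bar> \<le> t\<^sup>2 * (M * B\<^sup>2 * (U * B))" by (simp add: D.prob_space)
    have b0: "?b > 0" using b\<beta> GM by linarith
    have p0: "?p \<ge> \<beta>" by (rule \<beta>[OF \<theta>'])
    have split: "?n / ?b / t - g \<theta> $ i = (?n - t * ?q $ i) / (t * ?b) + ?q $ i * (?p - ?b) / (?b * ?p)"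
      using b0 t by (simp add: field_simps)
    have "\<bar>?n / ?b / t - g \<theta> $ i\<bar> \<le> \<bar>(?n - t * ?q $ i) / (t * ?b)\<bar> + \<bar>?q $ i * (?p - ?b) / (?b * ?p)\<bar>"
      unfolding split by (rule abs_triangle_ineq)
    also have "\<dots> = \<bar>?n - t * ?q $ i\<bar> / (t * ?b) + \<bar>?q $ i\<bar> * \<bar>?b - ?p\<bar> / (?b * ?p)"
      using b0 t by (simp add: abs_mult abs_minus_commute)
    also have "\<dots> \<le> t\<^sup>2 * (M * B\<^sup>2 * (U * B)) / (t * \<beta>) + G * (t * (G * B)) / (\<beta> * \<beta>)"
    proof (intro add_mono frac_le mult_mono)
      show "\<bar>?q $ i\<bar> \<le> G" using component_le_norm_cart order_trans Gb[OF \<theta>'] by blast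
    qed (use nb bp b\<beta> p0 GM t B0 U in auto)
    also have "\<dots> = c * t" using t by (simp add: c_def power2_eq_square field_simps)
    finally show ?thesis using b\<beta> by simp
  qed
  moreover have "c \<ge> 0" using GM U B0 by (simp add: c_def)
  ultimately show ?thesis using that[of \<beta> c] GM by blast
qed

section \<open>The law of one draw\<close>

text \<open>The latent variable model with joint density \<open>f\<close>, conditional density \<open>g\<close>, observed value \<open>y\<close>
  and perturbation density \<open>\<kappa>\<close>. Below, \<open>fX\<close> and \<open>fY\<close> are the marginal density of the latent variable
  and the likelihood, \<open>D\<close> is the law of the perturbation, and \<open>Q t \<theta>\<close> is the law of one pair of draws
  at parameter \<open>\<theta>\<close> and scale \<open>t\<close>.\<close>

locale importance_sampling_model =
  fixes \<mu> :: "'x measure" and \<nu> :: "'y measure" and f g :: "real^'p \<Rightarrow> 'x \<Rightarrow> 'y \<Rightarrow> real"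
    and y :: 'y and \<kappa> :: "real^'p \<Rightarrow> real"
  assumes sf\<mu>: "sigma_finite_measure \<mu>" and sf\<nu>: "sigma_finite_measure \<nu>"
    and joint: "joint_density \<mu> \<nu> f" and cond: "conditional_density \<mu> \<nu> f g"
    and y: "y \<in> space \<nu>"
    and pert: "perturbation_density \<kappa>"
begin

abbreviation "fX \<equiv> marginal_X \<nu> f"
abbreviation "fY \<theta> \<equiv> marginal_Y \<mu> f \<theta> y"
abbreviation "D \<equiv> density lborel \<kappa>"
abbreviation "Q \<equiv> pair_law \<mu> fX \<kappa>"

lemma f_measurable: "(\<lambda>(\<theta>, x, y). f \<theta> x y) \<in> borel_measurable (borel \<Otimes>\<^sub>M (\<mu> \<Otimes>\<^sub>M \<nu>))"
  and f_nonneg: "x \<in> space \<mu> \<Longrightarrow> y' \<in> space \<nu> \<Longrightarrow> 0 \<le> f \<theta> x y'"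
  and f_prob: "prob_space (density (\<mu> \<Otimes>\<^sub>M \<nu>) (\<lambda>(x, y). ennreal (f \<theta> x y)))"
  using joint by (auto simp: joint_density_def)

lemma g_measurable: "(\<lambda>(\<theta>, x, y). g \<theta> x y) \<in> borel_measurable (borel \<Otimes>\<^sub>M (\<mu> \<Otimes>\<^sub>M \<nu>))"
  and g_nonneg: "x \<in> space \<mu> \<Longrightarrow> y' \<in> space \<nu> \<Longrightarrow> 0 \<le> g \<theta> x y'"
  and f_eq: "y' \<in> space \<nu> \<Longrightarrow> AE x in \<mu>. f \<theta> x y' = fX \<theta> x * g \<theta> x y'"
  using cond by (auto simp: conditional_density_def)

lemma measurable_f[measurable (raw)]:
  assumes [measurable]: "a \<in> borel_measurable M" "b \<in> measurable M \<mu>" "c \<in> measurable M \<nu>"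
  shows "(\<lambda>\<omega>. f (a \<omega>) (b \<omega>) (c \<omega>)) \<in> borel_measurable M"
proof -
  have "(\<lambda>\<omega>. (a \<omega>, b \<omega>, c \<omega>)) \<in> measurable M (borel \<Otimes>\<^sub>M (\<mu> \<Otimes>\<^sub>M \<nu>))" by measurable
  from measurable_compose[OF this f_measurable] show ?thesis by simp
qed

lemma measurable_weight[measurable (raw)]:
  assumes [measurable]: "a \<in> borel_measurable M" "b \<in> measurable M \<mu>"
  shows "(\<lambda>\<omega>. g (a \<omega>) (b \<omega>) y) \<in> borel_measurable M"
proof -
  have "(\<lambda>\<omega>. (a \<omega>, b \<omega>, y)) \<in> measurable M (borel \<Otimes>\<^sub>M (\<mu> \<Otimes>\<^sub>M \<nu>))" using y by measurable
  from measurable_compose[OF this g_measurable] show ?thesis by simp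
qed

lemma measurable_fX[measurable (raw)]:
  assumes [measurable]: "a \<in> borel_measurable M" "b \<in> measurable M \<mu>"
  shows "(\<lambda>\<omega>. fX (a \<omega>) (b \<omega>)) \<in> borel_measurable M"
proof -
  interpret sigma_finite_measure \<nu> by (rule sf\<nu>)
  show ?thesis unfolding marginal_X_def by measurable
qed

lemma kappa_measurable[measurable]: "\<kappa> \<in> borel_measurable borel"
  and kappa_nonneg: "0 \<le> \<kappa> z" and prob_D: "prob_space D"
  and mean_D: "mean_vector D = 0" and pd_D: "positive_definite (covariance_matrix D)"
  using pert by (auto simp: perturbation_density_def)

lemma fX_nonneg: "x \<in> space \<mu> \<Longrightarrow> 0 \<le> fX \<theta> x"
  unfolding marginal_X_def by (intro integral_nonneg_AE AE_I2) (simp add: f_nonneg)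

lemma fX_prob: "(\<integral>\<^sup>+x. ennreal (fX \<theta> x) \<partial>\<mu>) = 1"
proof -
  interpret \<nu>: sigma_finite_measure \<nu> by (rule sf\<nu>)
  interpret P: prob_space "density (\<mu> \<Otimes>\<^sub>M \<nu>) (\<lambda>(x, y). ennreal (f \<theta> x y))" by (rule f_prob)
  have m[measurable]: "(\<lambda>(x, y). ennreal (f \<theta> x y)) \<in> borel_measurable (\<mu> \<Otimes>\<^sub>M \<nu>)" by measurable
  have "1 = emeasure (density (\<mu> \<Otimes>\<^sub>M \<nu>) (\<lambda>(x, y). ennreal (f \<theta> x y))) (space (\<mu> \<Otimes>\<^sub>M \<nu>))"
    using P.emeasure_space_1 by simp
  also have "\<dots> = (\<integral>\<^sup>+p. (\<lambda>(x, y). ennreal (f \<theta> x y)) p \<partial>(\<mu> \<Otimes>\<^sub>M \<nu>))"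
    by (subst emeasure_density[OF m]) (auto intro!: nn_integral_cong)
  also have "\<dots> = (\<integral>\<^sup>+x. \<integral>\<^sup>+y. ennreal (f \<theta> x y) \<partial>\<nu> \<partial>\<mu>)"
    by (subst \<nu>.nn_integral_fst[OF m, symmetric]) simp
  finally have 1: "(\<integral>\<^sup>+x. \<integral>\<^sup>+y. ennreal (f \<theta> x y) \<partial>\<nu> \<partial>\<mu>) = 1" by simp
  have "AE x in \<mu>. (\<integral>\<^sup>+y. ennreal (f \<theta> x y) \<partial>\<nu>) \<noteq> \<infinity>"
    by (rule nn_integral_PInf_AE) (use 1 in \<open>measurable, simp\<close>)
  hence "AE x in \<mu>. (\<integral>\<^sup>+y. ennreal (f \<theta> x y) \<partial>\<nu>) = ennreal (fX \<theta> x)"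
    using AE_space
  proof eventually_elim
    case (elim x)
    have "(\<lambda>y. f \<theta> x y) \<in> borel_measurable \<nu>" using elim(2) by measurable
    hence "integrable \<nu> (\<lambda>y. f \<theta> x y)"
      using elim f_nonneg by (intro integrableI_nonneg) (auto simp: less_top)
    thus ?case unfolding marginal_X_def using elim f_nonneg by (intro nn_integral_eq_integral) auto
  qed
  thus ?thesis using 1 nn_integral_cong_AE by metis
qed

lemma pair_density_measurable[measurable]:
  "(\<lambda>(z, x). ennreal (\<kappa> z * fX (\<theta> + t *\<^sub>R z) x)) \<in> borel_measurable (lborel \<Otimes>\<^sub>M \<mu>)"
  by measurable

lemma sets_Q[measurable_cong]: "sets (Q t \<theta>) = sets (borel \<Otimes>\<^sub>M \<mu>)"
  unfolding pair_law_def by (simp add: sets_pair_measure_cong[OF sets_lborel refl])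

lemma prob_Q: "prob_space (Q t \<theta>)"
proof
  interpret \<mu>: sigma_finite_measure \<mu> by (rule sf\<mu>)
  interpret D: prob_space D by (rule prob_D)
  have "emeasure (Q t \<theta>) (space (Q t \<theta>)) = (\<integral>\<^sup>+p. (\<lambda>(z, x). ennreal (\<kappa> z * fX (\<theta> + t *\<^sub>R z) x)) p \<partial>(lborel \<Otimes>\<^sub>M \<mu>))"
    unfolding pair_law_def space_density
    by (subst emeasure_density[OF pair_density_measurable sets.top]) (auto intro!: nn_integral_cong)
  also have "\<dots> = (\<integral>\<^sup>+z. \<integral>\<^sup>+x. ennreal (\<kappa> z * fX (\<theta> + t *\<^sub>R z) x) \<partial>\<mu> \<partial>lborel)"
    by (subst \<mu>.nn_integral_fst[symmetric]) simp_all
  also have "\<dots> = (\<integral>\<^sup>+z. ennreal (\<kappa> z) \<partial>lborel)"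
  proof (rule nn_integral_cong)
    fix z :: "real^'p"
    have "(\<integral>\<^sup>+x. ennreal (\<kappa> z * fX (\<theta> + t *\<^sub>R z) x) \<partial>\<mu>) = (\<integral>\<^sup>+x. ennreal (\<kappa> z) * ennreal (fX (\<theta> + t *\<^sub>R z) x) \<partial>\<mu>)"
      by (intro nn_integral_cong) (simp add: ennreal_mult kappa_nonneg fX_nonneg)
    also have "\<dots> = ennreal (\<kappa> z)" by (subst nn_integral_cmult) (auto simp: fX_prob)
    finally show "(\<integral>\<^sup>+x. ennreal (\<kappa> z * fX (\<theta> + t *\<^sub>R z) x) \<partial>\<mu>) = ennreal (\<kappa> z)" .
  qed
  also have "\<dots> = emeasure D (space D)" by (subst emeasure_density) auto
  also have "\<dots> = 1" by (rule D.emeasure_space_1)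
  finally show "emeasure (Q t \<theta>) (space (Q t \<theta>)) = 1" .
qed

lemma Q_kernel: "Q t \<in> measurable borel (prob_algebra (borel \<Otimes>\<^sub>M \<mu>))"
proof (rule measurable_prob_algebra_generated[where \<Omega> = "space (borel \<Otimes>\<^sub>M \<mu>)" and G = "sets (borel \<Otimes>\<^sub>M \<mu>)"])
  interpret \<mu>: sigma_finite_measure \<mu> by (rule sf\<mu>)
  interpret pair_sigma_finite "lborel :: (real^'p) measure" \<mu> by unfold_locales
  show "sets (borel \<Otimes>\<^sub>M \<mu>) = sigma_sets (space (borel \<Otimes>\<^sub>M \<mu>)) (sets (borel \<Otimes>\<^sub>M \<mu>))"
    by (simp add: sets.sigma_sets_eq)
  show "Int_stable (sets (borel \<Otimes>\<^sub>M \<mu>))" by (rule sets.Int_stable)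
  show "sets (borel \<Otimes>\<^sub>M \<mu>) \<subseteq> Pow (space (borel \<Otimes>\<^sub>M \<mu>))" by (rule sets.space_closed)
  show "prob_space (Q t \<theta>)" for \<theta> by (rule prob_Q)
  show "sets (Q t \<theta>) = sets (borel \<Otimes>\<^sub>M \<mu>)" for \<theta> by (rule sets_Q)
  fix A :: "((real^'p) \<times> 'x) set" assume A[measurable]: "A \<in> sets (borel \<Otimes>\<^sub>M \<mu>)"
  have A': "A \<in> sets (lborel \<Otimes>\<^sub>M \<mu>)" using A by (simp add: sets_pair_measure_cong[OF sets_lborel refl])
  have "emeasure (Q t \<theta>) A = (\<integral>\<^sup>+p. ennreal (\<kappa> (fst p) * fX (\<theta> + t *\<^sub>R fst p) (snd p)) * indicator A p \<partial>(lborel \<Otimes>\<^sub>M \<mu>))" for \<theta>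
    unfolding pair_law_def using A' by (subst emeasure_density) (auto intro!: nn_integral_cong simp: case_prod_beta)
  moreover have "(\<lambda>\<theta>. \<integral>\<^sup>+p. ennreal (\<kappa> (fst p) * fX (\<theta> + t *\<^sub>R fst p) (snd p)) * indicator A p \<partial>(lborel \<Otimes>\<^sub>M \<mu>)) \<in> borel_measurable borel"
    by measurable
  ultimately show "(\<lambda>\<theta>. emeasure (Q t \<theta>) A) \<in> borel_measurable borel" by simp
qed

lemma AE_Q_support:
  assumes "\<forall>z. z \<notin> K \<longrightarrow> \<kappa> z = 0"
  shows "AE p in Q t \<theta>. fst p \<in> K \<and> snd p \<in> space \<mu>"
proof -
  have "AE p in lborel \<Otimes>\<^sub>M \<mu>. 0 < ennreal (\<kappa> (fst p) * fX (\<theta> + t *\<^sub>R fst p) (snd p)) \<longrightarrow> fst p \<in> K \<and> snd p \<in> space \<mu>"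
    using assms by (intro AE_I2) (force simp: space_pair_measure)
  thus ?thesis unfolding pair_law_def by (subst AE_density) (simp_all add: case_prod_beta)
qed

lemma AE_D_support:
  assumes "\<forall>z. z \<notin> K \<longrightarrow> \<kappa> z = 0"
  shows "AE z in D. z \<in> K"
proof -
  have "AE z in lborel. 0 < ennreal (\<kappa> z) \<longrightarrow> z \<in> K" using assms by (intro AE_I2) force
  thus ?thesis by (subst AE_density) simp_all
qed

text \<open>Averaging the importance weight over the latent variable replaces it by the likelihood, since
  \<open>fX * g = f\<close> almost everywhere.\<close>

lemma integral_Q_weight:
  assumes K: "\<forall>z. z \<notin> K \<longrightarrow> \<kappa> z = 0" and k[measurable]: "k \<in> borel_measurable borel"
    and kb: "\<And>z. z \<in> K \<Longrightarrow> \<bar>k z\<bar> \<le> c" 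
    and wb: "\<And>z x. z \<in> K \<Longrightarrow> x \<in> space \<mu> \<Longrightarrow> g (\<theta> + t *\<^sub>R z) x y \<le> C"
  shows "(\<integral>p. g (\<theta> + t *\<^sub>R fst p) (snd p) y * k (fst p) \<partial>Q t \<theta>) = (\<integral>z. fY (\<theta> + t *\<^sub>R z) * k z \<partial>D)"
proof -
  interpret \<mu>: sigma_finite_measure \<mu> by (rule sf\<mu>)
  interpret pair_sigma_finite "lborel :: (real^'p) measure" \<mu> by unfold_locales
  interpret Q: prob_space "Q t \<theta>" by (rule prob_Q)
  let ?d = "\<lambda>p. \<kappa> (fst p) * fX (\<theta> + t *\<^sub>R fst p) (snd p)"
  let ?h = "\<lambda>p. g (\<theta> + t *\<^sub>R fst p) (snd p) y * k (fst p)"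
  have Qd: "Q t \<theta> = density (lborel \<Otimes>\<^sub>M \<mu>) (\<lambda>p. ennreal (?d p))"
    unfolding pair_law_def by (intro arg_cong[where f = "density _"]) (auto simp: fun_eq_iff)
  have d0: "AE p in lborel \<Otimes>\<^sub>M \<mu>. 0 \<le> ?d p"
    by (intro AE_I2) (auto simp: space_pair_measure kappa_nonneg fX_nonneg)
  have hm: "?h \<in> borel_measurable (lborel \<Otimes>\<^sub>M \<mu>)" by measurable
  have dm: "?d \<in> borel_measurable (lborel \<Otimes>\<^sub>M \<mu>)" by measurable
  have hi: "integrable (Q t \<theta>) ?h"
  proof (rule Q.integrable_const_bound[of _ "C * c"])
    show "AE p in Q t \<theta>. norm (?h p) \<le> C * c"
      using AE_Q_support[OF K]
    proof eventually_elim
      case (elim p)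
      have "0 \<le> g (\<theta> + t *\<^sub>R fst p) (snd p) y" using elim y by (intro g_nonneg) auto
      thus ?case using elim kb[of "fst p"] wb[of "fst p" "snd p"] unfolding real_norm_def abs_mult by (intro mult_mono) auto
    qed
  qed measurable
  have dhi: "integrable (lborel \<Otimes>\<^sub>M \<mu>) (\<lambda>p. ?d p * ?h p)"
    using hi unfolding Qd by (subst (asm) integrable_real_density[OF dm d0 hm])
  have "(\<integral>p. ?h p \<partial>Q t \<theta>) = (\<integral>p. ?d p * ?h p \<partial>(lborel \<Otimes>\<^sub>M \<mu>))"
    unfolding Qd by (rule integral_real_density[OF dm d0 hm])
  also have "\<dots> = (\<integral>z. \<integral>x. ?d (z, x) * ?h (z, x) \<partial>\<mu> \<partial>lborel)"
    by (rule integral_fst'[OF dhi, symmetric])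
  also have "\<dots> = (\<integral>z. \<kappa> z * (fY (\<theta> + t *\<^sub>R z) * k z) \<partial>lborel)"
  proof (rule Bochner_Integration.integral_cong[OF refl])
    fix z :: "real^'p"
    have "(\<integral>x. ?d (z, x) * ?h (z, x) \<partial>\<mu>) = \<kappa> z * k z * (\<integral>x. fX (\<theta> + t *\<^sub>R z) x * g (\<theta> + t *\<^sub>R z) x y \<partial>\<mu>)"
      by (subst integral_mult_right_zero[symmetric]) (simp add: mult_ac)
    also have "(\<integral>x. fX (\<theta> + t *\<^sub>R z) x * g (\<theta> + t *\<^sub>R z) x y \<partial>\<mu>) = fY (\<theta> + t *\<^sub>R z)"
      unfolding marginal_Y_def
    proof (rule integral_cong_AE)
      show "AE x in \<mu>. fX (\<theta> + t *\<^sub>R z) x * g (\<theta> + t *\<^sub>R z) x y = f (\<theta> + t *\<^sub>R z) x y"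
        using f_eq[OF y, of "\<theta> + t *\<^sub>R z"] by eventually_elim simp
    qed (use y in measurable)
    finally show "(\<integral>x. ?d (z, x) * ?h (z, x) \<partial>\<mu>) = \<kappa> z * (fY (\<theta> + t *\<^sub>R z) * k z)" by (simp add: mult_ac)
  qed
  also have "\<dots> = (\<integral>z. fY (\<theta> + t *\<^sub>R z) * k z \<partial>D)"
  proof (rule integral_real_density[symmetric])
    show "(\<lambda>z. fY (\<theta> + t *\<^sub>R z) * k z) \<in> borel_measurable lborel"
      unfolding marginal_Y_def using y by measurable
  qed (auto simp: kappa_nonneg)
  finally show ?thesis .
qed

end

section \<open>Mean and variance of the direction\<close>

lemma (in prob_space) variance_le_second_moment:
  fixes Y :: "'a \<Rightarrow> real"
  assumes "integrable M Y" "integrable M (\<lambda>x. (Y x - c)\<^sup>2)"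
  shows "integrable M (\<lambda>x. (Y x - expectation Y)\<^sup>2)" "variance Y \<le> expectation (\<lambda>x. (Y x - c)\<^sup>2)"
proof -
  let ?m = "expectation Y"
  have eq: "(\<lambda>x. (Y x - ?m)\<^sup>2) = (\<lambda>x. (Y x - c)\<^sup>2 + (2 * (c - ?m) * Y x + (?m\<^sup>2 - c\<^sup>2)))"
    by (simp add: fun_eq_iff power2_eq_square algebra_simps)
  show "integrable M (\<lambda>x. (Y x - ?m)\<^sup>2)" unfolding eq using assms by simp
  have "variance Y = expectation (\<lambda>x. (Y x - c)\<^sup>2) + (2 * (c - ?m) * ?m + (?m\<^sup>2 - c\<^sup>2))"
    unfolding eq using assms by (simp add: prob_space)
  also have "2 * (c - ?m) * ?m + (?m\<^sup>2 - c\<^sup>2) = - (c - ?m)\<^sup>2" by (simp add: power2_eq_square algebra_simps)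
  finally show "variance Y \<le> expectation (\<lambda>x. (Y x - c)\<^sup>2)" by simp
qed

text \<open>Up to the factor \<open>1 / t\<close>, a component of the direction is a self-normalized average of
  \<open>(S\<^sup>-\<^sup>1 z) $ i\<close>. The second term accounts for the convention that the ratio of sums is \<open>0\<close> when all
  weights vanish.\<close>

lemma iis_direction_component:
  fixes S :: "real^'p^'p" and c :: "real^'p \<Rightarrow> 'x \<Rightarrow> real" and \<theta> :: "real^'p"
  assumes t: "t \<noteq> 0"
  defines "w \<equiv> \<lambda>z x j. c (\<theta> + t *\<^sub>R z j) (x j)"
  shows "iis_direction c S t n \<theta> z x $ i =
    inverse t * (inverse (\<Sum>j<n. w z x j) * (\<Sum>j<n. w z x j * (matrix_inv S *v z j) $ i))
    - inverse (t\<^sup>2) * ((matrix_inv S *v \<theta>) $ i * (if (\<Sum>j<n. w z x j) = 0 then 1 else 0))"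
proof -
  let ?T = "matrix_inv S"
  let ?W = "\<Sum>j<n. w z x j"
  let ?V = "\<Sum>j<n. w z x j *\<^sub>R z j"
  have 1: "(\<Sum>j<n. w z x j *\<^sub>R (\<theta> + t *\<^sub>R z j)) = ?W *\<^sub>R \<theta> + t *\<^sub>R ?V"
    by (simp add: scaleR_right_distrib sum.distrib scaleR_sum_left scaleR_sum_right mult.commute)
  have 2: "inverse ?W *\<^sub>R (?W *\<^sub>R \<theta> + t *\<^sub>R ?V) - \<theta> = (t * inverse ?W) *\<^sub>R ?V - (if ?W = 0 then 1 else 0) *\<^sub>R \<theta>"
    by (cases "?W = 0") (auto simp: scaleR_right_distrib)
  have 3: "(?T *v ?V) $ i = (\<Sum>j<n. w z x j * (?T *v z j) $ i)"
  proof -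
    have "?T *v ?V = (\<Sum>j<n. w z x j *\<^sub>R (?T *v z j))"
      by (simp add: linear_sum[OF matrix_vector_mul_linear] matrix_vector_mult_scaleR)
    thus ?thesis by simp
  qed
  have "iis_direction c S t n \<theta> z x = inverse (t\<^sup>2) *\<^sub>R (?T *v ((t * inverse ?W) *\<^sub>R ?V - (if ?W = 0 then 1 else 0) *\<^sub>R \<theta>))"
    unfolding iis_direction_def Let_def using 1 2 by (simp add: w_def)
  also have "\<dots> $ i = inverse (t\<^sup>2) * (t * inverse ?W * (?T *v ?V) $ i - (if ?W = 0 then 1 else 0) * (?T *v \<theta>) $ i)"
    by (simp add: matrix_vector_mult_diff_distrib matrix_vector_mult_scaleR)
  also have "\<dots> = inverse t * (inverse ?W * (?T *v ?V) $ i) - inverse (t\<^sup>2) * ((?T *v \<theta>) $ i * (if ?W = 0 then 1 else 0))"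
    using t by (simp add: right_diff_distrib power2_eq_square)
  finally show ?thesis unfolding 3 .
qed

context importance_sampling_model
begin

text \<open>The direction of the algorithm for this model, as a function of scale, sample size, parameter and
  draws.\<close>

abbreviation "dir \<equiv> iis_direction (\<lambda>\<theta> x. g \<theta> x y) (covariance_matrix D)"

lemma measurable_dir[measurable (raw)]:
  assumes [measurable]: "\<theta> \<in> borel_measurable M"
    and z: "\<And>j. j < n \<Longrightarrow> z j \<in> borel_measurable M" and x: "\<And>j. j < n \<Longrightarrow> x j \<in> measurable M \<mu>"
  shows "(\<lambda>\<omega>. dir t n (\<theta> \<omega>) (\<lambda>j. z j \<omega>) (\<lambda>j. x j \<omega>)) \<in> borel_measurable M"
proof -
  have mv: "(*v) A \<in> borel_measurable borel" for A :: "real^'p^'p"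
    by (intro borel_measurable_continuous_onI linear_continuous_on matrix_vector_mul_bounded_linear)
  have a: "(\<lambda>\<omega>. \<theta> \<omega> + t *\<^sub>R z j \<omega>) \<in> borel_measurable M" if "j < n" for j using z[OF that] by measurable
  have w: "(\<lambda>\<omega>. g (\<theta> \<omega> + t *\<^sub>R z j \<omega>) (x j \<omega>) y) \<in> borel_measurable M" if "j < n" for j
    by (intro measurable_weight a x that)
  show ?thesis unfolding iis_direction_def Let_def
    by (intro borel_measurable_scaleR borel_measurable_const measurable_compose[OF _ mv] borel_measurable_diff
        borel_measurable_inverse borel_measurable_sum a w assms(1)) auto
qed

text \<open>The joint law of \<open>n\<close> independent draws at parameter \<open>\<theta>\<close>, the direction computed from a
  batch \<open>b\<close> of draws, and the mean of a component of that direction.\<close>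

abbreviation "batch_law t n \<theta> \<equiv> PiM {..<n} (\<lambda>_. Q t \<theta>)"
abbreviation "batch_dir t n \<theta> b \<equiv> dir t n \<theta> (\<lambda>j. fst (b j)) (\<lambda>j. snd (b j))"
abbreviation "dir_mean t n \<theta> i \<equiv> \<integral>b. batch_dir t n \<theta> b $ i \<partial>batch_law t n \<theta>"

lemma prob_batch_law: "prob_space (batch_law t n \<theta>)"
  by (intro prob_space_PiM prob_Q)

text \<open>On a bounded set of parameters, the direction computed from \<open>n\<close> draws at scale \<open>t\<close> has mean
  equal to the gradient up to terms of order \<open>t\<close> and \<open>1 / (t n)\<close>, and variance of order
  \<open>1 / (t\<^sup>2 n)\<close>; the terms with \<open>q ^ n\<close> come from the event that all weights vanish.\<close>

lemma direction_mean_and_variance: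
  fixes l gr
  assumes K0: "compact K0" "\<forall>z. z \<notin> K0 \<longrightarrow> \<kappa> z = 0"
    and l: "\<And>x. (l has_derivative (\<lambda>h. gr x \<bullet> h)) (at x)"
    and lip: "\<And>R. \<exists>L\<ge>0. \<forall>x\<in>cball 0 R. \<forall>y\<in>cball 0 R. norm (gr x - gr y) \<le> L * norm (x - y)"
    and fY: "\<And>\<theta>. fY \<theta> = exp (l \<theta>)"
    and w: "\<forall>K. compact K \<longrightarrow> bdd_above {g \<theta> x y | \<theta> x. \<theta> \<in> K \<and> x \<in> space \<mu>}"
    and R: "R \<ge> 0" and T: "T \<ge> 0"
  obtains c q where "c \<ge> 0" "0 \<le> q" "q < 1"
    "\<And>\<theta> t n i. norm \<theta> \<le> R \<Longrightarrow> 0 < t \<Longrightarrow> t \<le> T \<Longrightarrow> 0 < n \<Longrightarrow>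
       integrable (batch_law t n \<theta>) (\<lambda>b. batch_dir t n \<theta> b $ i)"
    "\<And>\<theta> t n i. norm \<theta> \<le> R \<Longrightarrow> 0 < t \<Longrightarrow> t \<le> T \<Longrightarrow> 0 < n \<Longrightarrow>
       \<bar>dir_mean t n \<theta> i - gr \<theta> $ i\<bar> \<le> c * (t + 1 / (t * n) + q ^ n / t\<^sup>2)"
    "\<And>\<theta> t n i. norm \<theta> \<le> R \<Longrightarrow> 0 < t \<Longrightarrow> t \<le> T \<Longrightarrow> 0 < n \<Longrightarrow>
       integrable (batch_law t n \<theta>) (\<lambda>b. (batch_dir t n \<theta> b $ i - dir_mean t n \<theta> i)\<^sup>2) \<and>
       (\<integral>b. (batch_dir t n \<theta> b $ i - dir_mean t n \<theta> i)\<^sup>2 \<partial>batch_law t n \<theta>)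
         \<le> c * (1 / (t\<^sup>2 * n) + q ^ n / t ^ 4)"
proof -
  obtain B0 where B0: "B0 > 0" "\<And>z. z \<in> K0 \<Longrightarrow> norm z \<le> B0"
    using compact_imp_bounded[OF K0(1)] by (auto simp: bounded_pos)
  let ?T = "matrix_inv (covariance_matrix D)"
  obtain U where U: "U \<ge> 0" "\<And>z i. \<bar>(?T *v z) $ i\<bar> \<le> U * norm z"
    using matrix_vector_component_bound by blast
  have DB: "AE z in D. norm z \<le> B0" using AE_D_support[OF K0(2)] by eventually_elim (rule B0)
  obtain \<beta> c1 where \<beta>: "\<beta> > 0" and c1: "c1 \<ge> 0"
    and mb: "\<And>\<theta> t. \<theta> \<in> cball 0 R \<Longrightarrow> 0 < t \<Longrightarrow> t \<le> T \<Longrightarrow> \<beta> \<le> (\<integral>z. exp (l (\<theta> + t *\<^sub>R z)) \<partial>D)"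
    and mg: "\<And>\<theta> t i. \<theta> \<in> cball 0 R \<Longrightarrow> 0 < t \<Longrightarrow> t \<le> T \<Longrightarrow>
      \<bar>(\<integral>z. exp (l (\<theta> + t *\<^sub>R z)) * (?T *v z) $ i \<partial>D) / (\<integral>z. exp (l (\<theta> + t *\<^sub>R z)) \<partial>D) / t - gr \<theta> $ i\<bar> \<le> c1 * t"
    by (rule tilted_mean_approximates_gradient[OF prob_D _ DB mean_D pd_D l lip R T]) auto
  have "bdd_above {g \<theta> x y | \<theta> x. \<theta> \<in> cball 0 (R + T * B0) \<and> x \<in> space \<mu>}"
    by (rule w[rule_format, OF compact_cball])
  then obtain C0 where C0: "\<And>\<theta> x. \<theta> \<in> cball 0 (R + T * B0) \<Longrightarrow> x \<in> space \<mu> \<Longrightarrow> g \<theta> x y \<le> C0"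
    unfolding bdd_above_def by blast
  \<comment> \<open>enlarged to at least \<open>\<beta>\<close> so that \<open>q = 1 - \<beta> / C\<close> lies in \<open>[0, 1)\<close>\<close>
  define C where "C = max C0 \<beta>"
  have C: "C > 0" "\<beta> \<le> C" using \<beta> by (auto simp: C_def)
  define B where "B = U * B0"
  have B: "B \<ge> 0" using U B0 by (simp add: B_def)
  define q where "q = 1 - \<beta> / C"
  have q: "0 \<le> q" "q < 1" using C \<beta> by (auto simp: q_def)
  define c2 where "c2 = (8 * B\<^sup>2 + 1 / 2) * C\<^sup>2 / \<beta>\<^sup>2"
  define c3 where "c3 = 16 * B\<^sup>2 * C\<^sup>2 / \<beta>\<^sup>2"
  define c where "c = c1 + c2 + U * R + 2 * c3 + 2 * (U * R)\<^sup>2"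
  have c23: "c2 \<ge> 0" "c3 \<ge> 0" by (auto simp: c2_def c3_def)
  have UR: "U * R \<ge> 0" using U R by simp
  have c: "c \<ge> 0" "c1 \<le> c" "c2 \<le> c" "U * R \<le> c" "2 * c3 \<le> c" "2 * (U * R)\<^sup>2 \<le> c"
    using c1 c23 UR by (auto simp: c_def intro!: add_nonneg_nonneg) 
  have main: "integrable (batch_law t n \<theta>) (\<lambda>b. batch_dir t n \<theta> b $ i) \<and>
      \<bar>dir_mean t n \<theta> i - gr \<theta> $ i\<bar> \<le> c * (t + 1 / (t * n) + q ^ n / t\<^sup>2) \<and>
      integrable (batch_law t n \<theta>) (\<lambda>b. (batch_dir t n \<theta> b $ i - dir_mean t n \<theta> i)\<^sup>2) \<and>
       (\<integral>b. (batch_dir t n \<theta> b $ i - dir_mean t n \<theta> i)\<^sup>2 \<partial>batch_law t n \<theta>)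
         \<le> c * (1 / (t\<^sup>2 * n) + q ^ n / t ^ 4)"
    if \<theta>: "norm \<theta> \<le> R" and t: "0 < t" "t \<le> T" and n: "0 < n" for \<theta> t n i
  proof -
    interpret Q: prob_space "Q t \<theta>" by (rule prob_Q)
    let ?M = "batch_law t n \<theta>"
    interpret M: prob_space ?M by (rule prob_batch_law)
    define w where "w p = g (\<theta> + t *\<^sub>R fst p) (snd p) y" for p
    define u where "u p = (?T *v fst p) $ i" for p :: "(real^'p) \<times> 'x"
    have [measurable]: "(\<lambda>z. (?T *v z) $ i) \<in> borel_measurable borel"
      by (intro borel_measurable_continuous_onI continuous_intros linear_continuous_on matrix_vector_mul_bounded_linear)
    have wm[measurable]: "w \<in> borel_measurable (Q t \<theta>)" unfolding w_def by measurable
    have um[measurable]: "u \<in> borel_measurable (Q t \<theta>)" unfolding u_def by measurable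
    have ball: "\<theta> + t *\<^sub>R z \<in> cball 0 (R + T * B0)" if "z \<in> K0" for z
    proof -
      have "norm (t *\<^sub>R z) \<le> T * B0" using t B0(2)[OF that] by (simp add: mult_mono)
      thus ?thesis using norm_triangle_ineq[of \<theta> "t *\<^sub>R z"] \<theta> by simp
    qed
    have wC: "g (\<theta> + t *\<^sub>R z) x y \<le> C" if "z \<in> K0" "x \<in> space \<mu>" for z x
      using C0[OF ball[OF that(1)] that(2)] by (simp add: C_def)
    have wb: "AE p in Q t \<theta>. 0 \<le> w p \<and> w p \<le> C"
      using AE_Q_support[OF K0(2)] by eventually_elim (use wC g_nonneg y in \<open>auto simp: w_def\<close>)
    have uB: "\<bar>(?T *v z) $ i\<bar> \<le> B" if "z \<in> K0" for z
      unfolding B_def by (rule order_trans[OF U(2)]) (intro mult_left_mono B0 that U)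
    have ub: "AE p in Q t \<theta>. \<bar>u p\<bar> \<le> B"
      using AE_Q_support[OF K0(2)] by eventually_elim (use uB in \<open>auto simp: u_def\<close>)
    have iw: "(\<integral>p. w p \<partial>Q t \<theta>) = (\<integral>z. exp (l (\<theta> + t *\<^sub>R z)) \<partial>D)"
      using integral_Q_weight[OF K0(2), of "\<lambda>_. 1" 1 \<theta> t C] wC by (simp add: w_def fY)
    have iwu: "(\<integral>p. w p * u p \<partial>Q t \<theta>) = (\<integral>z. exp (l (\<theta> + t *\<^sub>R z)) * (?T *v z) $ i \<partial>D)"
      using integral_Q_weight[OF K0(2), of "\<lambda>z. (?T *v z) $ i" B \<theta> t C] wC uB by (simp add: w_def u_def fY)
    have \<theta>': "\<theta> \<in> cball 0 R" using \<theta> by simp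
    have b\<beta>: "\<beta> \<le> (\<integral>p. w p \<partial>Q t \<theta>)" unfolding iw by (rule mb[OF \<theta>' t])
    define r where "r b = inverse (\<Sum>j<n. w (b j)) * (\<Sum>j<n. w (b j) * u (b j))" for b
    define \<rho> where "\<rho> = (\<integral>p. w p * u p \<partial>Q t \<theta>) / (\<integral>p. w p \<partial>Q t \<theta>)"
    have E: "AE b in ?M. \<bar>r b\<bar> \<le> B" "r \<in> borel_measurable ?M"
      "(\<integral>b. (r b - \<rho>)\<^sup>2 \<partial>?M) \<le> 16 * B\<^sup>2 * C\<^sup>2 / \<beta>\<^sup>2 / real n"
      "\<bar>(\<integral>b. r b \<partial>?M) - \<rho>\<bar> \<le> (8 * B\<^sup>2 + 1 / 2) * C\<^sup>2 / \<beta>\<^sup>2 / real n"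
      "measure ?M {b\<in>space ?M. (\<Sum>j<n. w (b j)) = 0} \<le> (1 - \<beta> / C) ^ n"
      unfolding r_def[abs_def] \<rho>_def by (rule self_normalized_estimate[OF prob_Q wm um wb ub B \<beta> b\<beta> n])+
    define s where "s = (?T *v \<theta>) $ i"
    have s: "\<bar>s\<bar> \<le> U * R" unfolding s_def by (rule order_trans[OF U(2)]) (intro mult_left_mono \<theta> U)
    define V where "V = {b \<in> space ?M. (\<Sum>j<n. w (b j)) = 0}"
    have comp[measurable]: "(\<lambda>b. b j) \<in> measurable ?M (Q t \<theta>)" if "j < n" for j using that by simp
    have V[measurable]: "V \<in> sets ?M"
    proof -
      have [measurable]: "(\<lambda>b. \<Sum>j<n. w (b j)) \<in> borel_measurable ?M"
        by (intro borel_measurable_sum measurable_compose[OF comp wm]) auto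
      show ?thesis unfolding V_def by measurable
    qed
    have V1: "measure ?M V \<le> q ^ n" unfolding V_def q_def by (rule E(5))
    have dir: "batch_dir t n \<theta> b $ i = inverse t * r b - inverse (t\<^sup>2) * (s * indicator V b)" if "b \<in> space ?M" for b
      using iis_direction_component[of t "\<lambda>\<theta> x. g \<theta> x y" "covariance_matrix D" n \<theta> "\<lambda>j. fst (b j)" "\<lambda>j. snd (b j)" i] t that
      by (simp add: r_def w_def u_def s_def V_def indicator_def)
    have ri: "integrable ?M r" using E(1,2) by (intro M.integrable_const_bound[of _ B]) auto
    have Vi: "integrable ?M (\<lambda>b. s * indicator V b)"
      by (intro integrable_mult_right) (simp add: integrable_indicator_iff M.emeasure_eq_measure)
    have di: "integrable ?M (\<lambda>b. inverse t * r b - inverse (t\<^sup>2) * (s * indicator V b))"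
      using ri Vi by simp
    hence i1: "integrable ?M (\<lambda>b. batch_dir t n \<theta> b $ i)"
      by (rule Bochner_Integration.integrable_cong[THEN iffD1, rotated -1]) (auto simp: dir)
    have mean: "dir_mean t n \<theta> i = inverse t * (\<integral>b. r b \<partial>?M) - inverse (t\<^sup>2) * (s * measure ?M V)"
    proof -
      have "dir_mean t n \<theta> i = (\<integral>b. inverse t * r b - inverse (t\<^sup>2) * (s * indicator V b) \<partial>?M)"
        by (intro Bochner_Integration.integral_cong) (auto simp: dir)
      also have "\<dots> = inverse t * (\<integral>b. r b \<partial>?M) - inverse (t\<^sup>2) * (s * measure ?M V)"
        using ri Vi by simp
      finally show ?thesis .
    qed
    have sV: "\<bar>s * measure ?M V\<bar> \<le> U * R * q ^ n"
      unfolding abs_mult using s V1 UR by (intro mult_mono) auto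
    have split: "dir_mean t n \<theta> i - gr \<theta> $ i =
      ((\<integral>b. r b \<partial>?M) - \<rho>) / t + (\<rho> / t - gr \<theta> $ i) - (s * measure ?M V) / t\<^sup>2"
      unfolding mean using t by (simp add: field_simps)
    have "\<bar>p + p' - p''\<bar> \<le> \<bar>p\<bar> + \<bar>p'\<bar> + \<bar>p''\<bar>" for p p' p'' :: real by linarith
    hence "\<bar>dir_mean t n \<theta> i - gr \<theta> $ i\<bar> \<le>
      \<bar>((\<integral>b. r b \<partial>?M) - \<rho>) / t\<bar> + \<bar>\<rho> / t - gr \<theta> $ i\<bar> + \<bar>(s * measure ?M V) / t\<^sup>2\<bar>"
      unfolding split .
    also have "\<dots> \<le> c2 / n / t + c1 * t + U * R * q ^ n / t\<^sup>2"
    proof (intro add_mono)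
      show "\<bar>((\<integral>b. r b \<partial>?M) - \<rho>) / t\<bar> \<le> c2 / n / t"
        using divide_right_mono[OF E(4), of t] t unfolding c2_def abs_divide by simp
      show "\<bar>\<rho> / t - gr \<theta> $ i\<bar> \<le> c1 * t" unfolding \<rho>_def iw iwu by (rule mg[OF \<theta>' t])
      show "\<bar>(s * measure ?M V) / t\<^sup>2\<bar> \<le> U * R * q ^ n / t\<^sup>2" 
        using divide_right_mono[OF sV, of "t\<^sup>2"] unfolding abs_divide by simp
    qed
    also have "\<dots> = c2 * (1 / (t * n)) + c1 * t + U * R * (q ^ n / t\<^sup>2)" by (simp add: mult.commute)
    also have "\<dots> \<le> c * (1 / (t * n)) + c * t + c * (q ^ n / t\<^sup>2)"
      using c t q by (intro add_mono mult_right_mono) auto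
    finally have i2: "\<bar>dir_mean t n \<theta> i - gr \<theta> $ i\<bar> \<le> c * (t + 1 / (t * n) + q ^ n / t\<^sup>2)"
      by (simp add: algebra_simps)
    have r2: "integrable ?M (\<lambda>b. (r b - \<rho>)\<^sup>2)"
    proof (rule M.integrable_const_bound[of _ "(B + \<bar>\<rho>\<bar>)\<^sup>2"])
      show "AE b in ?M. norm ((r b - \<rho>)\<^sup>2) \<le> (B + \<bar>\<rho>\<bar>)\<^sup>2"
        using E(1)
      proof eventually_elim
        case (elim b)
        have "\<bar>r b - \<rho>\<bar>\<^sup>2 \<le> (B + \<bar>\<rho>\<bar>)\<^sup>2" using elim by (intro power_mono) auto
        thus ?case by simp
      qed
      show "(\<lambda>b. (r b - \<rho>)\<^sup>2) \<in> borel_measurable ?M" using E(2) by measurable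
    qed
    have V2: "integrable ?M (\<lambda>b. (s * indicator V b)\<^sup>2)"
    proof -
      have "(\<lambda>b. (s * indicator V b)\<^sup>2) = (\<lambda>b. s\<^sup>2 * indicator V b :: real)" by (auto simp: fun_eq_iff indicator_def)
      thus ?thesis by (simp add: integrable_indicator_iff M.emeasure_eq_measure)
    qed
    have V2e: "(\<integral>b. (s * indicator V b)\<^sup>2 \<partial>?M) = s\<^sup>2 * measure ?M V"
    proof -
      have "(\<lambda>b. (s * indicator V b)\<^sup>2) = (\<lambda>b. s\<^sup>2 * indicator V b :: real)" by (auto simp: fun_eq_iff indicator_def)
      thus ?thesis by simp
    qed
    have dle: "(batch_dir t n \<theta> b $ i - \<rho> / t)\<^sup>2 \<le> 2 / t\<^sup>2 * (r b - \<rho>)\<^sup>2 + 2 / t ^ 4 * (s * indicator V b)\<^sup>2"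
      if "b \<in> space ?M" for b
    proof -
      have "batch_dir t n \<theta> b $ i - \<rho> / t = (r b - \<rho>) / t - (s * indicator V b) / t\<^sup>2"
        using that by (simp add: dir divide_inverse algebra_simps)
      also have "\<dots>\<^sup>2 \<le> 2 * ((r b - \<rho>) / t)\<^sup>2 + 2 * ((s * indicator V b) / t\<^sup>2)\<^sup>2"
      proof -
        have "0 \<le> ((r b - \<rho>) / t + (s * indicator V b) / t\<^sup>2)\<^sup>2" by simp
        thus ?thesis by (simp add: power2_sum power2_diff)
      qed
      also have "((s * indicator V b) / t\<^sup>2)\<^sup>2 = (s * indicator V b)\<^sup>2 / t ^ 4"
        by (simp add: power_divide)
      finally show ?thesis by (simp add: power_divide)
    qed
    have bi: "integrable ?M (\<lambda>b. 2 / t\<^sup>2 * (r b - \<rho>)\<^sup>2 + 2 / t ^ 4 * (s * indicator V b)\<^sup>2)"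
      using r2 V2 by simp
    have d2i: "integrable ?M (\<lambda>b. (batch_dir t n \<theta> b $ i - \<rho> / t)\<^sup>2)"
    proof (rule Bochner_Integration.integrable_bound[OF bi])
      show "(\<lambda>b. (batch_dir t n \<theta> b $ i - \<rho> / t)\<^sup>2) \<in> borel_measurable ?M"
        using borel_measurable_integrable[OF i1] by measurable
      show "AE b in ?M. norm ((batch_dir t n \<theta> b $ i - \<rho> / t)\<^sup>2) \<le> norm (2 / t\<^sup>2 * (r b - \<rho>)\<^sup>2 + 2 / t ^ 4 * (s * indicator V b)\<^sup>2)"
      proof (rule AE_I2)
        fix b assume "b \<in> space ?M"
        from dle[OF this] show "norm ((batch_dir t n \<theta> b $ i - \<rho> / t)\<^sup>2) \<le> norm (2 / t\<^sup>2 * (r b - \<rho>)\<^sup>2 + 2 / t ^ 4 * (s * indicator V b)\<^sup>2)"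
          unfolding real_norm_def by (smt (verit) zero_le_power2)
      qed
    qed
    note var = M.variance_le_second_moment[OF i1 d2i]
    note var(2)
    also have "(\<integral>b. (batch_dir t n \<theta> b $ i - \<rho> / t)\<^sup>2 \<partial>?M) \<le> (\<integral>b. 2 / t\<^sup>2 * (r b - \<rho>)\<^sup>2 + 2 / t ^ 4 * (s * indicator V b)\<^sup>2 \<partial>?M)"
      by (intro integral_mono d2i bi dle)
    also have "\<dots> = 2 / t\<^sup>2 * (\<integral>b. (r b - \<rho>)\<^sup>2 \<partial>?M) + 2 / t ^ 4 * (s\<^sup>2 * measure ?M V)"
      using r2 V2 V2e by simp
    also have "\<dots> \<le> 2 / t\<^sup>2 * (c3 / n) + 2 / t ^ 4 * ((U * R)\<^sup>2 * q ^ n)"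
    proof (intro add_mono mult_left_mono mult_mono)
      show "(\<integral>b. (r b - \<rho>)\<^sup>2 \<partial>?M) \<le> c3 / n" using E(3) by (simp add: c3_def)
      have "\<bar>s\<bar>\<^sup>2 \<le> (U * R)\<^sup>2" using s by (intro power_mono) auto
      thus "s\<^sup>2 \<le> (U * R)\<^sup>2" by simp
    qed (use V1 in auto)
    also have "\<dots> = 2 * c3 * (1 / (t\<^sup>2 * n)) + 2 * (U * R)\<^sup>2 * (q ^ n / t ^ 4)" by simp
    also have "\<dots> \<le> c * (1 / (t\<^sup>2 * n)) + c * (q ^ n / t ^ 4)"
      using c q by (intro add_mono mult_right_mono) auto
    also have "\<dots> = c * (1 / (t\<^sup>2 * n) + q ^ n / t ^ 4)" by (simp add: algebra_simps)
    finally show ?thesis using i1 i2 var(1) by blast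
  qed
  show ?thesis by (rule that[OF c(1) q]) (use main in blast)+
qed

end

section \<open>The random iteration\<close>

lemma cube_times_power_tendsto_0:
  fixes q :: real
  assumes "0 \<le> q" "q < 1"
  shows "(\<lambda>n. real n ^ 3 * q ^ n) \<longlonglongrightarrow> 0"
proof -
  \<comment> \<open>\<open>n\<^sup>3 q\<^sup>n\<close> is the cube of \<open>n r\<^sup>n\<close>\<close>
  let ?r = "root 3 q"
  have r: "0 \<le> ?r" "?r < 1" "?r ^ 3 = q" using assms by auto
  have "(\<lambda>n. real n * ?r ^ n) \<longlonglongrightarrow> 0" using powser_times_n_limit_0[of ?r] r by simp
  hence "(\<lambda>n. (real n * ?r ^ n) ^ 3) \<longlonglongrightarrow> 0 ^ 3" by (rule tendsto_power)
  moreover have "(real n * ?r ^ n) ^ 3 = real n ^ 3 * q ^ n" for n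
    by (simp add: power_mult_distrib power_mult[symmetric] mult.commute[of n]) (simp add: power_mult r(3))
  ultimately show ?thesis by simp
qed

text \<open>Since \<open>J \<tau> \<longrightarrow> \<infinity>\<close>, eventually \<open>1 / \<tau> \<le> J\<close>, so negative powers of \<open>\<tau>\<close> are absorbed by the exponential
  \<open>q ^ J\<close>.\<close>

lemma sample_size_asymptotics:
  fixes \<tau> :: "nat \<Rightarrow> real" and J :: "nat \<Rightarrow> nat"
  assumes \<tau>: "\<And>m. 0 < \<tau> m" "\<tau> \<longlonglongrightarrow> 0" and J: "\<And>m. 0 < J m"
    and J\<tau>: "filterlim (\<lambda>m. real (J m) * \<tau> m) at_top sequentially" and q: "0 \<le> q" "q < 1"
  shows "(\<lambda>m. \<tau> m + 1 / (\<tau> m * J m) + q ^ J m / (\<tau> m)\<^sup>2) \<longlonglongrightarrow> 0"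
    and "\<forall>\<^sub>F m in sequentially. q ^ J m / \<tau> m ^ 4 \<le> 1 / ((\<tau> m)\<^sup>2 * J m)"
proof -
  define s where "s n = real n ^ 3 * q ^ n" for n
  have "\<forall>\<^sub>F m in sequentially. \<tau> m < 1" by (rule order_tendstoD(2)[OF \<tau>(2)]) simp
  hence "\<forall>\<^sub>F m in sequentially. real (J m) * \<tau> m \<le> real (J m)"
    by eventually_elim (simp add: mult_left_le)
  hence "filterlim (\<lambda>m. real (J m)) at_top sequentially" using J\<tau> by (rule filterlim_at_top_mono[rotated])
  hence Jinf: "filterlim J sequentially sequentially" using filterlim_sequentially_iff_filterlim_real by blast
  have "s \<longlonglongrightarrow> 0" unfolding s_def by (rule cube_times_power_tendsto_0[OF q])
  from filterlim_compose[OF this Jinf] have sJ: "(\<lambda>m. s (J m)) \<longlonglongrightarrow> 0" .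
  have ev: "\<forall>\<^sub>F m in sequentially. 1 \<le> real (J m) * \<tau> m" using J\<tau> by (rule filterlim_at_top[THEN iffD1, rule_format])
  have bound: "q ^ J m / (\<tau> m)\<^sup>2 \<le> s (J m) / J m" if "1 \<le> real (J m) * \<tau> m" for m
  proof -
    have "1 / \<tau> m \<le> real (J m)" using that \<tau>(1)[of m] by (simp add: field_simps)
    hence "(1 / \<tau> m)\<^sup>2 \<le> (real (J m))\<^sup>2" using \<tau>(1)[of m] by (intro power_mono) (auto simp: less_imp_le)
    hence "q ^ J m * (1 / \<tau> m)\<^sup>2 \<le> q ^ J m * (real (J m))\<^sup>2" using q by (intro mult_left_mono) auto
    also have "\<dots> = s (J m) / J m" using J[of m] by (simp add: s_def power2_eq_square power3_eq_cube)
    finally show ?thesis by (simp add: power_divide)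
  qed
  have s0: "s n \<ge> 0" for n using q by (simp add: s_def)
  have "(\<lambda>m. q ^ J m / (\<tau> m)\<^sup>2) \<longlonglongrightarrow> 0"
  proof (rule tendsto_sandwich[OF _ _ tendsto_const sJ])
    show "\<forall>\<^sub>F m in sequentially. 0 \<le> q ^ J m / (\<tau> m)\<^sup>2" using q by (intro always_eventually) simp
    show "\<forall>\<^sub>F m in sequentially. q ^ J m / (\<tau> m)\<^sup>2 \<le> s (J m)"
      using ev
    proof eventually_elim
      case (elim m)
      have "s (J m) / J m \<le> s (J m) / 1" using J[of m] s0 by (intro divide_left_mono) auto
      thus ?case using bound[OF elim] by simp
    qed
  qed
  moreover have "(\<lambda>m. inverse (real (J m) * \<tau> m)) \<longlonglongrightarrow> 0" by (rule tendsto_inverse_0_at_top[OF J\<tau>])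
  hence "(\<lambda>m. 1 / (\<tau> m * J m)) \<longlonglongrightarrow> 0" by (simp add: inverse_eq_divide mult.commute)
  ultimately have "(\<lambda>m. \<tau> m + 1 / (\<tau> m * J m) + q ^ J m / (\<tau> m)\<^sup>2) \<longlonglongrightarrow> 0 + 0 + 0"
    using \<tau>(2) by (intro tendsto_add)
  thus "(\<lambda>m. \<tau> m + 1 / (\<tau> m * J m) + q ^ J m / (\<tau> m)\<^sup>2) \<longlonglongrightarrow> 0" by simp
  have "\<forall>\<^sub>F m in sequentially. s (J m) < 1" by (rule order_tendstoD(2)[OF sJ]) simp
  with ev show "\<forall>\<^sub>F m in sequentially. q ^ J m / \<tau> m ^ 4 \<le> 1 / ((\<tau> m)\<^sup>2 * J m)"
  proof eventually_elim
    case (elim m)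
    have "q ^ J m / \<tau> m ^ 4 = (q ^ J m / (\<tau> m)\<^sup>2) / (\<tau> m)\<^sup>2" by simp
    also have "\<dots> \<le> (s (J m) / J m) / (\<tau> m)\<^sup>2" by (intro divide_right_mono bound elim) simp
    also have "\<dots> \<le> (1 / J m) / (\<tau> m)\<^sup>2" using elim(2) by (intro divide_right_mono) auto
    also have "\<dots> = 1 / ((\<tau> m)\<^sup>2 * J m)" by simp
    finally show ?case .
  qed
qed

lemma summable_vec:
  fixes f :: "nat \<Rightarrow> real^'p"
  assumes "\<And>i. summable (\<lambda>m. f m $ i)"
  shows "summable f"
proof -
  have "f = (\<lambda>m. \<Sum>i\<in>UNIV. (f m $ i) *\<^sub>R axis i 1)"
    using basis_expansion[of "f _"] by (simp add: scalar_mult_eq_scaleR)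
  moreover have "summable (\<lambda>m. \<Sum>i\<in>UNIV. (f m $ i) *\<^sub>R axis i (1::real))"
    by (intro summable_sum summable_scaleR_left assms)
  ultimately show ?thesis by simp
qed

text \<open>A run of the algorithm on the probability space \<open>P\<close>. Below, \<open>\<Theta>\<close> is the sequence of estimates,
  \<open>F m\<close> the sigma-algebra of the draws before iteration \<open>m\<close>, \<open>Y m\<close> the batch of draws of iteration \<open>m\<close>
  with values in \<open>N m\<close>, and \<open>law m \<omega>\<close> its conditional law.\<close>

locale importance_sampling_run = importance_sampling_model \<mu> \<nu> f g y \<kappa>
  for \<mu> :: "'x measure" and \<nu> :: "'y measure" and f g :: "real^'p \<Rightarrow> 'x \<Rightarrow> 'y \<Rightarrow> real"
    and y :: 'y and \<kappa> :: "real^'p \<Rightarrow> real" +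
  fixes P :: "'w measure" and a \<tau> :: "nat \<Rightarrow> real" and J :: "nat \<Rightarrow> nat" and \<theta>1 :: "real^'p"
    and Z :: "nat \<Rightarrow> nat \<Rightarrow> 'w \<Rightarrow> real^'p" and X :: "nat \<Rightarrow> nat \<Rightarrow> 'w \<Rightarrow> 'x"
  assumes prob_P: "prob_space P"
    and draws: "monte_carlo_draws P \<mu> (marginal_X \<nu> f) \<kappa> \<tau> J
       (iis_estimate (\<lambda>\<theta> x. g \<theta> x y) (covariance_matrix (density lborel \<kappa>)) a \<tau> J \<theta>1 Z X) Z X"
begin

sublocale prob_space P by (rule prob_P)

abbreviation "\<Theta> \<equiv> iis_estimate (\<lambda>\<theta> x. g \<theta> x y) (covariance_matrix D) a \<tau> J \<theta>1 Z X"
abbreviation "F \<equiv> history P \<mu> J Z X"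
abbreviation "N m \<equiv> PiM {..<J m} (\<lambda>_. borel \<Otimes>\<^sub>M \<mu>)"
abbreviation "Y \<equiv> batch J Z X"
abbreviation "law m \<omega> \<equiv> batch_law (\<tau> m) (J m) (\<Theta> m \<omega>)"

lemma draws_measurable: "j < J m \<Longrightarrow> Z m j \<in> borel_measurable P" "j < J m \<Longrightarrow> X m j \<in> measurable P \<mu>"
  using draws by (auto simp: monte_carlo_draws_def)

text \<open>The events that generate the sigma-algebra of the past.\<close>

abbreviation "past_events m \<equiv> \<Union>k\<in>{..<m}. \<Union>j\<in>{..<J k}.
  {Z k j -` B \<inter> space P | B. B \<in> sets borel} \<union> {X k j -` B \<inter> space P | B. B \<in> sets \<mu>}"

lemma past_events_sets: "past_events m \<subseteq> sets P"
  using measurable_sets[OF draws_measurable(1)] measurable_sets[OF draws_measurable(2)] by blast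

lemma space_history: "space (F m) = space P"
  unfolding history_def by (rule space_measure_of) (use past_events_sets sets.space_closed in blast)

lemma sets_history: "sets (F m) = sigma_sets (space P) (past_events m)"
  unfolding history_def by (rule sets_measure_of) (use past_events_sets sets.space_closed in blast)

lemma subalgebra_history: "subalgebra P (F m)"
  unfolding subalgebra_def sets_history using space_history sets.sigma_sets_subset[OF past_events_sets] by simp

lemma draws_history:
  assumes "k < m" "j < J k"
  shows "Z k j \<in> borel_measurable (F m)" "X k j \<in> measurable (F m) \<mu>"
proof -
  have "Z k j -` B \<inter> space P \<in> sets (F m)" if "B \<in> sets borel" for B
    unfolding sets_history by (rule sigma_sets.Basic) (use assms that in blast)
  thus "Z k j \<in> borel_measurable (F m)" by (intro measurableI) (auto simp: space_history)
  have "X k j -` B \<inter> space P \<in> sets (F m)" if "B \<in> sets \<mu>" for B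
    unfolding sets_history by (rule sigma_sets.Basic) (use assms that in blast)
  thus "X k j \<in> measurable (F m) \<mu>"
    using measurable_space[OF draws_measurable(2)[OF assms(2)]]
    by (intro measurableI) (auto simp: space_history)
qed

lemma estimate_history: "m \<le> n \<Longrightarrow> \<Theta> m \<in> borel_measurable (F n)"
proof (induction m)
  case (Suc m)
  have [measurable]: "\<Theta> m \<in> borel_measurable (F n)" using Suc by simp
  have "(\<lambda>\<omega>. dir (\<tau> m) (J m) (\<Theta> m \<omega>) (\<lambda>j. Z m j \<omega>) (\<lambda>j. X m j \<omega>)) \<in> borel_measurable (F n)"
    using Suc.prems draws_history[of m n] by (intro measurable_dir) auto
  thus ?case by simp
next
  case 0
  have "\<Theta> 0 = (\<lambda>_. \<theta>1)" by (rule ext) simp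
  thus ?case by simp
qed

lemma batch_history: "m < n \<Longrightarrow> Y m \<in> measurable (F n) (N m)"
  unfolding batch_def by (intro measurable_restrict measurable_Pair draws_history) auto

lemma batch_measurable: "Y m \<in> measurable P (N m)"
  unfolding batch_def by (intro measurable_restrict measurable_Pair draws_measurable) auto

lemma law_kernel: "law m \<in> measurable (F m) (prob_algebra (N m))"
  by (rule measurable_compose[OF estimate_history[OF order_refl] measurable_PiM_power_kernel[OF Q_kernel finite_lessThan]])

lemma batch_conditional_law:
  "B \<in> sets (N m) \<Longrightarrow> AE \<omega> in P. real_cond_exp P (F m) (indicator (Y m -` B \<inter> space P)) \<omega> = measure (law m \<omega>) B"
  using draws by (auto simp: monte_carlo_draws_def)

lemma estimate_Suc: "\<Theta> (Suc m) \<omega> = \<Theta> m \<omega> + a m *\<^sub>R batch_dir (\<tau> m) (J m) (\<Theta> m \<omega>) (Y m \<omega>)"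
  by (simp add: iis_direction_def batch_def Let_def)

lemma batch_dir_measurable:
  "(\<lambda>(\<theta>, b). batch_dir t (J m) \<theta> b $ i) \<in> borel_measurable (borel \<Otimes>\<^sub>M N m)"
proof -
  have 1: "(\<lambda>p. batch_dir t (J m) (fst p) (snd p)) \<in> borel_measurable (borel \<Otimes>\<^sub>M N m)"
    by (intro measurable_dir) measurable
  have 2: "(\<lambda>v. v $ i) \<in> borel_measurable (borel :: (real^'p) measure)" by measurable
  show ?thesis using measurable_compose[OF 1 2] by (simp only: case_prod_beta')
qed

lemma mean_dir_measurable:
  "(\<lambda>\<theta>. dir_mean t (J m) \<theta> i) \<in> borel_measurable borel"
proof -
  let ?L = "\<lambda>\<theta>. batch_law t (J m) \<theta>"
  let ?h = "\<lambda>(\<theta>, b). batch_dir t (J m) \<theta> b $ i"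
  have L: "?L \<in> measurable borel (subprob_algebra (N m))"
    by (rule measurable_prob_algebraD[OF measurable_PiM_power_kernel[OF Q_kernel finite_lessThan]])
  have "(\<lambda>\<theta>. distr (?L \<theta>) (borel \<Otimes>\<^sub>M N m) (\<lambda>b. (\<theta>, b))) \<in> measurable borel (subprob_algebra (borel \<Otimes>\<^sub>M N m))"
    by (rule measurable_distr2[OF _ L]) measurable
  from measurable_compose[OF this integral_measurable_subprob_algebra[OF batch_dir_measurable[where t = t and m = m and i = i]]]
  have "(\<lambda>\<theta>. \<integral>p. ?h p \<partial>distr (?L \<theta>) (borel \<Otimes>\<^sub>M N m) (\<lambda>b. (\<theta>, b))) \<in> borel_measurable borel" .
  moreover have "(\<integral>p. ?h p \<partial>distr (?L \<theta>) (borel \<Otimes>\<^sub>M N m) (\<lambda>b. (\<theta>, b))) = (\<integral>b. batch_dir t (J m) \<theta> b $ i \<partial>?L \<theta>)" for \<theta>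
  proof -
    have "sets (?L \<theta>) = sets (N m)" by (intro sets_PiM_cong refl sets_Q)
    hence "(\<lambda>b. (\<theta>, b)) \<in> measurable (?L \<theta>) (borel \<Otimes>\<^sub>M N m)"
      by (subst measurable_cong_sets[OF _ refl]) (auto intro: measurable_Pair1')
    from integral_distr[OF this batch_dir_measurable] show ?thesis by simp
  qed
  ultimately show ?thesis by simp
qed

text \<open>On the event that the estimates stay within distance \<open>R\<close> of the origin, the algorithm is gradient
  ascent with vanishing bias \<open>b\<close> and noise \<open>\<xi>\<close> whose weighted series converges. The noise is the
  deviation of the direction from its conditional mean. It is cut off outside the ball and before the
  index \<open>m0\<close> from which the variance bound is of the order of the given summable sequence; both are
  decided by the past, so the martingale property is preserved.\<close>

lemma noise_decomposition:
  fixes l gr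
  assumes K0: "compact K0" "\<forall>z. z \<notin> K0 \<longrightarrow> \<kappa> z = 0"
    and l: "\<And>x. (l has_derivative (\<lambda>h. gr x \<bullet> h)) (at x)"
    and lip: "\<And>R. \<exists>L\<ge>0. \<forall>x\<in>cball 0 R. \<forall>y\<in>cball 0 R. norm (gr x - gr y) \<le> L * norm (x - y)"
    and fY: "\<And>\<theta>. fY \<theta> = exp (l \<theta>)"
    and w: "\<forall>K. compact K \<longrightarrow> bdd_above {g \<theta> x y | \<theta> x. \<theta> \<in> K \<and> x \<in> space \<mu>}"
    and pos: "\<And>m. 0 < \<tau> m" "\<And>m. 0 < J m" and \<tau>: "\<tau> \<longlonglongrightarrow> 0"
    and J\<tau>: "filterlim (\<lambda>m. real (J m) * \<tau> m) at_top sequentially"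
    and sq: "summable (\<lambda>m. (a m)\<^sup>2 * inverse (real (J m)) * inverse ((\<tau> m)\<^sup>2))"
    and R: "R \<ge> 0"
  shows "AE \<omega> in P. (\<forall>m. norm (\<Theta> m \<omega>) \<le> R) \<longrightarrow>
    (\<exists>b \<xi>. b \<longlonglongrightarrow> 0 \<and> summable (\<lambda>m. a m *\<^sub>R \<xi> m) \<and>
       (\<forall>m. \<Theta> (Suc m) \<omega> = \<Theta> m \<omega> + a m *\<^sub>R (gr (\<Theta> m \<omega>) + b m + \<xi> m)))"
proof -
  obtain T where T: "\<And>m. \<tau> m \<le> T"
    using convergent_imp_Bseq[OF convergentI[OF \<tau>]] unfolding Bseq_def by (metis abs_le_D1 real_norm_def)
  have T0: "T \<ge> 0" using T[of 0] pos(1)[of 0] by linarith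
  obtain c q where c: "c \<ge> 0" and q: "0 \<le> q" "q < 1"
    and int: "\<And>\<theta> t n i. norm \<theta> \<le> R \<Longrightarrow> 0 < t \<Longrightarrow> t \<le> T \<Longrightarrow> 0 < n \<Longrightarrow>
       integrable (batch_law t n \<theta>) (\<lambda>b. batch_dir t n \<theta> b $ i)"
    and mean: "\<And>\<theta> t n i. norm \<theta> \<le> R \<Longrightarrow> 0 < t \<Longrightarrow> t \<le> T \<Longrightarrow> 0 < n \<Longrightarrow>
       \<bar>dir_mean t n \<theta> i - gr \<theta> $ i\<bar> \<le> c * (t + 1 / (t * n) + q ^ n / t\<^sup>2)"
    and var: "\<And>\<theta> t n i. norm \<theta> \<le> R \<Longrightarrow> 0 < t \<Longrightarrow> t \<le> T \<Longrightarrow> 0 < n \<Longrightarrow>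
       integrable (batch_law t n \<theta>) (\<lambda>b. (batch_dir t n \<theta> b $ i - dir_mean t n \<theta> i)\<^sup>2) \<and>
       (\<integral>b. (batch_dir t n \<theta> b $ i - dir_mean t n \<theta> i)\<^sup>2 \<partial>batch_law t n \<theta>)
         \<le> c * (1 / (t\<^sup>2 * n) + q ^ n / t ^ 4)"
    by (rule direction_mean_and_variance[OF K0 l lip fY w R T0]) (rule that)
  note asym = sample_size_asymptotics[OF pos(1) \<tau> pos(2) J\<tau> q]
  obtain m0 where m0: "\<And>m. m \<ge> m0 \<Longrightarrow> q ^ J m / \<tau> m ^ 4 \<le> 1 / ((\<tau> m)\<^sup>2 * J m)"
    using asym(2) by (auto simp: eventually_sequentially)
  define \<delta> where "\<delta> m \<theta> b i = batch_dir (\<tau> m) (J m) \<theta> b $ i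
      - dir_mean (\<tau> m) (J m) \<theta> i" for m \<theta> b i
  define h where "h m i p = a m * (if m0 \<le> m \<and> norm (\<Theta> m (fst p)) \<le> R then \<delta> m (\<Theta> m (fst p)) (snd p) i else 0)" for m i p
  define v where "v m = 2 * c * ((a m)\<^sup>2 * inverse (real (J m)) * inverse ((\<tau> m)\<^sup>2))" for m
  have v: "summable v" unfolding v_def by (intro summable_mult sq)
  have v0: "v m \<ge> 0" for m using c by (simp add: v_def)
  have h_meas: "h m i \<in> borel_measurable (A \<Otimes>\<^sub>M N m)" if [measurable]: "\<Theta> m \<in> borel_measurable A" for m i A
  proof -
    have "(\<lambda>p. (\<Theta> m (fst p), snd p)) \<in> measurable (A \<Otimes>\<^sub>M N m) (borel \<Otimes>\<^sub>M N m)" by measurable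
    note [measurable] = measurable_compose[OF this batch_dir_measurable[where t = "\<tau> m" and m = m and i = i], simplified]
      measurable_compose[OF _ mean_dir_measurable[where t = "\<tau> m" and m = m and i = i]]
    show ?thesis unfolding h_def \<delta>_def by measurable
  qed
  define \<xi> where "\<xi> i m \<omega> = h m i (\<omega>, Y m \<omega>)" for i m \<omega>
  have conv: "AE \<omega> in P. summable (\<lambda>m. \<xi> i m \<omega>)" for i
  proof (rule martingale_difference_series_converges[OF subalgebra_history _ _ _ _ v])
    have hF: "h m i \<in> borel_measurable (F m \<Otimes>\<^sub>M N m)" for m
      by (rule h_meas[OF estimate_history[OF order_refl]])
    show adapted: "\<xi> i m \<in> borel_measurable (F n)" if "m < n" for m n
    proof -
      have "(\<lambda>\<omega>. (\<omega>, Y m \<omega>)) \<in> measurable (F n) (F n \<Otimes>\<^sub>M N m)"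
        using batch_history[OF that] by measurable
      from measurable_compose[OF this h_meas[OF estimate_history]] that show ?thesis
        by (simp add: \<xi>_def[abs_def])
    qed
    have \<xi>P[measurable]: "\<xi> i m \<in> borel_measurable P" for m
      using measurable_from_subalg[OF subalgebra_history adapted[of m "Suc m"]] by simp
    have hsq: "(\<integral>\<^sup>+b. ennreal ((h m i (\<omega>, b))\<^sup>2) \<partial>law m \<omega>) \<le> ennreal (v m)" for m \<omega>
    proof (cases "m0 \<le> m \<and> norm (\<Theta> m \<omega>) \<le> R")
      case True
      let ?M = "law m \<omega>"
      note V = var[OF conjunct2[OF True] pos(1)[of m] T pos(2)[of m], of i, folded \<delta>_def]
      have "(\<integral>\<^sup>+b. ennreal ((h m i (\<omega>, b))\<^sup>2) \<partial>?M) = (\<integral>\<^sup>+b. ennreal ((a m)\<^sup>2 * (\<delta> m (\<Theta> m \<omega>) b i)\<^sup>2) \<partial>?M)"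
        using True by (simp add: h_def power_mult_distrib)
      also have "\<dots> = ennreal (\<integral>b. (a m)\<^sup>2 * (\<delta> m (\<Theta> m \<omega>) b i)\<^sup>2 \<partial>?M)"
        using V by (intro nn_integral_eq_integral) auto
      also have "\<dots> \<le> ennreal (v m)"
      proof (rule ennreal_leI)
        have "(\<integral>b. (\<delta> m (\<Theta> m \<omega>) b i)\<^sup>2 \<partial>?M) \<le> c * (1 / ((\<tau> m)\<^sup>2 * J m) + q ^ J m / \<tau> m ^ 4)" using V by simp
        also have "\<dots> \<le> c * (1 / ((\<tau> m)\<^sup>2 * J m) + 1 / ((\<tau> m)\<^sup>2 * J m))"
          using m0[of m] True c by (intro mult_left_mono add_left_mono) auto
        finally have "(a m)\<^sup>2 * (\<integral>b. (\<delta> m (\<Theta> m \<omega>) b i)\<^sup>2 \<partial>?M) \<le> (a m)\<^sup>2 * (c * (1 / ((\<tau> m)\<^sup>2 * J m) + 1 / ((\<tau> m)\<^sup>2 * J m)))"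
          by (rule mult_left_mono) simp
        also have "\<dots> = v m" by (simp add: v_def inverse_eq_divide field_simps)
        finally show "(\<integral>b. (a m)\<^sup>2 * (\<delta> m (\<Theta> m \<omega>) b i)\<^sup>2 \<partial>?M) \<le> v m" by simp
      qed
      finally show ?thesis .
    next
      case False
      hence "h m i (\<omega>, b) = 0" for b by (auto simp: h_def)
      thus ?thesis by simp
    qed
    have nn: "(\<integral>\<^sup>+\<omega>. ennreal ((\<xi> i m \<omega>)\<^sup>2) \<partial>P) \<le> ennreal (v m)" for m
    proof -
      have hm: "(\<lambda>p. ennreal ((h m i p)\<^sup>2)) \<in> borel_measurable (F m \<Otimes>\<^sub>M N m)" using hF[of m] by measurable
      have "(\<integral>\<^sup>+\<omega>. ennreal ((\<xi> i m \<omega>)\<^sup>2) \<partial>P) = (\<integral>\<^sup>+\<omega>. \<integral>\<^sup>+b. ennreal ((h m i (\<omega>, b))\<^sup>2) \<partial>law m \<omega> \<partial>P)"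
        unfolding \<xi>_def
        by (rule nn_integral_disintegrate[OF subalgebra_history batch_measurable law_kernel batch_conditional_law hm])
      also have "\<dots> \<le> (\<integral>\<^sup>+\<omega>. ennreal (v m) \<partial>P)" by (intro nn_integral_mono hsq)
      finally show ?thesis by (simp add: emeasure_space_1)
    qed
    show sqi: "integrable P (\<lambda>\<omega>. (\<xi> i m \<omega>)\<^sup>2)" for m
      by (rule integrableI_nonneg) (use nn[of m] in \<open>auto intro: le_less_trans\<close>)
    show "(\<integral>\<omega>. (\<xi> i m \<omega>)\<^sup>2 \<partial>P) \<le> v m" for m
      using nn[of m] v0[of m] by (subst (asm) nn_integral_eq_integral[OF sqi]) auto
    fix m and G :: "'w \<Rightarrow> real" and C :: real
    assume G: "G \<in> borel_measurable (F m)" and GC: "\<And>\<omega>. \<bar>G \<omega>\<bar> \<le> C"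
    define H where "H p = h m i p * G (fst p)" for p
    have "(\<integral>\<omega>. H (\<omega>, Y m \<omega>) \<partial>P) = 0"
    proof (rule integral_disintegrate_0[OF subalgebra_history batch_measurable law_kernel batch_conditional_law])
      show "H \<in> borel_measurable (F m \<Otimes>\<^sub>M N m)" unfolding H_def using hF[of m] G by measurable
      have GP[measurable]: "G \<in> borel_measurable P" by (rule measurable_from_subalg[OF subalgebra_history G])
      have "integrable P (\<lambda>\<omega>. C * \<xi> i m \<omega>)"
        using square_integrable_imp_integrable[OF \<xi>P sqi] by simp
      thus "integrable P (\<lambda>\<omega>. H (\<omega>, Y m \<omega>))"
      proof (rule Bochner_Integration.integrable_bound)
        show "(\<lambda>\<omega>. H (\<omega>, Y m \<omega>)) \<in> borel_measurable P" using \<xi>P[of m] by (simp add: H_def \<xi>_def[abs_def])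
        show "AE \<omega> in P. norm (H (\<omega>, Y m \<omega>)) \<le> norm (C * \<xi> i m \<omega>)"
        proof (rule AE_I2)
          fix \<omega>
          have "\<bar>G \<omega>\<bar> \<le> \<bar>C\<bar>" using GC[of \<omega>] by linarith
          hence "\<bar>G \<omega>\<bar> * \<bar>\<xi> i m \<omega>\<bar> \<le> \<bar>C\<bar> * \<bar>\<xi> i m \<omega>\<bar>" by (rule mult_right_mono) simp
          thus "norm (H (\<omega>, Y m \<omega>)) \<le> norm (C * \<xi> i m \<omega>)"
            by (simp add: H_def \<xi>_def abs_mult mult.commute)
        qed
      qed
      fix \<omega>
      show "integrable (law m \<omega>) (\<lambda>b. H (\<omega>, b)) \<and> (\<integral>b. H (\<omega>, b) \<partial>law m \<omega>) = 0"
      proof (cases "m0 \<le> m \<and> norm (\<Theta> m \<omega>) \<le> R")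
        case True
        interpret L: prob_space "law m \<omega>" by (rule prob_batch_law)
        have i: "integrable (law m \<omega>) (\<lambda>b. batch_dir (\<tau> m) (J m) (\<Theta> m \<omega>) b $ i)"
          by (rule int[OF conjunct2[OF True] pos(1) T pos(2)])
        have "(\<lambda>b. H (\<omega>, b)) = (\<lambda>b. a m * G \<omega> * \<delta> m (\<Theta> m \<omega>) b i)" using True by (auto simp: H_def h_def)
        moreover have "integrable (law m \<omega>) (\<lambda>b. \<delta> m (\<Theta> m \<omega>) b i)" unfolding \<delta>_def using i by simp
        moreover have "(\<integral>b. \<delta> m (\<Theta> m \<omega>) b i \<partial>law m \<omega>) = 0" unfolding \<delta>_def using i by (simp add: L.prob_space)
        ultimately show ?thesis by simp
      next
        case False
        hence "(\<lambda>b. H (\<omega>, b)) = (\<lambda>b. 0)" by (auto simp: H_def h_def)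
        thus ?thesis by simp
      qed
    qed
    thus "(\<integral>\<omega>. \<xi> i m \<omega> * G \<omega> \<partial>P) = 0" by (simp add: H_def \<xi>_def)
  qed
  have "AE \<omega> in P. \<forall>i\<in>UNIV. summable (\<lambda>m. \<xi> i m \<omega>)" by (rule AE_finite_allI) (use conv in auto)
  thus ?thesis
  proof eventually_elim
    case (elim \<omega>)
    show ?case
    proof
      assume \<Theta>R: "\<forall>m. norm (\<Theta> m \<omega>) \<le> R"
      define n where "n m = (\<chi> i. if m0 \<le> m then \<delta> m (\<Theta> m \<omega>) (Y m \<omega>) i else 0)" for m
      define b where "b m = batch_dir (\<tau> m) (J m) (\<Theta> m \<omega>) (Y m \<omega>) - gr (\<Theta> m \<omega>) - n m" for m
      have "summable (\<lambda>m. a m *\<^sub>R n m)"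
      proof (rule summable_vec)
        fix i
        have "(\<lambda>m. (a m *\<^sub>R n m) $ i) = (\<lambda>m. \<xi> i m \<omega>)" using \<Theta>R by (auto simp: n_def \<xi>_def h_def)
        thus "summable (\<lambda>m. (a m *\<^sub>R n m) $ i)" using elim by simp
      qed
      moreover have "b \<longlonglongrightarrow> 0"
      proof (rule vec_tendstoI)
        fix i
        show "(\<lambda>m. b m $ i) \<longlonglongrightarrow> 0 $ i"
        proof (simp, rule Lim_null_comparison)
          show "\<forall>\<^sub>F m in sequentially. norm (b m $ i) \<le> c * (\<tau> m + 1 / (\<tau> m * J m) + q ^ J m / (\<tau> m)\<^sup>2)"
            using eventually_ge_at_top[of m0]
          proof eventually_elim
            case (elim m)
            thus ?case using mean[OF \<Theta>R[rule_format, of m] pos(1)[of m] T pos(2)[of m], of i] by (simp add: b_def n_def \<delta>_def)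
          qed
          show "(\<lambda>m. c * (\<tau> m + 1 / (\<tau> m * J m) + q ^ J m / (\<tau> m)\<^sup>2)) \<longlonglongrightarrow> 0"
            by (rule tendsto_mult_right_zero[OF asym(1)])
        qed
      qed
      moreover have "\<Theta> (Suc m) \<omega> = \<Theta> m \<omega> + a m *\<^sub>R (gr (\<Theta> m \<omega>) + b m + n m)" for m
        unfolding estimate_Suc by (simp add: b_def)
      ultimately show "\<exists>b \<xi>. b \<longlonglongrightarrow> 0 \<and> summable (\<lambda>m. a m *\<^sub>R \<xi> m) \<and>
         (\<forall>m. \<Theta> (Suc m) \<omega> = \<Theta> m \<omega> + a m *\<^sub>R (gr (\<Theta> m \<omega>) + b m + \<xi> m))" by blast
    qed
  qed
qed

end

section \<open>Almost sure convergence of the estimates\<close>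

theorem theorem2:
  fixes P :: "'w measure" and \<mu> :: "'x measure" and \<nu> :: "'y measure"
    and f_XY f_YX :: "real^'p \<Rightarrow> 'x \<Rightarrow> 'y \<Rightarrow> real" and y_obs :: 'y
    and \<kappa> :: "real^'p \<Rightarrow> real" and a \<tau> :: "nat \<Rightarrow> real" and J :: "nat \<Rightarrow> nat"
    and \<theta>1 \<theta>_mle :: "real^'p"
    and Z :: "nat \<Rightarrow> nat \<Rightarrow> 'w \<Rightarrow> real^'p" and X :: "nat \<Rightarrow> nat \<Rightarrow> 'w \<Rightarrow> 'x"
    and K0 :: "(real^'p) set"
  defines "l \<equiv> log_likelihood \<mu> f_XY y_obs"
    and "\<Theta> \<equiv> iis_estimate (\<lambda>\<theta> x. f_YX \<theta> x y_obs) (covariance_matrix (density lborel \<kappa>))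
                 a \<tau> J \<theta>1 Z X"
  assumes "sigma_finite_measure \<mu>" and "sigma_finite_measure \<nu>"
    and "joint_density \<mu> \<nu> f_XY" and "conditional_density \<mu> \<nu> f_XY f_YX"
    and "y_obs \<in> space \<nu>"
    and "\<forall>\<theta>. 0 < marginal_Y \<mu> f_XY \<theta> y_obs"
    and mle: "is_arg_max l (\<lambda>_. True) \<theta>_mle"
    and "perturbation_density \<kappa>"
    and "\<forall>m. 0 < a m" and "\<forall>m. 0 < \<tau> m" and "\<forall>m. 0 < J m"
    and "\<tau> \<longlonglongrightarrow> 0" and "filterlim (\<lambda>m. real (J m) * \<tau> m) at_top sequentially"
    and "a \<longlonglongrightarrow> 0" and "\<not> summable a"
    and "summable (\<lambda>m. (a m)\<^sup>2 * inverse (real (J m)) * inverse ((\<tau> m)\<^sup>2))"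
    and "prob_space P"
    and "monte_carlo_draws P \<mu> (marginal_X \<nu> f_XY) \<kappa> \<tau> J \<Theta> Z X"
    and i: "compact K0" "\<forall>z. z \<notin> K0 \<longrightarrow> \<kappa> z = 0"
    and ii: "twice_differentiable l"
      "\<forall>K1. compact K1 \<longrightarrow> bdd_above ((\<lambda>\<theta>. norm (grad l \<theta>)) ` K1)"
      "\<forall>K1. compact K1 \<longrightarrow> bdd_above ((\<lambda>\<theta>. max_abs_eigenvalue (hess l \<theta>)) ` K1)"
    and iii: "\<forall>K3. compact K3 \<longrightarrow> bdd_above {f_YX \<theta> x y_obs | \<theta> x. \<theta> \<in> K3 \<and> x \<in> space \<mu>}"
    and iv: "asymptotically_stable l \<theta>_mle"
    and v: "AE \<omega> in P. bounded (range (\<lambda>m. \<Theta> m \<omega>))"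
      "AE \<omega> in P. \<exists>K. compact K \<and> K \<subseteq> attraction_domain l \<theta>_mle \<and> (\<exists>\<^sub>\<infinity>m. \<Theta> m \<omega> \<in> K)"
  shows "AE \<omega> in P. (\<lambda>m. \<Theta> m \<omega>) \<longlonglongrightarrow> \<theta>_mle"
proof -
  have av: "\<forall>m. 0 < a m" "\<forall>m. 0 < \<tau> m" "\<forall>m. 0 < J m" by fact+
  have fY: "marginal_Y \<mu> f_XY \<theta> y_obs = exp (l \<theta>)" for \<theta>
    using \<open>\<forall>\<theta>. 0 < marginal_Y \<mu> f_XY \<theta> y_obs\<close> by (simp add: l_def log_likelihood_def)
  have dl: "(l has_derivative (\<lambda>h. grad l \<theta> \<bullet> h)) (at \<theta>)" for \<theta>
    using ii(1) has_derivative_grad by (auto simp: twice_differentiable_def)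
  have lip: "\<exists>L\<ge>0. \<forall>x\<in>cball 0 R. \<forall>y\<in>cball 0 R. norm (grad l x - grad l y) \<le> L * norm (x - y)" for R
    using grad_lipschitz_on_cball[OF ii(1) ii(3)] by metis
  interpret run: importance_sampling_run \<mu> \<nu> f_XY f_YX y_obs \<kappa> P a \<tau> J \<theta>1 Z X
    unfolding importance_sampling_run_def importance_sampling_model_def importance_sampling_run_axioms_def
    using assms(3-7,10,19) assms(20)[unfolded \<Theta>_def] by blast
  have max: "l x \<le> l \<theta>_mle" for x
    using mle by (auto simp: is_arg_max_def not_less)
  obtain r where r: "r > 0" "\<And>x. norm (x - \<theta>_mle) \<le> r \<Longrightarrow> grad l x = 0 \<Longrightarrow> x = \<theta>_mle"
    using isolated_critical_point[OF iv] by blast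
  have "AE \<omega> in P. (\<forall>m. norm (\<Theta> m \<omega>) \<le> real n) \<longrightarrow>
    (\<exists>b \<xi>. b \<longlonglongrightarrow> 0 \<and> summable (\<lambda>m. a m *\<^sub>R \<xi> m) \<and>
       (\<forall>m. \<Theta> (Suc m) \<omega> = \<Theta> m \<omega> + a m *\<^sub>R (grad l (\<Theta> m \<omega>) + b m + \<xi> m)))" for n
    unfolding \<Theta>_def
    by (rule run.noise_decomposition[OF i dl lip fY iii]) (use av assms(14,15,18) in auto)
  hence "AE \<omega> in P. \<forall>n::nat. (\<forall>m. norm (\<Theta> m \<omega>) \<le> real n) \<longrightarrow>
    (\<exists>b \<xi>. b \<longlonglongrightarrow> 0 \<and> summable (\<lambda>m. a m *\<^sub>R \<xi> m) \<and>
       (\<forall>m. \<Theta> (Suc m) \<omega> = \<Theta> m \<omega> + a m *\<^sub>R (grad l (\<Theta> m \<omega>) + b m + \<xi> m)))"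
    by (subst AE_all_countable) blast
  with v show ?thesis
  proof eventually_elim
    case (elim \<omega>)
    obtain C where C: "\<And>m. norm (\<Theta> m \<omega>) \<le> C" using elim(1) by (auto simp: bounded_iff)
    \<comment> \<open>countably many radii suffice, so the exceptional sets form a null set\<close>
    obtain n :: nat where "C \<le> real n" using real_arch_simple by blast
    hence "\<forall>m. norm (\<Theta> m \<omega>) \<le> real n" using C order_trans by blast
    then obtain b \<xi> where b: "b \<longlonglongrightarrow> 0" and \<xi>: "summable (\<lambda>m. a m *\<^sub>R \<xi> m)"
      and rec: "\<And>m. \<Theta> (Suc m) \<omega> = \<Theta> m \<omega> + a m *\<^sub>R (grad l (\<Theta> m \<omega>) + b m + \<xi> m)"
      using elim(3) by blast
    obtain K where K: "compact K" "K \<subseteq> attraction_domain l \<theta>_mle" "\<exists>\<^sub>\<infinity>m. \<Theta> m \<omega> \<in> K" using elim(2) by blast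
    have flow: "\<exists>\<zeta>. \<zeta> 0 = y \<and> (\<forall>t\<ge>0. (\<zeta> has_vector_derivative grad l (\<zeta> t)) (at t within {0..})) \<and>
        (\<zeta> \<longlongrightarrow> \<theta>_mle) at_top" if "y \<in> K" for y
      using K(2) that unfolding attraction_domain_def gradient_flow_def by blast
    show ?case
      by (rule noisy_gradient_ascent_converges[OF dl lip max r _ \<open>a \<longlonglongrightarrow> 0\<close> \<open>\<not> summable a\<close> b \<xi> rec elim(1) K(1,3) flow])
        (use av in auto)
  qed
qed

end
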